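(* Let $M$ be a manifold of dimension $n$. If $U$ is a ball in $M$, then the simplicial set $\Gamma(U,\mathbf{FMet})$ is contractible.
   Context: $\mathbf{FMet}$ is the simplicial presheaf on $M$ such that $\Gamma(U,\mathbf{FMet}[d])$ is the set of smooth families of flat Riemannian metrics on the open set $U\subset M$, parametrised by the simplex $\Delta^d$. "Ball" means an open subset diffeomorphic to $\{x\in\mathbb R^n:\|x\|<1\}$. Contractible means weakly equivalent to a point. *)

theory Defs
  imports "HOL-Analysis.Analysis" "HOL-Homology.Simplices"
begin

section \<open>Smooth functions on subsets of $\mathbb{R}^N$\<close>

text \<open>
  Since the dimension of the simplices varies, and dimension 0 is to be included, $\mathbb{R}^N$ is
  \<^term>\<open>Euclidean_space N\<close>: the functions \<^typ>\<open>nat \<Rightarrow> real\<close> vanishing from \<open>N\<close> onwards.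
\<close>

primrec C_k :: "nat \<Rightarrow> nat \<Rightarrow> (nat \<Rightarrow> real) set \<Rightarrow> ((nat \<Rightarrow> real) \<Rightarrow> real) \<Rightarrow> bool" where
  "C_k 0 N W f \<longleftrightarrow> continuous_map (subtopology (Euclidean_space N) W) euclideanreal f"
| "C_k (Suc k) N W f \<longleftrightarrow>
     continuous_map (subtopology (Euclidean_space N) W) euclideanreal f \<and>
     (\<forall>i<N. \<exists>f'. (\<forall>x\<in>W. ((\<lambda>t. f (x(i := t))) has_real_derivative f' x) (at (x i))) \<and> C_k k N W f')"

text \<open>On an arbitrary subset, smooth means locally the restriction of a \<open>C\<^sup>\<infinity>\<close> function defined on
  an open set of $\mathbb{R}^N$. For open subsets this is ordinary smoothness.\<close>

definition smooth_on_subset :: "nat \<Rightarrow> (nat \<Rightarrow> real) set \<Rightarrow> ((nat \<Rightarrow> real) \<Rightarrow> real) \<Rightarrow> bool" where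
  "smooth_on_subset N S f \<longleftrightarrow>
     (\<forall>x\<in>S. \<exists>W F. openin (Euclidean_space N) W \<and> x \<in> W \<and> (\<forall>k. C_k k N W F) \<and>
        (\<forall>y\<in>W \<inter> S. F y = f y))"

definition partial_deriv :: "nat \<Rightarrow> ((nat \<Rightarrow> real) \<Rightarrow> real) \<Rightarrow> (nat \<Rightarrow> real) \<Rightarrow> real" where
  "partial_deriv i f x = deriv (\<lambda>t. f (x(i := t))) (x i)"


section \<open>Smooth manifolds\<close>

text \<open>A chart is a pair of a domain and a coordinate map, of which only the values on the domain
  matter.\<close>

type_synonym 'a chart = "'a set \<times> ('a \<Rightarrow> nat \<Rightarrow> real)"

definition is_chart :: "nat \<Rightarrow> 'a topology \<Rightarrow> 'a chart \<Rightarrow> bool" where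
  "is_chart n M = (\<lambda>(V, \<phi>). openin M V \<and> openin (Euclidean_space n) (\<phi> ` V) \<and>
     homeomorphic_map (subtopology M V) (subtopology (Euclidean_space n) (\<phi> ` V)) \<phi>)"

definition transition :: "'a chart \<Rightarrow> 'a chart \<Rightarrow> (nat \<Rightarrow> real) \<Rightarrow> (nat \<Rightarrow> real)" where
  "transition c c' x = snd c' (inv_into (fst c) (snd c) x)"

definition smooth_transition :: "nat \<Rightarrow> 'a chart \<Rightarrow> 'a chart \<Rightarrow> bool" where
  "smooth_transition n c c' \<longleftrightarrow>
     (\<forall>k<n. smooth_on_subset n (snd c ` (fst c \<inter> fst c')) (\<lambda>x. transition c c' x k))"

text \<open>The smooth structure is given as a maximal atlas \<open>A\<close>.\<close>

definition smooth_manifold :: "nat \<Rightarrow> 'a topology \<Rightarrow> 'a chart set \<Rightarrow> bool" where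
  "smooth_manifold n M A \<longleftrightarrow>
     Hausdorff_space M \<and>
     (\<exists>\<B>. countable \<B> \<and> (\<forall>V\<in>\<B>. openin M V) \<and>
        (\<forall>W p. openin M W \<and> p \<in> W \<longrightarrow> (\<exists>V\<in>\<B>. p \<in> V \<and> V \<subseteq> W))) \<and>
     (\<forall>c\<in>A. is_chart n M c) \<and>
     (\<Union>c\<in>A. fst c) = topspace M \<and>
     (\<forall>c\<in>A. \<forall>c'\<in>A. smooth_transition n c c') \<and>
     (\<forall>c. is_chart n M c \<and> (\<forall>c'\<in>A. smooth_transition n c c' \<and> smooth_transition n c' c) \<longrightarrow> c \<in> A)"

definition unit_ball :: "nat \<Rightarrow> (nat \<Rightarrow> real) set" where
  "unit_ball n = {x \<in> topspace (Euclidean_space n). sqrt (\<Sum>i<n. (x i)\<^sup>2) < 1}"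

text \<open>Diffeomorphisms from an open subset \<open>U\<close> of \<open>M\<close> onto an open subset \<open>B\<close> of $\mathbb{R}^n$:
  \<open>f\<close> and its inverse are continuous, and smooth in all charts of \<open>M\<close>.\<close>

definition diffeomorphism :: "nat \<Rightarrow> 'a topology \<Rightarrow> 'a chart set \<Rightarrow> 'a set \<Rightarrow> (nat \<Rightarrow> real) set
    \<Rightarrow> ('a \<Rightarrow> nat \<Rightarrow> real) \<Rightarrow> bool" where
  "diffeomorphism n M A U B f \<longleftrightarrow>
     homeomorphic_map (subtopology M U) (subtopology (Euclidean_space n) B) f \<and>
     (\<forall>(V, \<phi>)\<in>A. \<forall>k<n.
        smooth_on_subset n (\<phi> ` (V \<inter> U)) (\<lambda>x. f (inv_into V \<phi> x) k) \<and>
        smooth_on_subset n (f ` (V \<inter> U)) (\<lambda>x. \<phi> (inv_into U f x) k))"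

definition is_ball :: "nat \<Rightarrow> 'a topology \<Rightarrow> 'a chart set \<Rightarrow> 'a set \<Rightarrow> bool" where
  "is_ball n M A U \<longleftrightarrow> openin M U \<and> (\<exists>f. diffeomorphism n M A U (unit_ball n) f)"


section \<open>Flat Riemannian metrics\<close>

text \<open>A tangent vector at \<open>p\<close> assigns to each chart around \<open>p\<close> its components in that chart, subject to
  the transformation law. Functions take the value 0 where they are not meaningful, so that equal
  tangent vectors (and, below, equal metrics) are equal functions.\<close>

type_synonym 'a tangent = "'a chart \<Rightarrow> nat \<Rightarrow> real"

definition jacobian :: "'a chart \<Rightarrow> 'a chart \<Rightarrow> 'a \<Rightarrow> nat \<Rightarrow> nat \<Rightarrow> real" where
  "jacobian c c' p k i = partial_deriv i (\<lambda>x. transition c c' x k) (snd c p)"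

definition tangent_space :: "nat \<Rightarrow> 'a chart set \<Rightarrow> 'a \<Rightarrow> 'a tangent set" where
  "tangent_space n A p =
     {v. (\<forall>c\<in>A. \<forall>c'\<in>A. p \<in> fst c \<and> p \<in> fst c' \<longrightarrow>
            (\<forall>k<n. v c' k = (\<Sum>i<n. jacobian c c' p k i * v c i))) \<and>
         (\<forall>c k. c \<notin> A \<or> p \<notin> fst c \<or> n \<le> k \<longrightarrow> v c k = 0)}"

text \<open>The coordinate vector $\partial/\partial x_i$ of the chart \<open>c\<close> at \<open>p\<close>.\<close>

definition coord_vector :: "nat \<Rightarrow> 'a chart set \<Rightarrow> 'a chart \<Rightarrow> nat \<Rightarrow> 'a \<Rightarrow> 'a tangent" where
  "coord_vector n A c i p =
     (\<lambda>c' k. if c' \<in> A \<and> p \<in> fst c' \<and> k < n then jacobian c c' p k i else 0)"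

definition inner_product_on :: "'a tangent set \<Rightarrow> ('a tangent \<Rightarrow> 'a tangent \<Rightarrow> real) \<Rightarrow> bool" where
  "inner_product_on T b \<longleftrightarrow>
     (\<forall>v\<in>T. \<forall>w\<in>T. b v w = b w v) \<and>
     (\<forall>u\<in>T. \<forall>v\<in>T. \<forall>w\<in>T. \<forall>r s. b (\<lambda>c k. r * u c k + s * v c k) w = r * b u w + s * b v w) \<and>
     (\<forall>v\<in>T. v \<noteq> (\<lambda>c k. 0) \<longrightarrow> 0 < b v v)"

type_synonym 'a metric_field = "'a \<Rightarrow> 'a tangent \<Rightarrow> 'a tangent \<Rightarrow> real"

definition metric_component ::
    "nat \<Rightarrow> 'a chart set \<Rightarrow> 'a metric_field \<Rightarrow> 'a chart \<Rightarrow> nat \<Rightarrow> nat \<Rightarrow> 'a \<Rightarrow> real" where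
  "metric_component n A g c i j p = g p (coord_vector n A c i p) (coord_vector n A c j p)"

definition riemannian_metric :: "nat \<Rightarrow> 'a chart set \<Rightarrow> 'a set \<Rightarrow> 'a metric_field \<Rightarrow> bool" where
  "riemannian_metric n A U g \<longleftrightarrow>
     (\<forall>p\<in>U. inner_product_on (tangent_space n A p) (g p)) \<and>
     (\<forall>(V, \<phi>)\<in>A. \<forall>i<n. \<forall>j<n.
        smooth_on_subset n (\<phi> ` (V \<inter> U))
          (\<lambda>x. metric_component n A g (V, \<phi>) i j (inv_into V \<phi> x))) \<and>
     (\<forall>p v w. p \<notin> U \<or> v \<notin> tangent_space n A p \<or> w \<notin> tangent_space n A p \<longrightarrow> g p v w = 0)"

text \<open>Flat means locally isometric to Euclidean space. As \<open>A\<close> is maximal, the local isometries to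
  $\mathbb{R}^n$ are the charts in which the metric has components \<open>\<delta>\<^sub>i\<^sub>j\<close>.\<close>

definition flat_metric :: "nat \<Rightarrow> 'a chart set \<Rightarrow> 'a set \<Rightarrow> 'a metric_field \<Rightarrow> bool" where
  "flat_metric n A U g \<longleftrightarrow>
     riemannian_metric n A U g \<and>
     (\<forall>p\<in>U. \<exists>c\<in>A. p \<in> fst c \<and> fst c \<subseteq> U \<and>
        (\<forall>q\<in>fst c. \<forall>i<n. \<forall>j<n. metric_component n A g c i j q = (if i = j then 1 else 0)))"


section \<open>Simplicial sets\<close>

definition simplex_maps :: "nat \<Rightarrow> nat \<Rightarrow> (nat \<Rightarrow> nat) set" where
  "simplex_maps m d = {\<theta> \<in> {..m} \<rightarrow>\<^sub>E {..d}. mono_on {..m} \<theta>}"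

text \<open>\<^term>\<open>act X m d \<theta>\<close> is the operator from \<open>d\<close>-simplices to \<open>m\<close>-simplices induced by
  $\theta : [m] \to [d]$.\<close>

record 'x sset =
  simplices :: "nat \<Rightarrow> 'x set"
  act :: "nat \<Rightarrow> nat \<Rightarrow> (nat \<Rightarrow> nat) \<Rightarrow> 'x \<Rightarrow> 'x"

definition simplicial_set :: "'x sset \<Rightarrow> bool" where
  "simplicial_set X \<longleftrightarrow>
     (\<forall>m d. \<forall>\<theta>\<in>simplex_maps m d. \<forall>x\<in>simplices X d. act X m d \<theta> x \<in> simplices X m) \<and>
     (\<forall>d. \<forall>x\<in>simplices X d. act X d d (restrict id {..d}) x = x) \<and>
     (\<forall>k m d. \<forall>\<eta>\<in>simplex_maps k m. \<forall>\<theta>\<in>simplex_maps m d. \<forall>x\<in>simplices X d.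
        act X k d (compose {..k} \<theta> \<eta>) x = act X k m \<eta> (act X m d \<theta> x))"

definition sset_map :: "'x sset \<Rightarrow> 'y sset \<Rightarrow> (nat \<Rightarrow> 'x \<Rightarrow> 'y) \<Rightarrow> bool" where
  "sset_map X Y f \<longleftrightarrow>
     (\<forall>d. \<forall>x\<in>simplices X d. f d x \<in> simplices Y d) \<and>
     (\<forall>m d. \<forall>\<theta>\<in>simplex_maps m d. \<forall>x\<in>simplices X d.
        f m (act X m d \<theta> x) = act Y m d \<theta> (f d x))"

definition sset_point :: "unit sset" where
  "sset_point = \<lparr>simplices = (\<lambda>d. {()}), act = (\<lambda>m d \<theta> x. ())\<rparr>"


section \<open>Geometric realization and weak equivalences\<close>

text \<open>The map of topological simplices induced by $\theta : [m] \to [d]$, in barycentric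
  coordinates.\<close>

definition simplex_push :: "nat \<Rightarrow> (nat \<Rightarrow> nat) \<Rightarrow> (nat \<Rightarrow> real) \<Rightarrow> (nat \<Rightarrow> real)" where
  "simplex_push m \<theta> s = (\<lambda>j. \<Sum>i\<in>{i\<in>{..m}. \<theta> i = j}. s i)"

type_synonym 'x cell_point = "(nat \<times> 'x) \<times> (nat \<Rightarrow> real)"

definition cells :: "'x sset \<Rightarrow> 'x cell_point topology" where
  "cells X = sum_topology (\<lambda>(d, x). subtopology (powertop_real UNIV) (standard_simplex d))
               (SIGMA d:UNIV. simplices X d)"

inductive glue :: "'x sset \<Rightarrow> 'x cell_point \<Rightarrow> 'x cell_point \<Rightarrow> bool" for X where
  "\<theta> \<in> simplex_maps m d \<Longrightarrow> x \<in> simplices X d \<Longrightarrow> s \<in> standard_simplex m \<Longrightarrow>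
     glue X ((m, act X m d \<theta> x), s) ((d, x), simplex_push m \<theta> s)"

definition cell_class :: "'x sset \<Rightarrow> 'x cell_point \<Rightarrow> 'x cell_point set" where
  "cell_class X a = {b. equivclp (glue X) a b}"

definition quotient_topology :: "'b topology \<Rightarrow> ('b \<Rightarrow> 'c) \<Rightarrow> 'c topology" where
  "quotient_topology T q =
     topology (\<lambda>W. W \<subseteq> q ` topspace T \<and> openin T {x \<in> topspace T. q x \<in> W})"

lemma istopology_quotient:
  "istopology (\<lambda>W. W \<subseteq> q ` topspace T \<and> openin T {x \<in> topspace T. q x \<in> W})"
proof -
  have inter: "{x \<in> topspace T. q x \<in> V \<inter> W} =
      {x \<in> topspace T. q x \<in> V} \<inter> {x \<in> topspace T. q x \<in> W}" for V W
    by blast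
  have union: "{x \<in> topspace T. q x \<in> \<Union>\<K>} = (\<Union>W\<in>\<K>. {x \<in> topspace T. q x \<in> W})" for \<K>
    by blast
  show ?thesis
    unfolding istopology_def inter union by (auto intro: openin_Union)
qed

lemma openin_quotient_topology:
  "openin (quotient_topology T q) W \<longleftrightarrow>
     W \<subseteq> q ` topspace T \<and> openin T {x \<in> topspace T. q x \<in> W}"
  by (simp add: quotient_topology_def topology_inverse'[OF istopology_quotient])

definition realization :: "'x sset \<Rightarrow> 'x cell_point set topology" where
  "realization X = quotient_topology (cells X) (cell_class X)"

text \<open>The union below is over the representatives of the class \<open>C\<close>, all of which give the same
  class when \<open>f\<close> is a simplicial map.\<close>

definition realization_map ::
    "'y sset \<Rightarrow> (nat \<Rightarrow> 'x \<Rightarrow> 'y) \<Rightarrow> 'x cell_point set \<Rightarrow> 'y cell_point set" where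
  "realization_map Y f C = (\<Union>((d, x), s)\<in>C. cell_class Y ((d, f d x), s))"

definition sphere_base :: "nat \<Rightarrow> real" where
  "sphere_base = (\<lambda>i. if i = 0 then 1 else 0)"

definition pointed_homotopic ::
    "nat \<Rightarrow> 'b topology \<Rightarrow> 'b \<Rightarrow> ((nat \<Rightarrow> real) \<Rightarrow> 'b) \<Rightarrow> ((nat \<Rightarrow> real) \<Rightarrow> 'b) \<Rightarrow> bool" where
  "pointed_homotopic k X x = homotopic_with (\<lambda>h. h sphere_base = x) (nsphere k) X"

text \<open>The underlying set of the \<open>k\<close>-th homotopy group. The group structure is not needed: induced maps
  are homomorphisms, so they are isomorphisms as soon as they are bijective.\<close>

definition homotopy_group :: "nat \<Rightarrow> 'b topology \<Rightarrow> 'b \<Rightarrow> ((nat \<Rightarrow> real) \<Rightarrow> 'b) set set" where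
  "homotopy_group k X x =
     (\<lambda>h. {h'. pointed_homotopic k X x h h'}) `
       {h. continuous_map (nsphere k) X h \<and> h sphere_base = x}"

definition homotopy_group_map ::
    "nat \<Rightarrow> 'c topology \<Rightarrow> 'c \<Rightarrow> ('b \<Rightarrow> 'c) \<Rightarrow> ((nat \<Rightarrow> real) \<Rightarrow> 'b) set \<Rightarrow> ((nat \<Rightarrow> real) \<Rightarrow> 'c) set"
  where
  "homotopy_group_map k Y y f C = (\<Union>h\<in>C. {h'. pointed_homotopic k Y y (f \<circ> h) h'})"

definition weak_homotopy_equivalence :: "'b topology \<Rightarrow> 'c topology \<Rightarrow> ('b \<Rightarrow> 'c) \<Rightarrow> bool" where
  "weak_homotopy_equivalence X Y f \<longleftrightarrow>
     continuous_map X Y f \<and>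
     bij_betw (\<lambda>C. \<Union>x\<in>C. path_component_of_set Y (f x))
       (path_components_of X) (path_components_of Y) \<and>
     (\<forall>x\<in>topspace X. \<forall>k\<ge>1.
        bij_betw (homotopy_group_map k Y (f x) f) (homotopy_group k X x) (homotopy_group k Y (f x)))"

definition weak_equivalence :: "'x sset \<Rightarrow> 'y sset \<Rightarrow> (nat \<Rightarrow> 'x \<Rightarrow> 'y) \<Rightarrow> bool" where
  "weak_equivalence X Y f \<longleftrightarrow>
     simplicial_set X \<and> simplicial_set Y \<and> sset_map X Y f \<and>
     weak_homotopy_equivalence (realization X) (realization Y) (realization_map Y f)"

definition sset_contractible :: "'x sset \<Rightarrow> bool" where
  "sset_contractible X \<longleftrightarrow> weak_equivalence X sset_point (\<lambda>d x. ())"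


section \<open>The simplicial set of sections of FMet over \<open>U\<close>\<close>

text \<open>A \<open>d\<close>-simplex is a family \<open>G\<close> of flat metrics on \<open>U\<close> indexed by the points of the standard
  simplex. Smoothness is joint: a point of $\phi(V \cap U) \times \Delta^d$ is encoded as a vector
  \<open>z\<close> in $\mathbb{R}^{n+(d+1)}$, its first \<open>n\<close> entries being the coordinates in the chart \<open>(V, \<phi>)\<close> and
  the remaining ones the barycentric coordinates.\<close>

definition chart_part :: "nat \<Rightarrow> (nat \<Rightarrow> real) \<Rightarrow> (nat \<Rightarrow> real)" where
  "chart_part n z = (\<lambda>k. if k < n then z k else 0)"

definition simplex_part :: "nat \<Rightarrow> (nat \<Rightarrow> real) \<Rightarrow> (nat \<Rightarrow> real)" where
  "simplex_part n z = (\<lambda>k. z (n + k))"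

definition smooth_family ::
    "nat \<Rightarrow> 'a chart set \<Rightarrow> 'a set \<Rightarrow> nat \<Rightarrow> ((nat \<Rightarrow> real) \<Rightarrow> 'a metric_field) \<Rightarrow> bool" where
  "smooth_family n A U d G \<longleftrightarrow>
     (\<forall>(V, \<phi>)\<in>A. \<forall>i<n. \<forall>j<n.
        smooth_on_subset (n + Suc d)
          {z \<in> topspace (Euclidean_space (n + Suc d)).
             chart_part n z \<in> \<phi> ` (V \<inter> U) \<and> simplex_part n z \<in> standard_simplex d}
          (\<lambda>z. metric_component n A (G (simplex_part n z)) (V, \<phi>) i j
                 (inv_into V \<phi> (chart_part n z))))"

definition FMet :: "nat \<Rightarrow> 'a chart set \<Rightarrow> 'a set \<Rightarrow> ((nat \<Rightarrow> real) \<Rightarrow> 'a metric_field) sset" where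
  "FMet n A U =
     \<lparr>simplices = (\<lambda>d. {G. (\<forall>s\<in>standard_simplex d. flat_metric n A U (G s)) \<and>
                          smooth_family n A U d G \<and>
                          (\<forall>s. s \<notin> standard_simplex d \<longrightarrow> G s = (\<lambda>p v w. 0))}),
      act = (\<lambda>m d \<theta> G s. if s \<in> standard_simplex m then G (simplex_push m \<theta> s)
                         else (\<lambda>p v w. 0))\<rparr>"

end

theory Submission
  imports Defs
begin

text \<open>
  The diffeomorphism \<open>f\<close> from \<open>U\<close> to the unit ball \<open>B\<close> belongs to the maximal atlas, so \<open>U\<close> is the domain
  of a single chart. In it a metric is a matrix-valued function \<open>a\<close> on \<open>B\<close>, and flatness says that
  locally \<open>a = (D\<psi>)\<^sup>T D\<psi>\<close> for a diffeomorphism \<open>\<psi>\<close> between open sets of $\mathbb{R}^n$. Two operations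
  preserve this. First, \<open>x \<mapsto> c a(l x)\<close> is flat for \<open>c > 0\<close> and \<open>0 < l \<le> 1\<close>, because it is the
  pullback of \<open>a\<close> under the dilation by \<open>l\<close>, up to a constant factor. Second, in the limit \<open>l = 0\<close> the
  metric becomes the constant matrix \<open>c a(0)\<close>, every constant positive definite matrix is flat, and
  these matrices form a convex cone. So a flat metric can be deformed, smoothly and without choices,
  first to the constant metric \<open>a(0)\<close> and then to a multiple of the standard metric.

  Being natural in the metric, the deformation turns a \<open>d\<close>-simplex \<open>G\<close> of flat metrics into a
  \<open>(d+1)\<close>-simplex, the cone on \<open>G\<close>: a point of the simplex \<open>\<Delta>\<^sup>d\<^sup>+\<^sup>1\<close> lies at height \<open>s\<^sub>0\<close> on the segment from
  the face opposite the vertex 0 to that vertex, and the height serves as the time of the deformation.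
  The deformation is arranged to be constant near its end, hence the cone is smooth at its apex. Cones
  are compatible with all simplicial operators, restrict to \<open>G\<close> on the face opposite the apex, and have
  the same apex for all \<open>G\<close>. Sliding points of the geometric realization along the cones towards the
  apex is then a contraction of the realization (\<open>realization_contractible_if_cone\<close>), and a contractible
  space is weakly equivalent to a point, for every choice of base points.

  Three things support this: a calculus of smooth functions closed under
  composition (\<open>smooth_on_subset_compose\<close>), the dictionary between flat metrics and their coefficient
  matrices (\<open>flat_metric_coefficients\<close>, \<open>flat_metric_metric_of\<close>), and the cone construction for the
  coefficient matrices (\<open>cone_coefficients_flat\<close>, \<open>cone_coefficients_smooth\<close>).
\<close>

abbreviation Rn :: "nat \<Rightarrow> (nat \<Rightarrow> real) set" where
  "Rn N \<equiv> topspace (Euclidean_space N)"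

abbreviation open_Rn :: "nat \<Rightarrow> (nat \<Rightarrow> real) set \<Rightarrow> bool" where
  "open_Rn N \<equiv> openin (Euclidean_space N)"


section \<open>Functions of class C^k on open subsets of Euclidean space\<close>

lemma topspace_subtopology_Euclidean_open:
  assumes "open_Rn N W"
  shows "subtopology (Euclidean_space N) W = top_of_set W"
proof -
  have "W \<subseteq> {x. \<forall>i\<ge>N. x i = 0}"
    using openin_subset[OF assms] by (simp add: topspace_Euclidean_space)
  then show ?thesis
    by (simp add: Euclidean_space_def euclidean_product_topology subtopology_subtopology Int_absorb1)
qed

lemma Euclidean_space_eq_top_of_set: "Euclidean_space N = top_of_set {x. \<forall>i\<ge>N. x i = 0}"
  by (simp add: Euclidean_space_def euclidean_product_topology)

text \<open>The topology is inherited from the product topology on all sequences, and a basic open set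
  restricts only finitely many coordinates. Since the coordinates from \<open>N\<close> on vanish, the finitely many
  conditions on the others give a cube of positive size.\<close>

lemma openin_Euclidean_space_iff_boxes:
  "open_Rn N W \<longleftrightarrow> W \<subseteq> Rn N \<and>
     (\<forall>x\<in>W. \<exists>e>0. \<forall>y\<in>Rn N. (\<forall>j<N. \<bar>y j - x j\<bar> < e) \<longrightarrow> y \<in> W)"
    (is "?L \<longleftrightarrow> ?R")
proof
  assume L: ?L
  have "\<exists>e>0. \<forall>y\<in>Rn N. (\<forall>j<N. \<bar>y j - x j\<bar> < e) \<longrightarrow> y \<in> W" if "x \<in> W" for x
  proof -
    obtain T where T: "open T" "W = T \<inter> {x. \<forall>i\<ge>N. x i = 0}"
      using L unfolding Euclidean_space_eq_top_of_set openin_open by blast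
    have "openin (product_topology (\<lambda>i. euclidean) UNIV) T"
      using T(1) by (simp add: euclidean_product_topology)
    moreover have "x \<in> T" using that T(2) by simp
    ultimately have "\<exists>X. x \<in> Pi\<^sub>E UNIV X \<and> (\<forall>i. openin euclidean (X i)) \<and>
        finite {i. X i \<noteq> topspace euclidean} \<and> Pi\<^sub>E UNIV X \<subseteq> T"
      by (rule product_topology_open_contains_basis)
    then obtain X where X: "x \<in> Pi\<^sub>E UNIV X" "\<forall>i. openin euclidean (X i)" "Pi\<^sub>E UNIV X \<subseteq> T"
      by (elim exE conjE)
    have "\<forall>i. \<exists>e. e > 0 \<and> (\<forall>u. \<bar>u - x i\<bar> < e \<longrightarrow> u \<in> X i)"
    proof
      fix i
      have "open (X i)" "x i \<in> X i"
        using X(1,2) unfolding PiE_iff by simp_all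
      then show "\<exists>e. e > 0 \<and> (\<forall>u. \<bar>u - x i\<bar> < e \<longrightarrow> u \<in> X i)"
        unfolding open_dist dist_real_def by blast
    qed
    from choice[OF this] obtain e
      where e: "\<And>i. e i > 0" "\<And>i u. \<bar>u - x i\<bar> < e i \<Longrightarrow> u \<in> X i"
      by blast
    define d where "d = Min (insert 1 (e ` {..<N}))"
    have d: "d > 0" "\<And>i. i < N \<Longrightarrow> d \<le> e i"
      unfolding d_def using e(1) by (auto simp: Min_gr_iff)
    have x0: "x i = 0" if "i \<ge> N" for i
      using \<open>x \<in> W\<close> T(2) that by auto
    have "y \<in> W" if y: "y \<in> Rn N" "\<forall>j<N. \<bar>y j - x j\<bar> < d" for y
    proof -
      have "y i \<in> X i" for i
      proof (cases "i < N")
        case True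
        then show ?thesis using e(2) d(2) y(2) by force
      next
        case False
        then show ?thesis using e x0[of i] y(1) by (auto simp: topspace_Euclidean_space)
      qed
      then have "y \<in> T" using X(3) by auto
      then show ?thesis using T(2) y(1) by (simp add: topspace_Euclidean_space)
    qed
    then show ?thesis using d(1) by blast
  qed
  then show ?R using L openin_subset by blast
next
  assume R: ?R
  show ?L
  proof (subst openin_subopen, intro ballI)
    fix x assume x: "x \<in> W"
    then obtain e where e: "e > 0"
      "\<And>y. y\<in>Rn N \<Longrightarrow> (\<forall>j<N. \<bar>y j - x j\<bar> < e) \<Longrightarrow> y \<in> W"
      using R by blast
    let ?T = "{y\<in>Rn N. \<forall>j<N. \<bar>y j - x j\<bar> < e}"
    have eq: "?T = Rn N \<inter> (\<Inter>j\<in>{..<N}. {y. \<bar>y j - x j\<bar> < e})" by auto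
    have "open (\<Inter>j\<in>{..<N}. {y. \<bar>y j - x j\<bar> < e})"
      by (intro open_INT ballI open_Collect_less continuous_intros)
         (auto intro!: continuous_intros)
    then have "open_Rn N ?T"
      unfolding eq Euclidean_space_eq_top_of_set openin_open by auto
    then show "\<exists>T. open_Rn N T \<and> x \<in> T \<and> T \<subseteq> W"
      using x e R by (intro exI[of _ ?T]) auto
  qed
qed

lemma C_k_imp_continuous_on:
  assumes "C_k k N W f" "open_Rn N W"
  shows "continuous_on W f"
proof -
  have "continuous_map (subtopology (Euclidean_space N) W) euclideanreal f"
    using assms(1) by (cases k) simp_all
  then show ?thesis by (simp add: topspace_subtopology_Euclidean_open[OF assms(2)])
qed

lemma C_k_SucD: "C_k (Suc k) N W f \<Longrightarrow> C_k k N W f"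
proof (induction k arbitrary: f)
  case (Suc k)
  have "\<exists>f'. (\<forall>x\<in>W. ((\<lambda>t. f (x(i := t))) has_real_derivative f' x) (at (x i))) \<and> C_k k N W f'"
    if i: "i < N" for i
  proof -
    obtain f' where "\<forall>x\<in>W. ((\<lambda>t. f (x(i := t))) has_real_derivative f' x) (at (x i))"
      "C_k (Suc k) N W f'"
      using Suc.prems i unfolding C_k.simps(2)[of "Suc k"] by blast
    then show ?thesis using Suc.IH by blast
  qed
  moreover have "continuous_map (subtopology (Euclidean_space N) W) euclideanreal f"
    using Suc.prems by simp
  ultimately show ?case by simp
qed simp

lemma C_k_subset: "C_k k N W f \<Longrightarrow> W' \<subseteq> W \<Longrightarrow> C_k k N W' f"
proof (induction k arbitrary: f)
  case (Suc k)
  then have "continuous_map (subtopology (Euclidean_space N) W') euclideanreal f"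
    by (auto intro: continuous_map_from_subtopology_mono)
  moreover have "\<exists>f'. (\<forall>x\<in>W'. ((\<lambda>t. f (x(i := t))) has_real_derivative f' x) (at (x i))) \<and> C_k k N W' f'"
    if i: "i < N" for i
  proof -
    obtain f' where "\<forall>x\<in>W. ((\<lambda>t. f (x(i := t))) has_real_derivative f' x) (at (x i))" "C_k k N W f'"
      using Suc.prems(1) i unfolding C_k.simps by blast
    then show ?thesis using Suc.prems(2) Suc.IH by blast
  qed
  ultimately show ?case by simp
qed (auto intro: continuous_map_from_subtopology_mono)

lemma C_k_0_iff: "open_Rn N W \<Longrightarrow> C_k 0 N W f \<longleftrightarrow> continuous_on W f"
  by (simp add: topspace_subtopology_Euclidean_open)

lemma C_k_Suc_iff: "open_Rn N W \<Longrightarrow> C_k (Suc k) N W f \<longleftrightarrow> continuous_on W f \<and>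
     (\<forall>i<N. \<exists>f'. (\<forall>x\<in>W. ((\<lambda>t. f (x(i := t))) has_real_derivative f' x) (at (x i))) \<and> C_k k N W f')"
  by (simp add: topspace_subtopology_Euclidean_open)

text \<open>The partial derivatives of \<^const>\<open>C_k\<close> vary one coordinate along all of $\mathbb{R}$. Only
  small variations matter, and these stay in an open set; this makes everything below local.\<close>

lemma eventually_update_mem:
  assumes "open_Rn N W" "x \<in> W" "i < N"
  shows "\<forall>\<^sub>F t in nhds (x i). x(i := t) \<in> W"
proof -
  obtain e where e: "e > 0"
      "\<And>y. y\<in>Rn N \<Longrightarrow> (\<forall>j<N. \<bar>y j - x j\<bar> < e) \<Longrightarrow> y \<in> W"
    using assms unfolding openin_Euclidean_space_iff_boxes by blast
  have x: "x \<in> Rn N" using assms openin_subset by blast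
  have "x(i := t) \<in> W" if "dist t (x i) < e" for t
    using that x assms(3) e(1) by (intro e(2)) (auto simp: dist_real_def topspace_Euclidean_space)
  then show ?thesis using e(1) by (auto simp: eventually_nhds_metric)
qed

lemma partial_derivative_cong:
  assumes "open_Rn N W" "x \<in> W" "i < N" "\<And>y. y \<in> W \<Longrightarrow> f y = g y"
  shows "((\<lambda>t. f (x(i := t))) has_real_derivative D) (at (x i)) \<longleftrightarrow>
         ((\<lambda>t. g (x(i := t))) has_real_derivative D) (at (x i))"
  by (intro DERIV_cong_ev refl eventually_mono[OF eventually_update_mem[OF assms(1-3)]] assms(4))

lemma C_k_cong:
  assumes "open_Rn N W" "\<And>x. x \<in> W \<Longrightarrow> f x = g x" "C_k k N W f"
  shows "C_k k N W g"
proof (cases k)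
  case 0
  then show ?thesis using assms continuous_on_cong[of W W f g] by (simp only: C_k_0_iff)
next
  case (Suc j)
  have "continuous_on W g"
    using assms C_k_imp_continuous_on continuous_on_cong[of W W f g] by metis
  then show ?thesis
    using assms partial_derivative_cong[OF assms(1) _ _ assms(2)]
    unfolding Suc C_k_Suc_iff[OF assms(1)] by meson
qed

lemma partial_deriv_cong:
  assumes "open_Rn N W" "x \<in> W" "i < N" "\<And>y. y \<in> W \<Longrightarrow> f y = g y"
  shows "partial_deriv i f x = partial_deriv i g x"
  unfolding partial_deriv_def
  by (intro deriv_cong_ev refl eventually_mono[OF eventually_update_mem[OF assms(1-3)]] assms(4))

text \<open>Derivatives are unique, so the partial derivatives that the definition of \<^const>\<open>C_k\<close> asks
  for can be replaced by explicit ones. This avoids choosing them in each proof.\<close>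

lemma C_k_Suc_iff_partial_deriv:
  assumes W: "open_Rn N W"
  shows "C_k (Suc k) N W f \<longleftrightarrow> continuous_on W f \<and>
     (\<forall>i<N. (\<forall>x\<in>W. ((\<lambda>t. f (x(i := t))) has_real_derivative partial_deriv i f x) (at (x i))) \<and>
       C_k k N W (partial_deriv i f))"
proof -
  have "C_k k N W (partial_deriv i f) \<and> (\<forall>x\<in>W. partial_deriv i f x = f' x)"
    if "\<forall>x\<in>W. ((\<lambda>t. f (x(i := t))) has_real_derivative f' x) (at (x i))" "C_k k N W f'" for i f'
  proof -
    have "\<forall>x\<in>W. partial_deriv i f x = f' x"
      using that unfolding partial_deriv_def by (auto intro: DERIV_imp_deriv)
    then show ?thesis using C_k_cong[OF W _ that(2), of "partial_deriv i f"] by auto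
  qed
  then have "(\<exists>f'. (\<forall>x\<in>W. ((\<lambda>t. f (x(i := t))) has_real_derivative f' x) (at (x i))) \<and> C_k k N W f') \<longleftrightarrow>
      (\<forall>x\<in>W. ((\<lambda>t. f (x(i := t))) has_real_derivative partial_deriv i f x) (at (x i))) \<and>
        C_k k N W (partial_deriv i f)" for i
    by auto
  then show ?thesis unfolding C_k_Suc_iff[OF W] by simp
qed

lemma C_k_locally_imp_continuous_on:
  assumes W: "open_Rn N W"
    and loc: "\<And>x. x \<in> W \<Longrightarrow> \<exists>W'. open_Rn N W' \<and> x \<in> W' \<and> C_k k N W' f"
  shows "continuous_on W f"
proof -
  have "continuous (at x within W) f" if x: "x \<in> W" for x
  proof -
    obtain W' where W': "open_Rn N W'" "x \<in> W'" "C_k k N W' f"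
      using loc[OF x] by (elim exE conjE)
    have f: "continuous_on W' f" by (rule C_k_imp_continuous_on[OF W'(3,1)])
    obtain T where T: "open T" "W' = {x. \<forall>i\<ge>N. x i = 0} \<inter> T"
      using W'(1) unfolding Euclidean_space_eq_top_of_set openin_open by (elim exE conjE)
    have "W \<subseteq> {x. \<forall>i\<ge>N. x i = 0}" using openin_subset[OF W] by (simp add: topspace_Euclidean_space)
    then have "continuous_on (W \<inter> T) f" using continuous_on_subset[OF f, of "W \<inter> T"] T(2) by blast
    moreover have "x \<in> W \<inter> T" using x W'(2) T(2) by simp
    ultimately have "continuous (at x within W \<inter> T) f"
      by (simp add: continuous_on_eq_continuous_within)
    then show ?thesis
      using at_within_nhd[of x T W "W \<inter> T"] W'(2) T by (simp add: continuous_within Int_assoc)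
  qed
  then show ?thesis by (simp add: continuous_on_eq_continuous_within)
qed

lemma C_k_local:
  assumes W: "open_Rn N W"
    and loc: "\<And>x. x \<in> W \<Longrightarrow> \<exists>W'. open_Rn N W' \<and> x \<in> W' \<and> C_k k N W' f"
  shows "C_k k N W f"
  using loc
proof (induction k arbitrary: f)
  case 0
  then show ?case unfolding C_k_0_iff[OF W] by (rule C_k_locally_imp_continuous_on[OF W])
next
  case (Suc k)
  have cont: "continuous_on W f" by (rule C_k_locally_imp_continuous_on[OF W Suc.prems])
  have "((\<lambda>t. f (x(i := t))) has_real_derivative partial_deriv i f x) (at (x i)) \<and>
       (\<exists>W'. open_Rn N W' \<and> x \<in> W' \<and> C_k k N W' (partial_deriv i f))"
    if i: "i < N" and x: "x \<in> W" for i x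
  proof -
    obtain W' where W': "open_Rn N W'" "x \<in> W'" "C_k (Suc k) N W' f"
      using Suc.prems[OF x] by (elim exE conjE)
    then show ?thesis using i unfolding C_k_Suc_iff_partial_deriv[OF W'(1)] by blast
  qed
  then show ?case using cont Suc.IH unfolding C_k_Suc_iff_partial_deriv[OF W] by simp
qed

lemma C_k_SucI:
  assumes "open_Rn N W" "continuous_on W f"
    and "\<And>i x. i < N \<Longrightarrow> x \<in> W \<Longrightarrow> ((\<lambda>t. f (x(i := t))) has_real_derivative f' i x) (at (x i))"
    and "\<And>i. i < N \<Longrightarrow> C_k k N W (f' i)"
  shows "C_k (Suc k) N W f"
  unfolding C_k_Suc_iff[OF assms(1)]
proof (intro conjI allI impI)
  fix i assume i: "i < N"
  show "\<exists>f'. (\<forall>x\<in>W. ((\<lambda>t. f (x(i := t))) has_real_derivative f' x) (at (x i))) \<and> C_k k N W f'"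
    by (intro exI[of _ "f' i"] conjI ballI assms(3,4) i)
qed (rule assms(2))

lemma C_k_Suc_DERIV:
  assumes "open_Rn N W" "C_k (Suc k) N W f" "i < N" "x \<in> W"
  shows "((\<lambda>t. f (x(i := t))) has_real_derivative partial_deriv i f x) (at (x i))"
  using assms(2-) unfolding C_k_Suc_iff_partial_deriv[OF assms(1)] by blast

lemma C_k_partial_deriv:
  assumes "open_Rn N W" "C_k (Suc k) N W f" "i < N"
  shows "C_k k N W (partial_deriv i f)"
  using assms(2-) unfolding C_k_Suc_iff_partial_deriv[OF assms(1)] by blast

lemma C_k_const: "open_Rn N W \<Longrightarrow> C_k k N W (\<lambda>x. c)"
proof (induction k arbitrary: c)
  case (Suc k)
  show ?case
    by (rule C_k_SucI[OF Suc.prems, where f' = "\<lambda>i x. 0"]) (rule continuous_on_const DERIV_const Suc)+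
qed (simp add: C_k_0_iff del: C_k.simps)

lemma C_k_coordinate:
  assumes "open_Rn N W" shows "C_k k N W (\<lambda>x. x j)"
proof -
  have c: "continuous_on W (\<lambda>x. x j)"
    using continuous_on_product_then_coordinatewise[of W "\<lambda>x. x" j] continuous_on_id[of W] by simp
  show ?thesis
  proof (cases k)
    case (Suc l)
    show ?thesis unfolding Suc
    proof (rule C_k_SucI[OF assms c, where f' = "\<lambda>i x. if i = j then 1 else 0"])
      show "((\<lambda>t. (x(i := t)) j) has_real_derivative (if i = j then 1 else 0)) (at (x i))" for x i
        by (cases "i = j") auto
    qed (rule C_k_const[OF assms])
  qed (use c assms in \<open>simp add: C_k_0_iff del: C_k.simps\<close>)
qed

lemma C_k_add:
  assumes W: "open_Rn N W"
  shows "C_k k N W f \<Longrightarrow> C_k k N W g \<Longrightarrow> C_k k N W (\<lambda>x. f x + g x)"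
proof (induction k arbitrary: f g)
  case 0
  then show ?case unfolding C_k_0_iff[OF W] by (rule continuous_on_add)
next
  case (Suc k)
  note f' = C_k_Suc_DERIV[OF W Suc.prems(1)] C_k_partial_deriv[OF W Suc.prems(1)]
  note g' = C_k_Suc_DERIV[OF W Suc.prems(2)] C_k_partial_deriv[OF W Suc.prems(2)]
  show ?case
  proof (rule C_k_SucI[OF W, where f' = "\<lambda>i x. partial_deriv i f x + partial_deriv i g x"])
    show "continuous_on W (\<lambda>x. f x + g x)"
      by (rule continuous_on_add[OF Suc.prems[THEN C_k_imp_continuous_on, OF W]])
    show "C_k k N W (\<lambda>x. partial_deriv i f x + partial_deriv i g x)" if "i < N" for i
      by (rule Suc.IH[OF f'(2)[OF that] g'(2)[OF that]])
    show "((\<lambda>t. f (x(i := t)) + g (x(i := t))) has_real_derivative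
        partial_deriv i f x + partial_deriv i g x) (at (x i))"
      if "i < N" "x \<in> W" for i x
      by (rule DERIV_add[OF f'(1)[OF that] g'(1)[OF that]])
  qed
qed

lemma C_k_mult:
  assumes W: "open_Rn N W"
  shows "C_k k N W f \<Longrightarrow> C_k k N W g \<Longrightarrow> C_k k N W (\<lambda>x. f x * g x)"
proof (induction k arbitrary: f g)
  case 0
  then show ?case unfolding C_k_0_iff[OF W] by (rule continuous_on_mult)
next
  case (Suc k)
  note f' = C_k_Suc_DERIV[OF W Suc.prems(1)] C_k_partial_deriv[OF W Suc.prems(1)]
  note g' = C_k_Suc_DERIV[OF W Suc.prems(2)] C_k_partial_deriv[OF W Suc.prems(2)]
  show ?case
  proof (rule C_k_SucI[OF W, where f' = "\<lambda>i x. partial_deriv i f x * g x + partial_deriv i g x * f x"])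
    show "continuous_on W (\<lambda>x. f x * g x)"
      by (rule continuous_on_mult[OF Suc.prems[THEN C_k_imp_continuous_on, OF W]])
    show "C_k k N W (\<lambda>x. partial_deriv i f x * g x + partial_deriv i g x * f x)" if "i < N" for i
      by (intro C_k_add[OF W] Suc.IH f'(2) g'(2) that Suc.prems[THEN C_k_SucD])
    show "((\<lambda>t. f (x(i := t)) * g (x(i := t))) has_real_derivative partial_deriv i f x * g x + partial_deriv i g x * f x) (at (x i))"
      if "i < N" "x \<in> W" for i x
      using DERIV_mult[OF f'(1)[OF that] g'(1)[OF that]] by (simp only: fun_upd_triv)
  qed
qed

lemma C_k_sum:
  assumes "open_Rn N W" "\<And>i. i \<in> I \<Longrightarrow> C_k k N W (f i)"
  shows "C_k k N W (\<lambda>x. \<Sum>i\<in>I. f i x)"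
  using assms(2)
proof (induction I rule: infinite_finite_induct)
  case (insert i I)
  have "C_k k N W (\<lambda>x. f i x + (\<Sum>i\<in>I. f i x))"
    by (intro C_k_add[OF assms(1)] insert) simp_all
  then show ?case by (simp only: sum.insert[OF insert.hyps])
qed (simp_all only: sum.infinite sum.empty C_k_const[OF assms(1)] not_False_eq_True)

text \<open>The sequence \<open>h\<close> lists a function of one variable and its successive derivatives, so that the
  induction over \<open>k\<close> can pass from \<open>h j\<close> to \<open>h (Suc j)\<close>.\<close>

lemma C_k_compose_real:
  assumes W: "open_Rn N W" and f: "C_k k N W f"
    and h: "\<And>j x. x \<in> W \<Longrightarrow> (h j has_real_derivative h (Suc j) (f x)) (at (f x))"
  shows "C_k k N W (\<lambda>x. h j (f x))"
proof -
  have cont: "continuous_on W (\<lambda>x. h j (f x))" for j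
  proof (rule continuous_on_compose2[OF _ C_k_imp_continuous_on[OF f W] order_refl])
    show "continuous_on (f ` W) (h j)"
      using h[THEN DERIV_isCont] by (intro continuous_at_imp_continuous_on) blast
  qed
  show ?thesis using f
  proof (induction k arbitrary: j)
    case 0
    then show ?case using cont C_k_0_iff[OF W] by blast
  next
    case (Suc k)
    note f' = C_k_Suc_DERIV[OF W Suc.prems] C_k_partial_deriv[OF W Suc.prems]
    show ?case
    proof (rule C_k_SucI[OF W cont, where f' = "\<lambda>i x. h (Suc j) (f x) * partial_deriv i f x"])
      show "((\<lambda>t. h j (f (x(i := t)))) has_real_derivative h (Suc j) (f x) * partial_deriv i f x) (at (x i))"
        if "i < N" "x \<in> W" for i x
        using DERIV_chain2[of "h j" _ "\<lambda>t. f (x(i := t))" "x i", OF _ f'(1)[OF that]] h[OF that(2)]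
        by simp
    qed (intro C_k_mult[OF W] Suc.IH f'(2) C_k_SucD[OF Suc.prems])
  qed
qed

text \<open>The mean value theorem without the case distinction on the order of \<open>a\<close> and \<open>b\<close>.\<close>

lemma mean_value_between:
  fixes F :: "real \<Rightarrow> real"
  assumes "\<And>u. \<bar>u - a\<bar> \<le> \<bar>b - a\<bar> \<Longrightarrow> (F has_real_derivative F' u) (at u)"
  obtains z where "\<bar>z - a\<bar> \<le> \<bar>b - a\<bar>" "F b - F a = (b - a) * F' z"
proof (cases a b rule: linorder_cases)
  case less
  have "(F has_real_derivative F' u) (at u)" if "a \<le> u" "u \<le> b" for u
    using assms[of u] that by simp
  from MVT2[OF less this] obtain z where "a < z" "z < b" "F b - F a = (b - a) * F' z" by blast
  then show ?thesis using that[of z] by simp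
next
  case equal
  then show ?thesis using that[of a] by simp
next
  case greater
  have "(F has_real_derivative F' u) (at u)" if "b \<le> u" "u \<le> a" for u
    using assms[of u] that by simp
  from MVT2[OF greater this] obtain z where "b < z" "z < a" "F a - F b = (a - b) * F' z" by blast
  then show ?thesis using that[of z] by (simp add: algebra_simps)
qed

text \<open>The chain rule for a function with continuous partial derivatives along a curve \<open>c\<close>. The
  coordinates are released one at a time: when the first \<open>m\<close> coordinates already move along the curve,
  letting coordinate \<open>m\<close> move as well changes \<open>f\<close>, by the mean value theorem, by a partial derivative at
  a nearby point times the increment of \<open>c m\<close>. Continuity of that partial derivative gives the
  derivative of the change.\<close>

lemma chain_rule_partial:
  assumes W: "open_Rn N W" and x: "x \<in> W"
    and f': "\<And>j y. j < N \<Longrightarrow> y \<in> W \<Longrightarrow> ((\<lambda>t. f (y(j := t))) has_real_derivative f' j y) (at (y j))"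
    and cont: "\<And>j. j < N \<Longrightarrow> continuous_on W (f' j)"
    and c': "\<And>j. j < N \<Longrightarrow> (c j has_real_derivative c' j) (at t0)"
    and c0: "x = (\<lambda>j. if j < N then c j t0 else 0)"
  shows "((\<lambda>t. f (\<lambda>j. if j < N then c j t else 0)) has_real_derivative (\<Sum>j<N. f' j x * c' j)) (at t0)"
proof -
  have x0: "x j = 0" if "j \<ge> N" for j using c0 that by simp
  have xc: "x j = c j t0" if "j < N" for j using c0 that by simp
  \<comment> \<open>The first \<open>m\<close> coordinates follow the curve, the others stay at their values at time \<open>t0\<close>.\<close>
  define p where "p m t = (\<lambda>j. if j < m then c j t else x j)" for m t
  have "((\<lambda>t. f (p m t)) has_real_derivative (\<Sum>j<m. f' j x * c' j)) (at t0)" if "m \<le> N" for m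
    using that
  proof (induction m)
    case 0
    then show ?case by (simp add: p_def)
  next
    case (Suc m)
    then have m: "m < N" by simp
    define D where "D t = f ((p m t)(m := c m t)) - f ((p m t)(m := x m))" for t
    define q where "q t = (if c m t = x m then f' m x else D t / (c m t - x m))" for t
    have pS: "p (Suc m) t = (p m t)(m := c m t)" "(p m t)(m := x m) = p m t" for t
      by (auto simp: p_def fun_eq_iff less_Suc_eq)
    have D0: "D t0 = 0" by (simp add: D_def xc[OF m])
    have "\<forall>\<^sub>F t in at t0. \<bar>q t - f' m x\<bar> < e" if e: "e > 0" for e
    proof -
      let ?V = "{y \<in> W. f' m y \<in> {f' m x - e <..< f' m x + e}}"
      have "openin (top_of_set W) ?V"
        using continuous_openin_preimage_gen[OF cont[OF m], of "{f' m x - e <..< f' m x + e}"]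
        by (simp add: vimage_def Int_def)
      then have "open_Rn N ?V"
        using openin_trans_full[OF _ W] topspace_subtopology_Euclidean_open[OF W] by simp
      moreover have "x \<in> ?V" using x e by simp
      ultimately obtain d where d: "d > 0"
        "\<And>y. y\<in>Rn N \<Longrightarrow> (\<forall>j<N. \<bar>y j - x j\<bar> < d) \<Longrightarrow> y \<in> ?V"
        unfolding openin_Euclidean_space_iff_boxes by blast
      have "\<forall>\<^sub>F t in at t0. \<forall>j\<in>{..<N}. \<bar>c j t - x j\<bar> < d"
      proof (intro eventually_ball_finite ballI)
        fix j assume "j \<in> {..<N}"
        then have "(c j \<longlongrightarrow> x j) (at t0)"
          using DERIV_isCont[OF c'[of j]] xc[of j] by (simp add: isCont_def)
        from tendstoD[OF this d(1)] show "\<forall>\<^sub>F t in at t0. \<bar>c j t - x j\<bar> < d"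
          by (simp add: dist_real_def)
      qed simp
      then show ?thesis
      proof (rule eventually_mono)
        fix t assume t: "\<forall>j\<in>{..<N}. \<bar>c j t - x j\<bar> < d"
        have in_V: "(p m t)(m := u) \<in> ?V" if "\<bar>u - x m\<bar> \<le> \<bar>c m t - x m\<bar>" for u
        proof (rule d(2))
          show "(p m t)(m := u) \<in> Rn N"
            using m x0 by (simp add: topspace_Euclidean_space p_def)
          show "\<forall>j<N. \<bar>((p m t)(m := u)) j - x j\<bar> < d"
            using t m d(1) le_less_trans[OF that, of d] by (auto simp: p_def)
        qed
        have "((\<lambda>s. f ((p m t)(m := s))) has_real_derivative f' m ((p m t)(m := u))) (at u)"
          if "\<bar>u - x m\<bar> \<le> \<bar>c m t - x m\<bar>" for u
        proof -
          have "(p m t)(m := u) \<in> W" using in_V[OF that] by simp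
          from f'[OF m this] show ?thesis by (simp only: fun_upd_upd fun_upd_same)
        qed
        then obtain z where z: "\<bar>z - x m\<bar> \<le> \<bar>c m t - x m\<bar>"
          "f ((p m t)(m := c m t)) - f ((p m t)(m := x m)) = (c m t - x m) * f' m ((p m t)(m := z))"
          by (rule mean_value_between[of "x m" "c m t" "\<lambda>s. f ((p m t)(m := s))" "\<lambda>u. f' m ((p m t)(m := u))"])
        have "D t = (c m t - x m) * f' m ((p m t)(m := z))"
          using z(2) unfolding D_def .
        then have "c m t \<noteq> x m \<Longrightarrow> q t = f' m ((p m t)(m := z))" by (simp add: q_def)
        moreover have "c m t = x m \<Longrightarrow> q t = f' m x" by (simp add: q_def)
        ultimately show "\<bar>q t - f' m x\<bar> < e" using in_V[OF z(1)] e by (cases "c m t = x m") auto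
      qed
    qed
    then have q: "(q \<longlongrightarrow> f' m x) (at t0)" by (simp add: tendsto_iff dist_real_def)
    have Dq: "D t = q t * (c m t - c m t0)" for t
    proof (cases "c m t = x m")
      case True
      then have "D t = 0" by (simp add: D_def)
      then show ?thesis using True xc[OF m] by simp
    next
      case False
      then show ?thesis using xc[OF m] by (simp add: q_def)
    qed
    have "((\<lambda>t. (c m t - c m t0) / (t - t0)) \<longlongrightarrow> c' m) (at t0)"
      using c'[OF m] by (simp add: has_field_derivative_iff)
    from tendsto_mult[OF q this] have "(D has_real_derivative f' m x * c' m) (at t0)"
      unfolding has_field_derivative_iff D0 by (simp add: Dq)
    moreover have "((\<lambda>t. f (p m t)) has_real_derivative (\<Sum>j<m. f' j x * c' j)) (at t0)"
      using Suc.IH m by simp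
    ultimately have "((\<lambda>t. f (p m t) + D t) has_real_derivative (\<Sum>j<m. f' j x * c' j) + f' m x * c' m) (at t0)"
      by (intro DERIV_add)
    moreover have "(\<lambda>t. f (p m t) + D t) = (\<lambda>t. f (p (Suc m) t))"
      unfolding D_def pS by simp
    ultimately show ?case by simp
  qed
  from this[OF order_refl]
  have "((\<lambda>t. f (p N t)) has_real_derivative (\<Sum>j<N. f' j x * c' j)) (at t0)" .
  moreover have "p N t = (\<lambda>j. if j < N then c j t else 0)" for t
    using x0 by (auto simp: p_def fun_eq_iff)
  ultimately show ?thesis by (simp only:)
qed

lemma openin_Euclidean_preimage:
  assumes V: "open_Rn m V" and W: "open_Rn N W"
    and g: "\<And>j. j < N \<Longrightarrow> continuous_on V (g j)"
  shows "open_Rn m {x \<in> V. (\<lambda>j. if j < N then g j x else 0) \<in> W}"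
proof -
  have "continuous_map (top_of_set V) (Euclidean_space N) (\<lambda>x j. if j < N then g j x else 0)"
    unfolding continuous_map_componentwise_Euclidean_space using g by simp
  from openin_continuous_map_preimage[OF this W]
  have "openin (top_of_set V) {x \<in> V. (\<lambda>j. if j < N then g j x else 0) \<in> W}"
    by simp
  then show ?thesis
    using openin_trans_full[OF _ V] topspace_subtopology_Euclidean_open[OF V] by simp
qed

text \<open>Induction over \<open>k\<close>: by the chain rule the partial derivatives of the composition are sums of
  products of functions to which the induction hypothesis applies. The \<open>if\<close> pads the tuple of the
  functions \<open>g j\<close> to a point of $\mathbb{R}^N$.\<close>

lemma C_k_compose:
  assumes V: "open_Rn m V" and W: "open_Rn N W"
    and g: "\<And>j. j < N \<Longrightarrow> C_k k m V (g j)"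
    and gW: "\<And>x. x \<in> V \<Longrightarrow> (\<lambda>j. if j < N then g j x else 0) \<in> W"
    and f: "C_k k N W f"
  shows "C_k k m V (\<lambda>x. f (\<lambda>j. if j < N then g j x else 0))"
  using g f
proof (induction k arbitrary: f)
  have cont: "continuous_on V (\<lambda>x. f (\<lambda>j. if j < N then g j x else 0))"
    if g: "\<And>j. j < N \<Longrightarrow> C_k k m V (g j)" and f: "C_k k N W f" for k f
  proof (rule continuous_on_compose2[OF C_k_imp_continuous_on[OF f W]])
    show "continuous_on V (\<lambda>x j. if j < N then g j x else 0)"
    proof (rule continuous_on_coordinatewise_then_product)
      fix j show "continuous_on V (\<lambda>x. if j < N then g j x else 0)"
        using C_k_imp_continuous_on[OF g V] by (cases "j < N") simp_all
    qed
  qed (use gW in blast)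
  {
    case 0
    then show ?case using cont[of 0 f] C_k_0_iff[OF V] by blast
  next
    case (Suc k)
    let ?G = "\<lambda>x j. if j < N then g j x else 0"
    note g = Suc.prems(1)[THEN C_k_SucD] and f = C_k_SucD[OF Suc.prems(2)]
    show ?case
    proof (rule C_k_SucI[OF V cont[OF g f], where f' = "\<lambda>i x. \<Sum>j<N. partial_deriv j f (?G x) * partial_deriv i (g j) x"])
      fix i assume i: "i < m"
      show "C_k k m V (\<lambda>x. \<Sum>j<N. partial_deriv j f (?G x) * partial_deriv i (g j) x)"
      proof (rule C_k_sum[OF V], rule C_k_mult[OF V])
        fix j assume "j \<in> {..<N}"
        then have j: "j < N" by simp
        show "C_k k m V (\<lambda>x. partial_deriv j f (?G x))"
          by (rule Suc.IH[OF g C_k_partial_deriv[OF W Suc.prems(2) j]])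
        show "C_k k m V (partial_deriv i (g j))"
          by (rule C_k_partial_deriv[OF V Suc.prems(1)[OF j] i])
      qed
      fix x assume x: "x \<in> V"
      show "((\<lambda>t. f (?G (x(i := t)))) has_real_derivative
          (\<Sum>j<N. partial_deriv j f (?G x) * partial_deriv i (g j) x)) (at (x i))"
      proof (rule chain_rule_partial[OF W gW[OF x]])
        show "continuous_on W (partial_deriv j f)" if "j < N" for j
          by (rule C_k_imp_continuous_on[OF C_k_partial_deriv[OF W Suc.prems(2) that] W])
      qed (simp_all only: C_k_Suc_DERIV[OF W Suc.prems(2)] C_k_Suc_DERIV[OF V Suc.prems(1) i x] fun_upd_triv)
    qed
  }
qed

lemma partial_deriv_compose:
  assumes V: "open_Rn m V" and W: "open_Rn N W"
    and g: "\<And>j. j < N \<Longrightarrow> C_k 1 m V (g j)"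
    and f: "C_k 1 N W f"
    and x: "x \<in> V" "(\<lambda>j. if j < N then g j x else 0) \<in> W" and i: "i < m"
  shows "partial_deriv i (\<lambda>x. f (\<lambda>j. if j < N then g j x else 0)) x =
     (\<Sum>j<N. partial_deriv j f (\<lambda>j. if j < N then g j x else 0) * partial_deriv i (g j) x)"
  unfolding partial_deriv_def[of i "\<lambda>x. f (\<lambda>j. if j < N then g j x else 0)"]
proof (rule DERIV_imp_deriv, rule chain_rule_partial[OF W x(2)])
  show "continuous_on W (partial_deriv j f)" if "j < N" for j
    using C_k_imp_continuous_on[OF C_k_partial_deriv[OF W f[unfolded One_nat_def] that] W] .
  show "((\<lambda>t. f (y(j := t))) has_real_derivative partial_deriv j f y) (at (y j))" if "j < N" "y \<in> W" for j y
    by (rule C_k_Suc_DERIV[OF W f[unfolded One_nat_def] that])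
  show "((\<lambda>t. g j (x(i := t))) has_real_derivative partial_deriv i (g j) x) (at (x i))" if "j < N" for j
    by (rule C_k_Suc_DERIV[OF V g[OF that, unfolded One_nat_def] i x(1)])
qed (simp only: fun_upd_triv)

section \<open>Smooth functions on arbitrary subsets\<close>

lemma smooth_on_subsetI:
  assumes "\<And>x. x \<in> S \<Longrightarrow> \<exists>W F. open_Rn N W \<and> x \<in> W \<and> (\<forall>k. C_k k N W F) \<and> (\<forall>y\<in>W \<inter> S. F y = f y)"
  shows "smooth_on_subset N S f"
  unfolding smooth_on_subset_def by (rule ballI) (rule assms)

lemma smooth_on_subsetE:
  assumes "smooth_on_subset N S f" "x \<in> S"
  obtains W F where "open_Rn N W" "x \<in> W" "\<forall>k. C_k k N W F" "\<forall>y\<in>W \<inter> S. F y = f y"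
proof -
  from bspec[OF assms(1)[unfolded smooth_on_subset_def] assms(2)] obtain W F where
    "open_Rn N W \<and> x \<in> W \<and> (\<forall>k. C_k k N W F) \<and> (\<forall>y\<in>W \<inter> S. F y = f y)"
    by (elim exE)
  then show thesis by (intro that[of W F]) (elim conjE; assumption)+
qed

lemma smooth_on_subset_mono:
  assumes "smooth_on_subset N S f" "T \<subseteq> S"
  shows "smooth_on_subset N T f"
proof (rule smooth_on_subsetI)
  fix x assume "x \<in> T"
  then have x: "x \<in> S" using assms(2) by blast
  obtain W F where "open_Rn N W" "x \<in> W" "\<forall>k. C_k k N W F" "\<forall>y\<in>W \<inter> S. F y = f y"
    by (rule smooth_on_subsetE[OF assms(1) x])
  moreover from this have "\<forall>y\<in>W \<inter> T. F y = f y" using assms(2) by blast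
  ultimately show "\<exists>W F. open_Rn N W \<and> x \<in> W \<and> (\<forall>k. C_k k N W F) \<and> (\<forall>y\<in>W \<inter> T. F y = f y)"
    by (intro exI[of _ W] exI[of _ F] conjI)
qed

lemma smooth_on_subset_cong:
  assumes f: "smooth_on_subset N S f" and eq: "\<And>x. x \<in> S \<Longrightarrow> f x = g x"
  shows "smooth_on_subset N S g"
proof (rule smooth_on_subsetI)
  fix x assume x: "x \<in> S"
  obtain W F where "open_Rn N W" "x \<in> W" "\<forall>k. C_k k N W F" "\<forall>y\<in>W \<inter> S. F y = f y"
    by (rule smooth_on_subsetE[OF f x])
  moreover from this have "\<forall>y\<in>W \<inter> S. F y = g y" using eq by simp
  ultimately show "\<exists>W F. open_Rn N W \<and> x \<in> W \<and> (\<forall>k. C_k k N W F) \<and> (\<forall>y\<in>W \<inter> S. F y = g y)"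
    by (intro exI[of _ W] exI[of _ F] conjI)
qed

text \<open>A function that locally extends to a smooth function, and whose domain is open, is itself
  locally equal to these extensions.\<close>

lemma smooth_on_open_iff:
  assumes S: "open_Rn N S"
  shows "smooth_on_subset N S f \<longleftrightarrow> (\<forall>k. C_k k N S f)"
proof (intro iffI allI)
  fix k assume f: "smooth_on_subset N S f"
  show "C_k k N S f"
  proof (rule C_k_local[OF S])
    fix x assume x: "x \<in> S"
    obtain W F where W: "open_Rn N W" "x \<in> W" "\<forall>k. C_k k N W F" "\<forall>y\<in>W \<inter> S. F y = f y"
      by (rule smooth_on_subsetE[OF f x])
    have WS: "open_Rn N (W \<inter> S)" by (rule openin_Int[OF W(1) S])
    have "C_k k N (W \<inter> S) f"
    proof (rule C_k_cong[OF WS])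
      show "C_k k N (W \<inter> S) F" by (rule C_k_subset[OF W(3)[THEN spec]]) blast
    qed (use W(4) in blast)
    then show "\<exists>W'. open_Rn N W' \<and> x \<in> W' \<and> C_k k N W' f"
      using WS x W(2) by blast
  qed
next
  assume "\<forall>k. C_k k N S f"
  then show "smooth_on_subset N S f"
    using S by (intro smooth_on_subsetI exI[of _ S] exI[of _ f]) simp
qed

lemma smooth_on_subset_local:
  assumes "\<And>x. x \<in> S \<Longrightarrow> \<exists>W. open_Rn N W \<and> x \<in> W \<and> smooth_on_subset N (S \<inter> W) f"
  shows "smooth_on_subset N S f"
proof (rule smooth_on_subsetI)
  fix x assume x: "x \<in> S"
  obtain W where W: "open_Rn N W" "x \<in> W" "smooth_on_subset N (S \<inter> W) f"
    using assms[OF x] by blast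
  have "x \<in> S \<inter> W" using x W by simp
  obtain V F where V: "open_Rn N V" "x \<in> V" "\<forall>k. C_k k N V F" "\<forall>y\<in>V \<inter> (S \<inter> W). F y = f y"
    by (rule smooth_on_subsetE[OF W(3) \<open>x \<in> S \<inter> W\<close>])
  have "open_Rn N (V \<inter> W)" by (rule openin_Int[OF V(1) W(1)])
  moreover have "C_k k N (V \<inter> W) F" for k by (rule C_k_subset[OF V(3)[THEN spec]]) simp
  ultimately show "\<exists>W F. open_Rn N W \<and> x \<in> W \<and> (\<forall>k. C_k k N W F) \<and> (\<forall>y\<in>W \<inter> S. F y = f y)"
    using V W(2) by (intro exI[of _ "V \<inter> W"] exI[of _ F]) auto
qed

lemma smooth_on_subset_const:
  assumes "S \<subseteq> Rn N"
  shows "smooth_on_subset N S (\<lambda>x. c)"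
proof (rule smooth_on_subset_mono[OF _ assms])
  show "smooth_on_subset N (Rn N) (\<lambda>x. c)"
    unfolding smooth_on_open_iff[OF openin_topspace] by (intro allI C_k_const openin_topspace)
qed

lemma smooth_on_subset_coordinate:
  assumes "S \<subseteq> Rn N"
  shows "smooth_on_subset N S (\<lambda>x. x j)"
proof (rule smooth_on_subset_mono[OF _ assms])
  show "smooth_on_subset N (Rn N) (\<lambda>x. x j)"
    unfolding smooth_on_open_iff[OF openin_topspace] by (intro allI C_k_coordinate openin_topspace)
qed

text \<open>Sums and products are treated together: on the intersection of the two neighbourhoods the
  operation applies to the local extensions.\<close>

lemma smooth_on_subset_binop:
  assumes op: "\<And>k W F G. open_Rn N W \<Longrightarrow> C_k k N W F \<Longrightarrow> C_k k N W G \<Longrightarrow> C_k k N W (\<lambda>x. h (F x) (G x))"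
    and f: "smooth_on_subset N S f" and g: "smooth_on_subset N S g"
  shows "smooth_on_subset N S (\<lambda>x. h (f x) (g x))"
proof (rule smooth_on_subsetI)
  fix x assume x: "x \<in> S"
  obtain V F where V: "open_Rn N V" "x \<in> V" "\<forall>k. C_k k N V F" "\<forall>y\<in>V \<inter> S. F y = f y"
    by (rule smooth_on_subsetE[OF f x])
  obtain W G where W: "open_Rn N W" "x \<in> W" "\<forall>k. C_k k N W G" "\<forall>y\<in>W \<inter> S. G y = g y"
    by (rule smooth_on_subsetE[OF g x])
  have VW: "open_Rn N (V \<inter> W)" by (rule openin_Int[OF V(1) W(1)])
  have "C_k k N (V \<inter> W) (\<lambda>x. h (F x) (G x))" for k
    by (rule op[OF VW C_k_subset[OF V(3)[THEN spec]] C_k_subset[OF W(3)[THEN spec]]]) auto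
  then show "\<exists>W F. open_Rn N W \<and> x \<in> W \<and> (\<forall>k. C_k k N W F) \<and> (\<forall>y\<in>W \<inter> S. F y = h (f y) (g y))"
    using V W VW by (intro exI[of _ "V \<inter> W"] exI[of _ "\<lambda>x. h (F x) (G x)"]) auto
qed

lemma smooth_on_subset_add:
  "smooth_on_subset N S f \<Longrightarrow> smooth_on_subset N S g \<Longrightarrow> smooth_on_subset N S (\<lambda>x. f x + g x)"
  by (rule smooth_on_subset_binop[where h = "(+)", OF C_k_add])

lemma smooth_on_subset_mult:
  "smooth_on_subset N S f \<Longrightarrow> smooth_on_subset N S g \<Longrightarrow> smooth_on_subset N S (\<lambda>x. f x * g x)"
  by (rule smooth_on_subset_binop[where h = "(*)", OF C_k_mult])

lemma smooth_on_subset_sum: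
  assumes "S \<subseteq> Rn N" "\<And>i. i \<in> I \<Longrightarrow> smooth_on_subset N S (f i)"
  shows "smooth_on_subset N S (\<lambda>x. \<Sum>i\<in>I. f i x)"
  using assms(2)
proof (induction I rule: infinite_finite_induct)
  case (insert i I)
  have "smooth_on_subset N S (\<lambda>x. f i x + (\<Sum>i\<in>I. f i x))"
    by (intro smooth_on_subset_add insert) simp_all
  then show ?case by (simp only: sum.insert[OF insert.hyps])
next
  case (infinite I)
  show ?case unfolding sum.infinite[OF infinite.hyps] by (rule smooth_on_subset_const[OF assms(1)])
next
  case empty
  show ?case unfolding sum.empty by (rule smooth_on_subset_const[OF assms(1)])
qed

text \<open>The local extensions of the coordinates of \<open>G\<close> need not take values in the set \<open>S\<close>, but near
  the given point their values lie in the open domain of a local extension of \<open>f\<close>, and there the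
  extensions can be composed.\<close>

lemma smooth_on_subset_compose:
  assumes f: "smooth_on_subset N S f"
    and g: "\<And>j. j < N \<Longrightarrow> smooth_on_subset m T (\<lambda>x. G x j)"
    and G: "\<And>x. x \<in> T \<Longrightarrow> G x \<in> S"
    and S: "S \<subseteq> Rn N" and T: "T \<subseteq> Rn m"
  shows "smooth_on_subset m T (\<lambda>x. f (G x))"
proof (rule smooth_on_subsetI)
  fix x assume x: "x \<in> T"
  have "\<forall>j. \<exists>WF. j < N \<longrightarrow> open_Rn m (fst WF) \<and> x \<in> fst WF \<and> (\<forall>k. C_k k m (fst WF) (snd WF)) \<and>
      (\<forall>y\<in>fst WF \<inter> T. snd WF y = G y j)"
  proof
    fix j show "\<exists>WF. j < N \<longrightarrow> open_Rn m (fst WF) \<and> x \<in> fst WF \<and> (\<forall>k. C_k k m (fst WF) (snd WF)) \<and>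
      (\<forall>y\<in>fst WF \<inter> T. snd WF y = G y j)"
      using g[of j] x unfolding smooth_on_subset_def by (cases "j < N") auto
  qed
  from choice[OF this] obtain WF where WF: "\<forall>j<N. open_Rn m (fst (WF j)) \<and> x \<in> fst (WF j) \<and>
      (\<forall>k. C_k k m (fst (WF j)) (snd (WF j))) \<and> (\<forall>y\<in>fst (WF j) \<inter> T. snd (WF j) y = G y j)"
    by blast
  define W where "W = Rn m \<inter> (\<Inter>j\<in>{..<N}. fst (WF j))"
  define H where "H j = snd (WF j)" for j
  have W: "open_Rn m W"
    unfolding W_def using WF by (intro openin_Int_Inter) auto
  have xW: "x \<in> W" unfolding W_def using WF x T by auto
  have H: "C_k k m W (H j)" if "j < N" for j k
  proof (rule C_k_subset)
    show "C_k k m (fst (WF j)) (H j)" using WF that unfolding H_def by blast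
    show "W \<subseteq> fst (WF j)" using that unfolding W_def by blast
  qed
  have HG: "H j y = G y j" if "j < N" "y \<in> W" "y \<in> T" for j y
    using WF that unfolding H_def W_def by auto
  have HG': "(\<lambda>j. if j < N then H j y else 0) = G y" if "y \<in> W" "y \<in> T" for y
    using HG[OF _ that] G[OF that(2)] S by (fastforce simp: topspace_Euclidean_space)
  obtain V F where V: "open_Rn N V" "G x \<in> V" "\<forall>k. C_k k N V F" "\<forall>y\<in>V \<inter> S. F y = f y"
    by (rule smooth_on_subsetE[OF f G[OF x]])
  define W' where "W' = {x \<in> W. (\<lambda>j. if j < N then H j x else 0) \<in> V}"
  have W': "open_Rn m W'"
    unfolding W'_def by (rule openin_Euclidean_preimage[OF W V(1) C_k_imp_continuous_on[OF H W]])
  let ?F = "\<lambda>x. F (\<lambda>j. if j < N then H j x else 0)"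
  show "\<exists>W F. open_Rn m W \<and> x \<in> W \<and> (\<forall>k. C_k k m W F) \<and> (\<forall>y\<in>W \<inter> T. F y = f (G y))"
  proof (intro exI[of _ W'] exI[of _ ?F] conjI allI ballI)
    show "open_Rn m W'" by (rule W')
    show "x \<in> W'" using HG'[OF xW x] xW V(2) by (simp add: W'_def)
    show "C_k k m W' ?F" for k
      by (rule C_k_compose[OF W' V(1) C_k_subset[OF H] _ V(3)[THEN spec]]) (auto simp: W'_def)
    show "?F y = f (G y)" if "y \<in> W' \<inter> T" for y
      using HG'[of y] that V(4) G[of y] by (simp add: W'_def)
  qed
qed

lemma smooth_on_subset_compose_real:
  assumes f: "smooth_on_subset N S f" and J: "open J" "\<And>x. x \<in> S \<Longrightarrow> f x \<in> J"
    and h: "\<And>j t. t \<in> J \<Longrightarrow> (h j has_real_derivative h (Suc j) t) (at t)"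
  shows "smooth_on_subset N S (\<lambda>x. h 0 (f x))"
proof (rule smooth_on_subsetI)
  fix x assume x: "x \<in> S"
  obtain W F where W: "open_Rn N W" "x \<in> W" "\<forall>k. C_k k N W F" "\<forall>y\<in>W \<inter> S. F y = f y"
    by (rule smooth_on_subsetE[OF f x])
  define V where "V = {y \<in> W. F y \<in> J}"
  have "openin (top_of_set W) V"
    using continuous_openin_preimage_gen[OF C_k_imp_continuous_on[OF W(3)[THEN spec, of 0] W(1)] J(1)]
    by (simp add: V_def vimage_def Int_def)
  then have V: "open_Rn N V"
    using openin_trans_full[OF _ W(1)] topspace_subtopology_Euclidean_open[OF W(1)] by simp
  have "C_k k N V (\<lambda>x. h 0 (F x))" for k
  proof (rule C_k_compose_real[OF V, where h = h])
    show "C_k k N V F" by (rule C_k_subset[OF W(3)[THEN spec]]) (auto simp: V_def)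
  qed (use h in \<open>simp add: V_def\<close>)
  moreover have "x \<in> V" using W(2,4) x J(2)[OF x] by (simp add: V_def)
  ultimately show "\<exists>W F. open_Rn N W \<and> x \<in> W \<and> (\<forall>k. C_k k N W F) \<and> (\<forall>y\<in>W \<inter> S. F y = h 0 (f y))"
    using V W(4) by (intro exI[of _ V] exI[of _ "\<lambda>x. h 0 (F x)"]) (auto simp: V_def)
qed

lemma smooth_on_subset_partial_deriv:
  assumes S: "open_Rn N S" and f: "smooth_on_subset N S f" and i: "i < N"
  shows "smooth_on_subset N S (partial_deriv i f)"
  unfolding smooth_on_open_iff[OF S]
proof
  fix k
  have "C_k (Suc k) N S f" using f unfolding smooth_on_open_iff[OF S] by (rule spec)
  then show "C_k k N S (partial_deriv i f)" by (rule C_k_partial_deriv[OF S _ i])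
qed

lemma smooth_imp_C_1:
  assumes "open_Rn N S" "smooth_on_subset N S f" shows "C_k 1 N S f"
  using assms(2) unfolding smooth_on_open_iff[OF assms(1)] by (rule spec)

lemma partial_deriv_compose_smooth:
  assumes V: "open_Rn m V" and W: "open_Rn N W"
    and g: "\<And>j. j < N \<Longrightarrow> smooth_on_subset m V (\<lambda>x. G x j)"
    and G: "\<And>x. x \<in> V \<Longrightarrow> G x \<in> W"
    and f: "smooth_on_subset N W f"
    and x: "x \<in> V" and i: "i < m"
  shows "partial_deriv i (\<lambda>x. f (G x)) x = (\<Sum>j<N. partial_deriv j f (G x) * partial_deriv i (\<lambda>x. G x j) x)"
proof -
  have GG: "(\<lambda>j. if j < N then G x j else 0) = G x" if "x \<in> V" for x
    using G[OF that] openin_subset[OF W] by (fastforce simp: topspace_Euclidean_space)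
  have "partial_deriv i (\<lambda>x. f (G x)) x = partial_deriv i (\<lambda>x. f (\<lambda>j. if j < N then G x j else 0)) x"
    by (rule partial_deriv_cong[OF V x i]) (simp add: GG)
  also have "\<dots> = (\<Sum>j<N. partial_deriv j f (\<lambda>j. if j < N then G x j else 0) * partial_deriv i (\<lambda>x. G x j) x)"
    by (rule partial_deriv_compose[OF V W smooth_imp_C_1[OF V g] smooth_imp_C_1[OF W f] x _ i])
       (simp_all add: GG[OF x] G[OF x])
  finally show ?thesis by (simp add: GG[OF x])
qed

lemma smooth_on_subset_imp_continuous_on:
  assumes "open_Rn N S" "smooth_on_subset N S f"
  shows "continuous_on S f"
  using C_k_imp_continuous_on[OF smooth_imp_C_1[OF assms] assms(1)] .

lemma partial_deriv_coordinate: "partial_deriv i (\<lambda>x. x j) x = (if i = j then 1 else 0)"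
proof -
  have "((\<lambda>t. (x(i := t)) j) has_real_derivative (if i = j then 1 else 0)) (at (x i))"
    by (cases "i = j") auto
  from DERIV_imp_deriv[OF this] show ?thesis by (simp only: partial_deriv_def)
qed

section \<open>A smooth function supported on the positive half-line\<close>

text \<open>The functions \<open>p(1/u) exp(-1/u)\<close>, extended by zero. Unlike \<open>exp(-1/u)\<close> alone, this class is
  closed under differentiation.\<close>

definition poly_exp_recip :: "real poly \<Rightarrow> real \<Rightarrow> real" where
  "poly_exp_recip p u = (if u > 0 then poly p (1 / u) * exp (- (1 / u)) else 0)"

lemma poly_times_exp_minus_tendsto_0: "((\<lambda>y. poly q y * exp (- y)) \<longlongrightarrow> (0::real)) at_top"
proof -
  have "((\<lambda>y. \<Sum>i\<le>degree q. coeff q i * (y ^ i / exp y)) \<longlongrightarrow> (\<Sum>i\<le>degree q. coeff q i * 0)) at_top"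
    by (intro tendsto_sum tendsto_mult tendsto_const tendsto_power_div_exp_0)
  moreover have "(\<lambda>y. \<Sum>i\<le>degree q. coeff q i * (y ^ i / exp y)) = (\<lambda>y. poly q y * exp (- y))"
    by (simp add: poly_altdef sum_distrib_right exp_minus field_simps sum_divide_distrib)
  ultimately show ?thesis by simp
qed

text \<open>At the origin the difference quotient is again of the form \<open>q(1/u) exp(-1/u)\<close> and tends to
  zero because the exponential decays faster than any polynomial grows.\<close>

lemma poly_exp_recip_derivative:
  "(poly_exp_recip p has_real_derivative poly_exp_recip ([:0, 0, 1:] * (p - pderiv p)) u) (at u)"
proof (cases u "0 :: real" rule: linorder_cases)
  case less
  have "((\<lambda>u. 0) has_real_derivative 0) (at u)" by simp
  then have "(poly_exp_recip p has_real_derivative 0) (at u)"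
    by (rule has_field_derivative_transform_within_open[of _ _ _ "{..<0}"]) (use less in \<open>auto simp: poly_exp_recip_def\<close>)
  then show ?thesis using less by (simp add: poly_exp_recip_def)
next
  case greater
  have "((\<lambda>u. 1 / u) has_real_derivative - (1 / u\<^sup>2)) (at u)"
    using greater by (auto intro!: derivative_eq_intros simp: power2_eq_square)
  note inv = this
  have "((\<lambda>u. poly p (1 / u) * exp (- (1 / u))) has_real_derivative
      poly (pderiv p) (1 / u) * - (1 / u\<^sup>2) * exp (- (1 / u)) + exp (- (1 / u)) * - (- (1 / u\<^sup>2)) * poly p (1 / u)) (at u)"
    by (rule DERIV_mult[OF DERIV_chain2[OF poly_DERIV inv] DERIV_chain2[OF DERIV_exp DERIV_minus[OF inv]]])
  moreover have "poly (pderiv p) (1 / u) * - (1 / u\<^sup>2) * exp (- (1 / u)) + exp (- (1 / u)) * - (- (1 / u\<^sup>2)) * poly p (1 / u)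
      = poly_exp_recip ([:0, 0, 1:] * (p - pderiv p)) u"
    using greater by (simp add: poly_exp_recip_def field_simps power2_eq_square)
  ultimately have "((\<lambda>u. poly p (1 / u) * exp (- (1 / u))) has_real_derivative poly_exp_recip ([:0, 0, 1:] * (p - pderiv p)) u) (at u)"
    by simp
  then show ?thesis
    by (rule has_field_derivative_transform_within_open[of _ _ _ "{0<..}"]) (use greater in \<open>auto simp: poly_exp_recip_def\<close>)
next
  case equal
  have "((\<lambda>y. (poly_exp_recip p y - poly_exp_recip p 0) / (y - 0)) \<longlongrightarrow> 0) (at 0)"
  proof (rule filterlim_split_at)
    show "((\<lambda>y. (poly_exp_recip p y - poly_exp_recip p 0) / (y - 0)) \<longlongrightarrow> 0) (at_left 0)"
    proof (rule tendsto_eventually)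
      show "\<forall>\<^sub>F y in at_left 0. (poly_exp_recip p y - poly_exp_recip p 0) / (y - 0) = 0"
        unfolding eventually_at_filter by (rule always_eventually) (auto simp: poly_exp_recip_def)
    qed
    have "((\<lambda>y. poly (pCons 0 p) (inverse y) * exp (- inverse y)) \<longlongrightarrow> 0) (at_right (0::real))"
      by (rule filterlim_compose[OF poly_times_exp_minus_tendsto_0 filterlim_inverse_at_top_right])
    moreover have "\<forall>\<^sub>F y in at_right 0. poly (pCons 0 p) (inverse y) * exp (- inverse y) = (poly_exp_recip p y - poly_exp_recip p 0) / (y - 0)"
      unfolding eventually_at_filter
      by (rule always_eventually) (auto simp: poly_exp_recip_def field_simps)
    ultimately show "((\<lambda>y. (poly_exp_recip p y - poly_exp_recip p 0) / (y - 0)) \<longlongrightarrow> 0) (at_right 0)"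
      by (rule Lim_transform_eventually)
  qed
  then show ?thesis using equal by (simp add: has_field_derivative_iff poly_exp_recip_def)
qed

text \<open>A smooth function that vanishes exactly on the nonpositive half-line and is normalized to have the
  value 1 at 1.\<close>

definition ramp :: "real \<Rightarrow> real" where "ramp u = exp 1 * poly_exp_recip 1 u"

lemma ramp_nonneg: "0 \<le> ramp u" and ramp_pos_iff: "0 < ramp u \<longleftrightarrow> 0 < u" and ramp_eq_0_iff: "ramp u = 0 \<longleftrightarrow> u \<le> 0"
  and ramp_1: "ramp 1 = 1"
  by (auto simp: ramp_def poly_exp_recip_def exp_add[symmetric])

lemma ramp_le_1: "u \<le> 1 \<Longrightarrow> ramp u \<le> 1"
  by (auto simp: ramp_def poly_exp_recip_def exp_add[symmetric])

lemma smooth_ramp: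
  assumes "smooth_on_subset N S f"
  shows "smooth_on_subset N S (\<lambda>x. ramp (f x))"
proof -
  \<comment> \<open>The polynomial that belongs to the \<open>j\<close>-th derivative.\<close>
  define P where "P j = ((\<lambda>p. [:0, 0, 1:] * (p - pderiv p)) ^^ j) (1 :: real poly)" for j :: nat
  have "smooth_on_subset N S (\<lambda>x. (\<lambda>j u. exp 1 * poly_exp_recip (P j) u) 0 (f x))"
  proof (rule smooth_on_subset_compose_real[OF assms open_UNIV])
    show "((\<lambda>u. exp 1 * poly_exp_recip (P j) u) has_real_derivative exp 1 * poly_exp_recip (P (Suc j)) t) (at t)" for j t
      using DERIV_cmult[OF poly_exp_recip_derivative[of "P j" t], of "exp 1"] by (simp add: P_def)
  qed simp
  then show ?thesis by (simp add: P_def ramp_def)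
qed

lemma smooth_inverse:
  assumes "smooth_on_subset N S f" "\<And>x. x \<in> S \<Longrightarrow> f x \<noteq> 0"
  shows "smooth_on_subset N S (\<lambda>x. 1 / f x)"
proof -
  have "smooth_on_subset N S (\<lambda>x. (\<lambda>j t. (-1) ^ j * fact j * inverse t ^ Suc j) 0 (f x))"
  proof (rule smooth_on_subset_compose_real[OF assms(1), of "- {0}"])
    fix j and t :: real assume "t \<in> - {0}"
    then have "((\<lambda>t. inverse t ^ Suc j) has_real_derivative of_nat (Suc j) * (- (inverse t ^ Suc (Suc 0)) * inverse t ^ j)) (at t)"
      using DERIV_power[OF DERIV_inverse[of t UNIV], of "Suc j"] by simp
    from DERIV_cmult[OF this, of "(-1) ^ j * fact j"]
    show "((\<lambda>t. (-1) ^ j * fact j * inverse t ^ Suc j) has_real_derivative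
        (-1) ^ Suc j * fact (Suc j) * inverse t ^ Suc (Suc j)) (at t)"
      by (simp add: algebra_simps)
  qed (use assms(2) in auto)
  then show ?thesis by (simp add: inverse_eq_divide)
qed

section \<open>Tangent spaces and Jacobians\<close>

locale manifold_with_atlas =
  fixes n :: nat and M :: "'a topology" and A :: "'a chart set"
  assumes manifold: "smooth_manifold n M A"
begin

lemma chart_in_atlas: "c \<in> A \<Longrightarrow> is_chart n M c"
  using manifold unfolding smooth_manifold_def by blast

lemma
  assumes "c \<in> A"
  shows chart_open: "openin M (fst c)"
    and chart_image_open: "open_Rn n (snd c ` fst c)"
    and chart_homeomorphic: "homeomorphic_map (subtopology M (fst c)) (subtopology (Euclidean_space n) (snd c ` fst c)) (snd c)"
  using chart_in_atlas[OF assms] unfolding is_chart_def by (auto simp: case_prod_beta)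

lemma chart_inj: "c \<in> A \<Longrightarrow> inj_on (snd c) (fst c)"
  using homeomorphic_imp_injective_map[OF chart_homeomorphic] openin_subset[OF chart_open]
  by (simp add: topspace_subtopology Int_absorb1)

lemma chart_image_of_open:
  assumes c: "c \<in> A" and W: "openin M W" "W \<subseteq> fst c"
  shows "open_Rn n (snd c ` W)"
proof -
  have "openin (subtopology M (fst c)) W"
    using W by (simp add: openin_subtopology_alt) (metis W(1) inf.absorb_iff2 image_eqI mem_Collect_eq Int_commute)
  then have "openin (subtopology (Euclidean_space n) (snd c ` fst c)) (snd c ` W)"
    using homeomorphic_imp_open_map[OF chart_homeomorphic[OF c]] unfolding open_map_def by blast
  then show ?thesis using openin_trans_full chart_image_open[OF c] by blast
qed

lemma transition_apply: "c \<in> A \<Longrightarrow> p \<in> fst c \<Longrightarrow> transition c c' (snd c p) = snd c' p"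
  by (simp add: transition_def inv_into_f_f[OF chart_inj])

lemma transition_smooth:
  assumes "c \<in> A" "c' \<in> A" "k < n"
  shows "smooth_on_subset n (snd c ` (fst c \<inter> fst c')) (\<lambda>x. transition c c' x k)"
  using assms manifold unfolding smooth_manifold_def smooth_transition_def by blast

lemma overlap_open: "c \<in> A \<Longrightarrow> c' \<in> A \<Longrightarrow> open_Rn n (snd c ` (fst c \<inter> fst c'))"
  by (intro chart_image_of_open openin_Int chart_open) auto

lemma jacobian_self:
  assumes c: "c \<in> A" and p: "p \<in> fst c" and i: "i < n"
  shows "jacobian c c p k i = (if i = k then 1 else 0)"
proof -
  have "jacobian c c p k i = partial_deriv i (\<lambda>x. x k) (snd c p)"
    unfolding jacobian_def
  proof (rule partial_deriv_cong[OF chart_image_open[OF c] _ i])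
    fix y assume "y \<in> snd c ` fst c"
    then obtain q where "q \<in> fst c" "y = snd c q" by blast
    then show "transition c c y k = y k" using transition_apply[OF c] by simp
  qed (use p in blast)
  then show ?thesis by (simp add: partial_deriv_coordinate)
qed

text \<open>The chain rule for the transition functions, which compose on the intersection of the three
  chart domains.\<close>

lemma jacobian_chain:
  assumes c: "c \<in> A" "c' \<in> A" "c'' \<in> A" and p: "p \<in> fst c" "p \<in> fst c'" "p \<in> fst c''"
    and k: "k < n" and i: "i < n"
  shows "jacobian c c'' p k i = (\<Sum>j<n. jacobian c' c'' p k j * jacobian c c' p j i)"
proof -
  let ?D = "fst c \<inter> fst c' \<inter> fst c''"
  let ?V = "snd c ` ?D" and ?W = "snd c' ` (fst c' \<inter> fst c'')"
  have V: "open_Rn n ?V"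
    by (intro chart_image_of_open openin_Int chart_open c) auto
  have W: "open_Rn n ?W" by (rule overlap_open[OF c(2,3)])
  have "jacobian c c'' p k i = partial_deriv i (\<lambda>x. transition c' c'' (transition c c' x) k) (snd c p)"
    unfolding jacobian_def
  proof (rule partial_deriv_cong[OF V _ i])
    fix y assume "y \<in> ?V"
    then obtain q where "q \<in> ?D" "y = snd c q" by blast
    then show "transition c c'' y k = transition c' c'' (transition c c' y) k"
      using transition_apply c by simp
  qed (use p in blast)
  also have "\<dots> = (\<Sum>j<n. partial_deriv j (\<lambda>x. transition c' c'' x k) (transition c c' (snd c p)) *
      partial_deriv i (\<lambda>x. transition c c' x j) (snd c p))"
  proof (rule partial_deriv_compose_smooth[OF V W])
    show "smooth_on_subset n ?V (\<lambda>x. transition c c' x j)" if "j < n" for j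
      by (rule smooth_on_subset_mono[OF transition_smooth[OF c(1,2) that]]) blast
    show "transition c c' x \<in> ?W" if x: "x \<in> ?V" for x
    proof -
      obtain q where "q \<in> ?D" "x = snd c q" using x by blast
      then show ?thesis using transition_apply[OF c(1)] by simp
    qed
    show "smooth_on_subset n ?W (\<lambda>x. transition c' c'' x k)" by (rule transition_smooth[OF c(2,3) k])
  qed (use p i in blast)+
  also have "\<dots> = (\<Sum>j<n. jacobian c' c'' p k j * jacobian c c' p j i)"
    by (simp only: jacobian_def transition_apply[OF c(1) p(1)])
  finally show ?thesis .
qed

text \<open>The transformation law of a coordinate vector is the cocycle identity of the Jacobians.\<close>

lemma coord_vector_tangent:
  assumes c: "c \<in> A" and p: "p \<in> fst c" and i: "i < n"
  shows "coord_vector n A c i p \<in> tangent_space n A p"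
  unfolding tangent_space_def mem_Collect_eq
proof (intro conjI ballI allI impI)
  fix c' c'' k assume c': "c' \<in> A" "c'' \<in> A" "p \<in> fst c' \<and> p \<in> fst c''" and k: "k < n"
  have "jacobian c c'' p k i = (\<Sum>j<n. jacobian c' c'' p k j * jacobian c c' p j i)"
    using jacobian_chain[OF c c'(1,2) p _ _ k i] c'(3) by blast
  then show "coord_vector n A c i p c'' k = (\<Sum>j<n. jacobian c' c'' p k j * coord_vector n A c i p c' j)"
    using c' k by (simp add: coord_vector_def)
next
  fix c' k assume "c' \<notin> A \<or> p \<notin> fst c' \<or> n \<le> k"
  then show "coord_vector n A c i p c' k = 0" by (auto simp: coord_vector_def)
qed

lemma coord_vector_component:
  "c' \<in> A \<Longrightarrow> p \<in> fst c' \<Longrightarrow> k < n \<Longrightarrow> coord_vector n A c i p c' k = jacobian c c' p k i"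
  by (simp add: coord_vector_def)

text \<open>By the transformation law, a tangent vector is determined by its components in one chart. Here
  the convention matters that components outside the meaningful range are zero.\<close>

lemma tangent_expansion:
  assumes v: "v \<in> tangent_space n A p" and c: "c \<in> A" and p: "p \<in> fst c"
  shows "v = (\<lambda>c' k. \<Sum>i<n. v c i * coord_vector n A c i p c' k)"
proof (intro ext)
  fix c' k
  show "v c' k = (\<Sum>i<n. v c i * coord_vector n A c i p c' k)"
  proof (cases "c' \<in> A \<and> p \<in> fst c' \<and> k < n")
    case True
    then have "v c' k = (\<Sum>i<n. jacobian c c' p k i * v c i)"
      using v c p unfolding tangent_space_def by blast
    then show ?thesis using True by (simp add: coord_vector_component mult.commute)
  next
    case False
    then have "c' \<notin> A \<or> p \<notin> fst c' \<or> n \<le> k" by auto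
    then have "v c' k = 0" using v unfolding tangent_space_def by blast
    moreover have "coord_vector n A c i p c' k = 0" for i using False by (auto simp: coord_vector_def)
    ultimately show ?thesis by simp
  qed
qed

lemma tangent_combination:
  assumes "u \<in> tangent_space n A p" "v \<in> tangent_space n A p"
  shows "(\<lambda>c k. r * u c k + s * v c k) \<in> tangent_space n A p"
  unfolding tangent_space_def mem_Collect_eq
proof (intro conjI ballI allI impI)
  fix c c' k assume c: "c \<in> A" "c' \<in> A" "p \<in> fst c \<and> p \<in> fst c'" and k: "k < n"
  have u: "u c' k = (\<Sum>i<n. jacobian c c' p k i * u c i)"
    using assms(1) c k unfolding tangent_space_def by blast
  have v: "v c' k = (\<Sum>i<n. jacobian c c' p k i * v c i)"
    using assms(2) c k unfolding tangent_space_def by blast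
  show "r * u c' k + s * v c' k = (\<Sum>i<n. jacobian c c' p k i * (r * u c i + s * v c i))"
    unfolding u v sum_distrib_left sum.distrib[symmetric]
    by (intro sum.cong refl) (simp add: algebra_simps)
next
  fix c k assume ck: "c \<notin> A \<or> p \<notin> fst c \<or> n \<le> k"
  have "u c k = 0" using assms(1) ck unfolding tangent_space_def by blast
  moreover have "v c k = 0" using assms(2) ck unfolding tangent_space_def by blast
  ultimately show "r * u c k + s * v c k = 0" by simp
qed

lemma tangent_zero: "(\<lambda>c k. 0) \<in> tangent_space n A p"
  unfolding tangent_space_def by simp

lemma tangent_sum:
  assumes "finite I" "\<And>i. i \<in> I \<Longrightarrow> e i \<in> tangent_space n A p"
  shows "(\<lambda>c k. \<Sum>i\<in>I. r i * e i c k) \<in> tangent_space n A p"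
  using assms
proof (induction I rule: finite_induct)
  case empty
  then show ?case by (simp add: tangent_zero)
next
  case (insert i I)
  have "(\<lambda>c k. r i * e i c k + 1 * (\<Sum>i\<in>I. r i * e i c k)) \<in> tangent_space n A p"
    by (rule tangent_combination) (use insert in simp_all)
  then show ?case using insert by simp
qed

lemma inner_product_sum_left:
  assumes b: "inner_product_on (tangent_space n A p) b" and I: "finite I"
    and e: "\<And>i. i \<in> I \<Longrightarrow> e i \<in> tangent_space n A p" and w: "w \<in> tangent_space n A p"
  shows "b (\<lambda>c k. \<Sum>i\<in>I. r i * e i c k) w = (\<Sum>i\<in>I. r i * b (e i) w)"
proof -
  have lin: "b (\<lambda>c k. r * u c k + s * v c k) w = r * b u w + s * b v w"
    if "u \<in> tangent_space n A p" "v \<in> tangent_space n A p" for u v r s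
    using b that w unfolding inner_product_on_def by blast
  show ?thesis using I e
  proof (induction I rule: finite_induct)
    case empty
    then show ?case using lin[OF tangent_zero tangent_zero, of 0 0] by simp
  next
    case (insert i I)
    have "b (\<lambda>c k. r i * e i c k + 1 * (\<Sum>i\<in>I. r i * e i c k)) w
        = r i * b (e i) w + 1 * b (\<lambda>c k. \<Sum>i\<in>I. r i * e i c k) w"
      by (rule lin[OF _ tangent_sum]) (use insert in simp_all)
    then show ?case using insert by simp
  qed
qed

lemma inner_product_sum:
  assumes b: "inner_product_on (tangent_space n A p) b" and I: "finite I"
    and e: "\<And>i. i \<in> I \<Longrightarrow> e i \<in> tangent_space n A p"
  shows "b (\<lambda>c k. \<Sum>i\<in>I. r i * e i c k) (\<lambda>c k. \<Sum>j\<in>I. s j * e j c k) =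
     (\<Sum>i\<in>I. \<Sum>j\<in>I. b (e i) (e j) * r i * s j)"
proof -
  note T = tangent_sum[OF I e]
  have sym: "b u v = b v u" if "u \<in> tangent_space n A p" "v \<in> tangent_space n A p" for u v
    using b that unfolding inner_product_on_def by blast
  have "b (e i) (\<lambda>c k. \<Sum>j\<in>I. s j * e j c k) = (\<Sum>j\<in>I. s j * b (e i) (e j))" if i: "i \<in> I" for i
  proof -
    have "b (e i) (\<lambda>c k. \<Sum>j\<in>I. s j * e j c k) = b (\<lambda>c k. \<Sum>j\<in>I. s j * e j c k) (e i)"
      by (rule sym[OF e[OF i] T])
    also have "\<dots> = (\<Sum>j\<in>I. s j * b (e j) (e i))"
      by (rule inner_product_sum_left[OF b I e e[OF i]])
    also have "\<dots> = (\<Sum>j\<in>I. s j * b (e i) (e j))"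
      by (intro sum.cong refl arg_cong2[where f = "(*)"] sym e i)
    finally show ?thesis .
  qed
  then have "(\<Sum>i\<in>I. r i * b (e i) (\<lambda>c k. \<Sum>j\<in>I. s j * e j c k)) =
      (\<Sum>i\<in>I. \<Sum>j\<in>I. b (e i) (e j) * r i * s j)"
    by (simp add: sum_distrib_left mult_ac)
  then show ?thesis by (simp only: inner_product_sum_left[OF b I e T])
qed

lemma inner_product_eq_components:
  assumes b: "inner_product_on (tangent_space n A p) (g p)"
    and c: "c \<in> A" and p: "p \<in> fst c"
    and v: "v \<in> tangent_space n A p" and w: "w \<in> tangent_space n A p"
  shows "g p v w = (\<Sum>i<n. \<Sum>j<n. metric_component n A g c i j p * v c i * w c j)"
proof -
  have "g p (\<lambda>c' k. \<Sum>i<n. v c i * coord_vector n A c i p c' k) (\<lambda>c' k. \<Sum>i<n. w c i * coord_vector n A c i p c' k)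
     = (\<Sum>i<n. \<Sum>j<n. g p (coord_vector n A c i p) (coord_vector n A c j p) * v c i * w c j)"
    by (rule inner_product_sum[OF b]) (simp_all add: coord_vector_tangent[OF c p])
  then show ?thesis
    using tangent_expansion[OF v c p] tangent_expansion[OF w c p] by (simp add: metric_component_def)
qed

end

section \<open>Coefficient matrices of flat metrics\<close>

text \<open>Coordinates \<open>\<psi>\<close> on \<open>W\<close>, with inverse \<open>\<eta>\<close>, in which the metric with coefficients \<open>a\<close> is the standard
  one: \<open>a\<close> is the Gram matrix of the Jacobian of \<open>\<psi>\<close>. The inverse is part of the data, so that no
  inverse function theorem is needed to see that \<open>\<psi>\<close> is a chart.\<close>

definition flattening :: "nat \<Rightarrow> (nat \<Rightarrow> nat \<Rightarrow> (nat \<Rightarrow> real) \<Rightarrow> real) \<Rightarrow> (nat \<Rightarrow> real) set \<Rightarrow>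
    ((nat \<Rightarrow> real) \<Rightarrow> nat \<Rightarrow> real) \<Rightarrow> ((nat \<Rightarrow> real) \<Rightarrow> nat \<Rightarrow> real) \<Rightarrow> bool" where
  "flattening n a W \<psi> \<eta> \<longleftrightarrow> open_Rn n W \<and> open_Rn n (\<psi> ` W) \<and>
     (\<forall>k<n. smooth_on_subset n W (\<lambda>y. \<psi> y k)) \<and>
     (\<forall>k<n. smooth_on_subset n (\<psi> ` W) (\<lambda>y. \<eta> y k)) \<and>
     (\<forall>y\<in>W. \<eta> (\<psi> y) = y) \<and>
     (\<forall>y\<in>W. \<forall>i<n. \<forall>j<n. a i j y =
        (\<Sum>k<n. partial_deriv i (\<lambda>x. \<psi> x k) y * partial_deriv j (\<lambda>x. \<psi> x k) y))"

lemma flatteningD: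
  assumes "flattening n a W \<psi> \<eta>"
  shows "open_Rn n W" "open_Rn n (\<psi> ` W)"
    "\<forall>k<n. smooth_on_subset n W (\<lambda>y. \<psi> y k)"
    "\<forall>k<n. smooth_on_subset n (\<psi> ` W) (\<lambda>y. \<eta> y k)"
    "\<forall>y\<in>W. \<eta> (\<psi> y) = y"
    "\<forall>y\<in>W. \<forall>i<n. \<forall>j<n. a i j y =
        (\<Sum>k<n. partial_deriv i (\<lambda>x. \<psi> x k) y * partial_deriv j (\<lambda>x. \<psi> x k) y)"
  by (rule assms[unfolded flattening_def, THEN conjunct1]
    assms[unfolded flattening_def, THEN conjunct2, THEN conjunct1]
    assms[unfolded flattening_def, THEN conjunct2, THEN conjunct2, THEN conjunct1]
    assms[unfolded flattening_def, THEN conjunct2, THEN conjunct2, THEN conjunct2, THEN conjunct1]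
    assms[unfolded flattening_def, THEN conjunct2, THEN conjunct2, THEN conjunct2, THEN conjunct2, THEN conjunct1]
    assms[unfolded flattening_def, THEN conjunct2, THEN conjunct2, THEN conjunct2, THEN conjunct2, THEN conjunct2])+

text \<open>Flatness of the metric on the open set \<open>B\<close> of $\mathbb{R}^n$ with coefficients \<open>a\<close>. Symmetry,
  positivity and smoothness of \<open>a\<close> are consequences.\<close>

definition flat_coefficients :: "nat \<Rightarrow> (nat \<Rightarrow> real) set \<Rightarrow> (nat \<Rightarrow> nat \<Rightarrow> (nat \<Rightarrow> real) \<Rightarrow> real) \<Rightarrow> bool" where
  "flat_coefficients n B a \<longleftrightarrow> (\<forall>x\<in>B. \<exists>W \<psi> \<eta>. x \<in> W \<and> W \<subseteq> B \<and> flattening n a W \<psi> \<eta>)"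

lemma flat_coefficientsE:
  assumes "flat_coefficients n B a" "x \<in> B"
  obtains W \<psi> \<eta> where "x \<in> W" "W \<subseteq> B" "flattening n a W \<psi> \<eta>"
proof -
  from bspec[OF assms(1)[unfolded flat_coefficients_def] assms(2)] show thesis
    by (elim exE conjE) (rule that; assumption)
qed

lemma sum_kronecker:
  fixes X :: "nat \<Rightarrow> real"
  assumes "i < n"
  shows "(\<Sum>l<n. (if i = l then 1 else 0) * X l) = X i" "(\<Sum>l<n. (if l = i then 1 else 0) * X l) = X i"
proof -
  have "(\<Sum>l<n. (if i = l then 1 else 0) * X l) = (\<Sum>l<n. if i = l then X l else 0)"
    by (intro sum.cong) auto
  also have "\<dots> = X i" using assms by simp
  finally show "(\<Sum>l<n. (if i = l then 1 else 0) * X l) = X i" .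
  then show "(\<Sum>l<n. (if l = i then 1 else 0) * X l) = X i" by (simp only: eq_commute)
qed

text \<open>The chain rule for \<open>\<eta> \<circ> \<psi> = id\<close>.\<close>

lemma partial_deriv_inverse:
  assumes W: "open_Rn n W" and P: "open_Rn n (\<psi> ` W)"
    and s: "\<forall>k<n. smooth_on_subset n W (\<lambda>y. \<psi> y k)" and r: "\<forall>k<n. smooth_on_subset n (\<psi> ` W) (\<lambda>y. \<eta> y k)"
    and inv: "\<forall>y\<in>W. \<eta> (\<psi> y) = y" and x: "x \<in> W" and i: "i < n" and l: "l < n"
  shows "(\<Sum>k<n. partial_deriv k (\<lambda>y. \<eta> y i) (\<psi> x) * partial_deriv l (\<lambda>y. \<psi> y k) x) = (if i = l then 1 else 0)"
proof -
  have "partial_deriv l (\<lambda>y. \<eta> (\<psi> y) i) x = (\<Sum>k<n. partial_deriv k (\<lambda>y. \<eta> y i) (\<psi> x) * partial_deriv l (\<lambda>y. \<psi> y k) x)"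
    by (rule partial_deriv_compose_smooth[OF W P]) (use s r i l x in auto)
  moreover have "partial_deriv l (\<lambda>y. \<eta> (\<psi> y) i) x = partial_deriv l (\<lambda>y. y i) x"
    by (rule partial_deriv_cong[OF W x l]) (use inv in simp)
  ultimately show ?thesis by (simp add: partial_deriv_coordinate eq_commute)
qed

lemma flat_coefficients_at_point:
  assumes "flat_coefficients n B a" "x \<in> B"
  obtains J K where "\<forall>i<n. \<forall>j<n. a i j x = (\<Sum>k<n. J k i * J k j)"
    "\<forall>i<n. \<forall>l<n. (\<Sum>k<n. K i k * J k l) = (if i = l then 1 else (0::real))"
proof -
  obtain W \<psi> \<eta> where fl: "x \<in> W" "W \<subseteq> B" "flattening n a W \<psi> \<eta>"
    by (rule flat_coefficientsE[OF assms])
  note W = flatteningD(1)[OF fl(3)] fl(1,2) flatteningD(2-6)[OF fl(3)]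
  show thesis
  proof (rule that[of "\<lambda>k i. partial_deriv i (\<lambda>x. \<psi> x k) x" "\<lambda>i k. partial_deriv k (\<lambda>y. \<eta> y i) (\<psi> x)"])
    show "\<forall>i<n. \<forall>j<n. a i j x = (\<Sum>k<n. partial_deriv i (\<lambda>x. \<psi> x k) x * partial_deriv j (\<lambda>x. \<psi> x k) x)"
      using W(2,8) by blast
  qed (intro allI impI partial_deriv_inverse[OF W(1,4-7,2)])
qed

text \<open>If \<open>b = J\<^sup>T J\<close>, then the bilinear form of \<open>b\<close> is \<open>(v, w) \<mapsto> (J v) \<bullet> (J w)\<close>.\<close>

lemma quadratic_form_gram:
  fixes J :: "nat \<Rightarrow> nat \<Rightarrow> real"
  assumes "\<And>i j. i < n \<Longrightarrow> j < n \<Longrightarrow> b i j = (\<Sum>k<n. J k i * J k j)"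
  shows "(\<Sum>i<n. \<Sum>j<n. b i j * v i * w j) = (\<Sum>k<n. (\<Sum>i<n. J k i * v i) * (\<Sum>j<n. J k j * w j))"
proof -
  have "(\<Sum>i<n. \<Sum>j<n. b i j * v i * w j) = (\<Sum>i<n. \<Sum>j<n. \<Sum>k<n. (J k i * v i) * (J k j * w j))"
    by (intro sum.cong refl) (simp add: assms sum_distrib_left sum_distrib_right mult_ac)
  also have "\<dots> = (\<Sum>i<n. \<Sum>k<n. \<Sum>j<n. (J k i * v i) * (J k j * w j))"
    by (intro sum.cong refl sum.swap)
  also have "\<dots> = (\<Sum>k<n. \<Sum>i<n. \<Sum>j<n. (J k i * v i) * (J k j * w j))"
    by (rule sum.swap)
  finally show ?thesis by (simp only: sum_product)
qed

text \<open>With \<open>a = J\<^sup>T J\<close> the value is \<open>\<parallel>J v\<parallel>\<^sup>2\<close>, and \<open>J\<close> is injective because it has the left inverse \<open>K\<close>.\<close>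

lemma flat_coefficients_positive:
  assumes "flat_coefficients n B a" "x \<in> B" "i0 < n" "v i0 \<noteq> (0::real)"
  shows "0 < (\<Sum>i<n. \<Sum>j<n. a i j x * v i * v j)"
proof -
  obtain J K where JK: "\<forall>i<n. \<forall>j<n. a i j x = (\<Sum>k<n. J k i * J k j)"
    "\<forall>i<n. \<forall>l<n. (\<Sum>k<n. K i k * J k l) = (if i = l then 1 else (0::real))"
    by (rule flat_coefficients_at_point[OF assms(1,2)])
  note J = JK(1)[rule_format] and K = JK(2)[rule_format]
  have eq: "(\<Sum>i<n. \<Sum>j<n. a i j x * v i * v j) = (\<Sum>k<n. (\<Sum>i<n. J k i * v i)\<^sup>2)"
    using quadratic_form_gram[OF J, where v = v and w = v] by (simp add: power2_eq_square)
  have "\<exists>k<n. (\<Sum>i<n. J k i * v i) \<noteq> 0"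
  proof (rule ccontr)
    assume "\<not> ?thesis"
    then have z: "(\<Sum>i<n. J k i * v i) = 0" if "k < n" for k using that by blast
    have "v i0 = (\<Sum>l<n. (if i0 = l then 1 else 0) * v l)" by (rule sum_kronecker(1)[OF assms(3), symmetric])
    also have "\<dots> = (\<Sum>l<n. \<Sum>k<n. K i0 k * J k l * v l)"
      by (intro sum.cong refl) (simp add: K[OF assms(3), symmetric] sum_distrib_right)
    also have "\<dots> = (\<Sum>k<n. \<Sum>l<n. K i0 k * J k l * v l)" by (rule sum.swap)
    also have "\<dots> = (\<Sum>k<n. K i0 k * (\<Sum>l<n. J k l * v l))" by (simp add: sum_distrib_left mult.assoc)
    also have "\<dots> = 0" using z by simp
    finally show False using assms(4) by simp
  qed
  then obtain k where k: "k < n" "(\<Sum>i<n. J k i * v i) \<noteq> 0" by blast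
  have "0 < (\<Sum>k<n. (\<Sum>i<n. J k i * v i)\<^sup>2)"
    by (rule sum_pos2[of _ k]) (use k in auto)
  then show ?thesis by (simp only: eq)
qed

lemma flat_coefficients_symmetric:
  assumes "flat_coefficients n B a" "x \<in> B" "i < n" "j < n"
  shows "a i j x = a j i x"
proof -
  obtain J K where JK: "\<forall>i<n. \<forall>j<n. a i j x = (\<Sum>k<n. J k i * J k j)"
    "\<forall>i<n. \<forall>l<n. (\<Sum>k<n. K i k * J k l) = (if i = l then 1 else (0::real))"
    by (rule flat_coefficients_at_point[OF assms(1,2)])
  note J = JK(1)[rule_format] and K = JK(2)[rule_format]
  show ?thesis unfolding J[OF assms(3,4)] J[OF assms(4,3)] by (intro sum.cong refl mult.commute)
qed

lemma flat_coefficients_smooth: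
  assumes a: "flat_coefficients n B a" and i: "i < n" and j: "j < n"
  shows "smooth_on_subset n B (a i j)"
proof (rule smooth_on_subset_local)
  fix x assume "x \<in> B"
  obtain W \<psi> \<eta> where fl: "x \<in> W" "W \<subseteq> B" "flattening n a W \<psi> \<eta>"
    by (rule flat_coefficientsE[OF a \<open>x \<in> B\<close>])
  note W = flatteningD(1)[OF fl(3)] fl(1,2) flatteningD(2-6)[OF fl(3)]
  have "smooth_on_subset n W (\<lambda>y. \<Sum>k<n. partial_deriv i (\<lambda>x. \<psi> x k) y * partial_deriv j (\<lambda>x. \<psi> x k) y)"
    by (intro smooth_on_subset_sum openin_subset[OF W(1)] smooth_on_subset_mult smooth_on_subset_partial_deriv[OF W(1)] i j)
       (use W(5) in auto)
  then have "smooth_on_subset n W (a i j)"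
    by (rule smooth_on_subset_cong) (use W(8) i j in simp)
  then have "smooth_on_subset n (B \<inter> W) (a i j)" by (rule smooth_on_subset_mono) simp
  then show "\<exists>W. open_Rn n W \<and> x \<in> W \<and> smooth_on_subset n (B \<inter> W) (a i j)"
    using W(1,2) by blast
qed

section \<open>Rescaling flat metrics and constant metrics\<close>

text \<open>The Cholesky factorization \<open>b = P\<^sup>T P\<close> of a positive definite matrix, with both identities for
  the inverse \<open>Q\<close> of \<open>P\<close>. Writing the matrix of size \<open>n + 1\<close> in blocks, the last column of the new
  factor is \<open>(y, z)\<close> with \<open>P\<^sup>T y\<close> equal to the off-diagonal part and \<open>z\<^sup>2\<close> equal to the Schur complement. The
  latter is positive, being the value of the form at the vector \<open>(-q, 1)\<close> where \<open>P q = y\<close>.\<close>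

lemma cholesky:
  fixes b :: "nat \<Rightarrow> nat \<Rightarrow> real"
  assumes "\<And>i j. i < n \<Longrightarrow> j < n \<Longrightarrow> b i j = b j i"
    and "\<And>v i. i < n \<Longrightarrow> v i \<noteq> 0 \<Longrightarrow> 0 < (\<Sum>i<n. \<Sum>j<n. b i j * v i * v j)"
  shows "\<exists>P Q. (\<forall>i<n. \<forall>j<n. (\<Sum>k<n. P k i * P k j) = b i j) \<and>
    (\<forall>i<n. \<forall>j<n. (\<Sum>k<n. Q i k * P k j) = (if i = j then 1 else 0)) \<and>
    (\<forall>i<n. \<forall>j<n. (\<Sum>k<n. P i k * Q k j) = (if i = j then 1 else (0::real)))"
  using assms
proof (induction n)
  case 0
  then show ?case by simp
next
  case (Suc n)
  have "\<exists>P Q. (\<forall>i<n. \<forall>j<n. (\<Sum>k<n. P k i * P k j) = b i j) \<and>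
    (\<forall>i<n. \<forall>j<n. (\<Sum>k<n. Q i k * P k j) = (if i = j then 1 else 0)) \<and>
    (\<forall>i<n. \<forall>j<n. (\<Sum>k<n. P i k * Q k j) = (if i = j then 1 else (0::real)))"
  proof (rule Suc.IH)
    show "b i j = b j i" if "i < n" "j < n" for i j using Suc.prems(1)[of i j] that by simp
    fix v :: "nat \<Rightarrow> real" and i assume i: "i < n" "v i \<noteq> 0"
    have "0 < (\<Sum>i<Suc n. \<Sum>j<Suc n. b i j * (v(n := 0)) i * (v(n := 0)) j)"
      by (rule Suc.prems(2)[of i]) (use i in auto)
    then show "0 < (\<Sum>i<n. \<Sum>j<n. b i j * v i * v j)" by simp
  qed
  then obtain P Q where PQ: "\<forall>i<n. \<forall>j<n. (\<Sum>k<n. P k i * P k j) = b i j"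
    "\<forall>i<n. \<forall>j<n. (\<Sum>k<n. Q i k * P k j) = (if i = j then 1 else 0)"
    "\<forall>i<n. \<forall>j<n. (\<Sum>k<n. P i k * Q k j) = (if i = j then 1 else (0::real))"
    by blast
  define y where "y k = (\<Sum>l<n. Q l k * b l n)" for k
  define q where "q i = (\<Sum>k<n. Q i k * y k)" for i
  have Py: "(\<Sum>k<n. P k i * y k) = b i n" if "i < n" for i
  proof -
    have "(\<Sum>k<n. P k i * y k) = (\<Sum>k<n. \<Sum>l<n. Q l k * P k i * b l n)"
      by (simp add: y_def sum_distrib_left mult_ac)
    also have "\<dots> = (\<Sum>l<n. \<Sum>k<n. Q l k * P k i * b l n)" by (rule sum.swap)
    also have "\<dots> = (\<Sum>l<n. (if l = i then 1 else 0) * b l n)"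
      using PQ(2) that by (simp add: sum_distrib_right[symmetric])
    also have "\<dots> = b i n" by (rule sum_kronecker[OF that])
    finally show ?thesis .
  qed
  have Pq: "(\<Sum>i<n. P k i * q i) = y k" if "k < n" for k
  proof -
    have "(\<Sum>i<n. P k i * q i) = (\<Sum>i<n. \<Sum>m<n. P k i * Q i m * y m)"
      by (simp add: q_def sum_distrib_left mult_ac)
    also have "\<dots> = (\<Sum>m<n. \<Sum>i<n. P k i * Q i m * y m)" by (rule sum.swap)
    also have "\<dots> = (\<Sum>m<n. (if k = m then 1 else 0) * y m)"
      using PQ(3) that by (simp add: sum_distrib_right[symmetric])
    also have "\<dots> = y k" by (rule sum_kronecker[OF that])
    finally show ?thesis .
  qed
  have qb: "(\<Sum>i<n. b i n * q i) = (\<Sum>k<n. y k * y k)"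
  proof -
    have "(\<Sum>i<n. b i n * q i) = (\<Sum>i<n. \<Sum>k<n. P k i * q i * y k)"
      by (intro sum.cong refl) (simp add: Py[symmetric] sum_distrib_left sum_distrib_right mult_ac)
    also have "\<dots> = (\<Sum>k<n. \<Sum>i<n. P k i * q i * y k)" by (rule sum.swap)
    also have "\<dots> = (\<Sum>k<n. y k * y k)" by (simp add: sum_distrib_right[symmetric] Pq)
    finally show ?thesis .
  qed
  have qq: "(\<Sum>i<n. \<Sum>j<n. b i j * q i * q j) = (\<Sum>k<n. y k * y k)"
  proof -
    have "(\<Sum>i<n. \<Sum>j<n. b i j * q i * q j) = (\<Sum>k<n. (\<Sum>i<n. P k i * q i) * (\<Sum>j<n. P k j * q j))"
      by (rule quadratic_form_gram) (use PQ(1) in simp)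
    then show ?thesis by (simp add: Pq)
  qed
  \<comment> \<open>The value of the form at this vector is the Schur complement.\<close>
  define v where "v = (\<lambda>i. if i < n then - q i else (1::real))"
  have "0 < (\<Sum>i<Suc n. \<Sum>j<Suc n. b i j * v i * v j)"
    by (rule Suc.prems(2)[of n]) (simp_all add: v_def)
  also have "(\<Sum>i<Suc n. \<Sum>j<Suc n. b i j * v i * v j) =
      (\<Sum>i<n. \<Sum>j<n. b i j * q i * q j) - (\<Sum>i<n. b i n * q i) - (\<Sum>j<n. b n j * q j) + b n n"
    by (simp add: v_def sum.distrib sum_negf sum_subtractf)
  also have "(\<Sum>j<n. b n j * q j) = (\<Sum>i<n. b i n * q i)"
    by (intro sum.cong refl arg_cong2[where f = "(*)"] Suc.prems(1)) auto
  finally have pos: "0 < b n n - (\<Sum>k<n. y k * y k)" by (simp add: qb qq)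
  define z where "z = sqrt (b n n - (\<Sum>k<n. y k * y k))"
  have z: "z > 0" "z * z = b n n - (\<Sum>k<n. y k * y k)" using pos by (simp_all add: z_def)
  define P' where "P' k i = (if k < n then if i < n then P k i else y k else if i < n then 0 else z)" for k i
  define Q' where "Q' i k = (if i < n then if k < n then Q i k else - q i / z else if k < n then 0 else 1 / z)" for i k
  have "\<forall>i<Suc n. \<forall>j<Suc n. (\<Sum>k<Suc n. P' k i * P' k j) = b i j"
  proof -
    have "(\<Sum>k<n. y k * P k j) = b n j" if "j < n" for j
      using Py[OF that] Suc.prems(1)[of n j] that by (simp add: mult.commute)
    then show ?thesis unfolding All_less_Suc using PQ(1) Py z(2) by (simp add: P'_def)
  qed
  moreover have "\<forall>i<Suc n. \<forall>j<Suc n. (\<Sum>k<Suc n. Q' i k * P' k j) = (if i = j then 1 else 0)"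
    unfolding All_less_Suc using PQ(2) z(1) by (simp add: P'_def Q'_def q_def)
  moreover have "(\<Sum>k<n. P i k * (- q k / z)) = - y i / z" if "i < n" for i
    using Pq[OF that] by (simp add: sum_negf sum_divide_distrib[symmetric])
  then have "\<forall>i<Suc n. \<forall>j<Suc n. (\<Sum>k<Suc n. P' i k * Q' k j) = (if i = j then 1 else 0)"
    unfolding All_less_Suc using PQ(3) z(1) by (simp add: P'_def Q'_def)
  ultimately show ?case by blast
qed

text \<open>If \<open>b = P\<^sup>T P\<close>, then the linear coordinates \<open>x \<mapsto> P x\<close> flatten the metric.\<close>

lemma flat_coefficients_constant:
  assumes B: "open_Rn n B"
    and sym: "\<And>i j. i < n \<Longrightarrow> j < n \<Longrightarrow> b i j = b j i"
    and pos: "\<And>v i. i < n \<Longrightarrow> v i \<noteq> (0::real) \<Longrightarrow> 0 < (\<Sum>i<n. \<Sum>j<n. b i j * v i * v j)"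
  shows "flat_coefficients n B (\<lambda>i j x. b i j)"
proof -
  obtain P Q where P: "\<forall>i<n. \<forall>j<n. (\<Sum>k<n. P k i * P k j) = b i j"
    and QP: "\<forall>i<n. \<forall>j<n. (\<Sum>k<n. Q i k * P k j) = (if i = j then 1 else 0)"
    and PQ: "\<forall>i<n. \<forall>j<n. (\<Sum>k<n. P i k * Q k j) = (if i = j then 1 else (0::real))"
  proof -
    have "\<exists>P Q. (\<forall>i<n. \<forall>j<n. (\<Sum>k<n. P k i * P k j) = b i j) \<and>
      (\<forall>i<n. \<forall>j<n. (\<Sum>k<n. Q i k * P k j) = (if i = j then 1 else 0)) \<and>
      (\<forall>i<n. \<forall>j<n. (\<Sum>k<n. P i k * Q k j) = (if i = j then 1 else (0::real)))"
      by (rule cholesky) (rule sym pos; assumption)+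
    then show thesis using that by blast
  qed
  define L where "L T y = (\<lambda>k. if k < n then (\<Sum>i<n. T k i * y i) else 0)" for T :: "nat \<Rightarrow> nat \<Rightarrow> real" and y :: "nat \<Rightarrow> real"
  have inv: "L S (L T y) = y"
    if ST: "\<forall>i<n. \<forall>j<n. (\<Sum>k<n. S i k * T k j) = (if i = j then 1 else 0)" and y: "y \<in> Rn n" for S T y
  proof (rule ext)
    fix i
    show "L S (L T y) i = y i"
    proof (cases "i < n")
      case True
      have "L S (L T y) i = (\<Sum>k<n. S i k * (\<Sum>j<n. T k j * y j))" using True by (simp add: L_def)
      also have "\<dots> = (\<Sum>k<n. \<Sum>j<n. S i k * T k j * y j)" by (simp add: sum_distrib_left mult_ac)
      also have "\<dots> = (\<Sum>j<n. \<Sum>k<n. S i k * T k j * y j)" by (rule sum.swap)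
      also have "\<dots> = (\<Sum>j<n. (if i = j then 1 else 0) * y j)"
        using ST True by (simp add: sum_distrib_right[symmetric])
      also have "\<dots> = y i" by (rule sum_kronecker[OF True])
      finally show ?thesis .
    next
      case False
      then show ?thesis using y by (simp add: L_def topspace_Euclidean_space)
    qed
  qed
  have LE: "L T y \<in> Rn n" for T y by (simp add: L_def topspace_Euclidean_space)
  note BE = openin_subset[OF B]
  have Lsm: "smooth_on_subset n S (\<lambda>y. L T y k)" if "k < n" "S \<subseteq> Rn n" for S T k
    unfolding L_def using that
    by (simp add: smooth_on_subset_sum smooth_on_subset_mult smooth_on_subset_const smooth_on_subset_coordinate)
  have im: "L P ` B = {z \<in> Rn n. L Q z \<in> B}"
  proof (intro equalityI subsetI)
    fix z assume "z \<in> L P ` B"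
    then show "z \<in> {z \<in> Rn n. L Q z \<in> B}" using inv[OF QP] LE BE by auto
  next
    fix z assume "z \<in> {z \<in> Rn n. L Q z \<in> B}"
    then have "z = L P (L Q z)" "L Q z \<in> B" using inv[OF PQ] by auto
    then show "z \<in> L P ` B" by blast
  qed
  have PB: "open_Rn n (L P ` B)"
  proof -
    have "open_Rn n {z \<in> Rn n. (\<lambda>j. if j < n then L Q z j else 0) \<in> B}"
      by (rule openin_Euclidean_preimage[OF openin_topspace B smooth_on_subset_imp_continuous_on[OF openin_topspace Lsm]]) auto
    moreover have "(\<lambda>j. if j < n then L Q z j else 0) = L Q z" for z by (auto simp: L_def)
    ultimately show ?thesis by (simp only: im)
  qed
  have deriv: "partial_deriv i (\<lambda>y. L P y k) y = P k i" if k: "k < n" and i: "i < n" for i k y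
  proof -
    have "((\<lambda>t. \<Sum>j<n. P k j * (y(i := t)) j) has_real_derivative (\<Sum>j<n. P k j * (if i = j then 1 else 0))) (at (y i))"
    proof (intro DERIV_sum DERIV_cmult)
      fix j show "((\<lambda>t. (y(i := t)) j) has_real_derivative (if i = j then 1 else 0)) (at (y i))"
        by (cases "i = j") auto
    qed
    moreover have "(\<Sum>j<n. P k j * (if i = j then 1 else 0)) = P k i"
      using sum_kronecker(1)[OF i, of "P k"] by (simp only: mult.commute)
    ultimately have "((\<lambda>t. \<Sum>j<n. P k j * (y(i := t)) j) has_real_derivative P k i) (at (y i))" by simp
    from DERIV_imp_deriv[OF this] show ?thesis using k by (simp only: partial_deriv_def L_def if_True)
  qed
  show ?thesis unfolding flat_coefficients_def
  proof
    fix x assume x: "x \<in> B"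
    show "\<exists>W \<psi> \<eta>. x \<in> W \<and> W \<subseteq> B \<and> flattening n (\<lambda>i j x. b i j) W \<psi> \<eta>"
    proof (rule exI[of _ B], rule exI[of _ "L P"], rule exI[of _ "L Q"], unfold flattening_def, intro conjI allI impI ballI)
      show "L Q (L P y) = y" if "y \<in> B" for y using inv[OF QP] BE that by blast
      show "b i j = (\<Sum>k<n. partial_deriv i (\<lambda>x. L P x k) y * partial_deriv j (\<lambda>x. L P x k) y)"
        if "i < n" "j < n" for y i j using P that by (simp add: deriv)
    qed (use B x PB BE in \<open>auto intro!: Lsm openin_subset[OF PB]\<close>)
  qed
qed


lemma scaled_in_Euclidean: "y \<in> Rn n \<Longrightarrow> (\<lambda>k. l * y k) \<in> Rn n"
  by (simp add: topspace_Euclidean_space)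

lemma smooth_scaled_coordinate:
  "S \<subseteq> Rn n \<Longrightarrow> smooth_on_subset n S (\<lambda>y. l * y j)"
  by (rule smooth_on_subset_mult[OF smooth_on_subset_const smooth_on_subset_coordinate])

lemma openin_scale_preimage:
  assumes V: "open_Rn n V"
  shows "open_Rn n {y \<in> Rn n. (\<lambda>k. l * y k) \<in> V}"
proof -
  have "open_Rn n {y \<in> Rn n. (\<lambda>j. if j < n then l * y j else 0) \<in> V}"
    by (rule openin_Euclidean_preimage[OF openin_topspace V
          smooth_on_subset_imp_continuous_on[OF openin_topspace smooth_scaled_coordinate]]) simp
  moreover have "(\<lambda>j. if j < n then l * y j else 0) = (\<lambda>j. l * y j)" if "y \<in> Rn n" for y
    using that by (auto simp: topspace_Euclidean_space)
  ultimately show ?thesis by (simp cong: conj_cong)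
qed

text \<open>The image of \<open>V\<close> is the preimage of \<open>V\<close> under the continuous map \<open>\<eta>\<close>.\<close>

lemma openin_image_of_diffeomorphism:
  assumes W: "open_Rn n W" and P: "open_Rn n (\<psi> ` W)"
    and r: "\<forall>k<n. smooth_on_subset n (\<psi> ` W) (\<lambda>y. \<eta> y k)"
    and inv: "\<forall>y\<in>W. \<eta> (\<psi> y) = y"
    and V: "open_Rn n V" "V \<subseteq> W"
  shows "open_Rn n (\<psi> ` V)"
proof -
  have "open_Rn n {z \<in> \<psi> ` W. (\<lambda>j. if j < n then \<eta> z j else 0) \<in> V}"
    by (rule openin_Euclidean_preimage[OF P V(1) smooth_on_subset_imp_continuous_on[OF P]]) (use r in blast)
  moreover have "{z \<in> \<psi> ` W. (\<lambda>j. if j < n then \<eta> z j else 0) \<in> V} = \<psi> ` V"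
  proof -
    have "(\<lambda>j. if j < n then \<eta> (\<psi> y) j else 0) = y" if "y \<in> W" for y
      using inv openin_subset[OF W] that by (fastforce simp: topspace_Euclidean_space)
    then show ?thesis using V(2) by auto
  qed
  ultimately show ?thesis by simp
qed

text \<open>If \<open>\<psi>\<close> flattens \<open>a\<close> near \<open>l x\<close>, then \<open>m \<psi>(l y)\<close>, for \<open>y\<close> near \<open>x\<close>, has the Jacobian
  \<open>m l D\<psi>(l y)\<close>, whose Gram matrix is \<open>(m l)\<^sup>2 a(l y)\<close>. So \<open>m = sqrt c / l\<close> gives coordinates that
  flatten the rescaled metric.\<close>

lemma flat_coefficients_scale:
  assumes a: "flat_coefficients n B a" and B: "open_Rn n B"
    and l: "l > 0" "\<And>x. x \<in> B \<Longrightarrow> (\<lambda>k. l * x k) \<in> B" and c: "c > 0"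
  shows "flat_coefficients n B (\<lambda>i j x. c * a i j (\<lambda>k. l * x k))"
  unfolding flat_coefficients_def
proof
  fix x assume x: "x \<in> B"
  note BE = openin_subset[OF B]
  define m where "m = sqrt c / l"
  have m: "m > 0" "m * l = sqrt c" using l(1) c by (simp_all add: m_def)
  obtain W \<psi> \<eta> where fl: "(\<lambda>k. l * x k) \<in> W" "W \<subseteq> B" "flattening n a W \<psi> \<eta>"
    by (rule flat_coefficientsE[OF a l(2)[OF x]])
  note W = flatteningD(1)[OF fl(3)] fl(1,2) flatteningD(2-6)[OF fl(3)]
  \<comment> \<open>\<open>W\<close> may reach beyond the dilated copy of \<open>B\<close>, so it is cut down to it before dilating back.\<close>
  define B' where "B' = {y \<in> Rn n. (\<lambda>k. (1 / l) * y k) \<in> B}"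
  define V where "V = W \<inter> B'"
  have V: "open_Rn n V" "V \<subseteq> W"
    unfolding V_def B'_def by (intro openin_Int W(1) openin_scale_preimage B) blast
  have PV: "open_Rn n (\<psi> ` V)"
    by (rule openin_image_of_diffeomorphism[OF W(1,4,6,7) V])
  define S where "S = {y \<in> Rn n. (\<lambda>k. l * y k) \<in> V}"
  have S: "open_Rn n S" unfolding S_def by (rule openin_scale_preimage[OF V(1)])
  note SE = openin_subset[OF S]
  have SB: "S \<subseteq> B" using l(1) by (auto simp: S_def V_def B'_def)
  have xS: "x \<in> S" using x BE W(2) l(1) scaled_in_Euclidean[of x n l] by (auto simp: S_def V_def B'_def)
  have lS: "(\<lambda>k. l * y k) \<in> W" if "y \<in> S" for y using that V(2) by (auto simp: S_def)
  have PE: "\<psi> ` V \<subseteq> Rn n" by (rule openin_subset[OF PV])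
  let ?\<psi> = "\<lambda>y k. m * \<psi> (\<lambda>k. l * y k) k" and ?\<eta> = "\<lambda>z k. (1 / l) * \<eta> (\<lambda>k. (1 / m) * z k) k"
  have im: "?\<psi> ` S = {z \<in> Rn n. (\<lambda>k. (1 / m) * z k) \<in> \<psi> ` V}"
  proof (intro equalityI subsetI)
    fix z assume "z \<in> ?\<psi> ` S"
    then obtain y where y: "y \<in> S" "z = ?\<psi> y" by blast
    have "(\<lambda>k. (1 / m) * z k) = \<psi> (\<lambda>k. l * y k)" using y(2) m(1) by simp
    moreover have "(\<lambda>k. l * y k) \<in> V" using y(1) by (simp add: S_def)
    moreover from this have "z \<in> Rn n"
      unfolding y(2) using PE by (intro scaled_in_Euclidean) blast
    ultimately show "z \<in> {z \<in> Rn n. (\<lambda>k. (1 / m) * z k) \<in> \<psi> ` V}" by simp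
  next
    fix z assume "z \<in> {z \<in> Rn n. (\<lambda>k. (1 / m) * z k) \<in> \<psi> ` V}"
    then obtain v where v: "v \<in> V" "(\<lambda>k. (1 / m) * z k) = \<psi> v" by blast
    define y where "y = (\<lambda>k. (1 / l) * v k)"
    have vy: "(\<lambda>k. l * y k) = v" using l(1) by (simp add: y_def)
    have "y \<in> S" using v(1) V openin_subset[OF V(1)] vy scaled_in_Euclidean[of v n "1/l"]
      by (auto simp: S_def y_def)
    moreover have "z k = m * \<psi> v k" for k using fun_cong[OF v(2), of k] m(1) by (simp add: field_simps)
    then have "z = ?\<psi> y" by (auto simp: vy)
    ultimately show "z \<in> ?\<psi> ` S" by blast
  qed
  have PS: "open_Rn n (?\<psi> ` S)" unfolding im by (rule openin_scale_preimage[OF PV])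
  have psm: "smooth_on_subset n S (\<lambda>y. ?\<psi> y k)" if k: "k < n" for k
  proof (rule smooth_on_subset_mult[OF smooth_on_subset_const[OF SE]],
      rule smooth_on_subset_compose[where f = "\<lambda>y. \<psi> y k" and G = "\<lambda>y k. l * y k"])
    show "smooth_on_subset n W (\<lambda>y. \<psi> y k)" using W(5) k by blast
  qed (use SE lS openin_subset[OF W(1)] in \<open>auto intro: smooth_scaled_coordinate\<close>)
  have esm: "smooth_on_subset n (?\<psi> ` S) (\<lambda>y. ?\<eta> y k)" if k: "k < n" for k
  proof (rule smooth_on_subset_mult[OF smooth_on_subset_const[OF openin_subset[OF PS]]],
      rule smooth_on_subset_compose[where f = "\<lambda>y. \<eta> y k" and G = "\<lambda>z k. (1 / m) * z k"])
    show "smooth_on_subset n (\<psi> ` W) (\<lambda>y. \<eta> y k)" using W(6) k by blast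
    show "smooth_on_subset n (?\<psi> ` S) (\<lambda>x. (1 / m) * x j)" for j
      by (rule smooth_scaled_coordinate[OF openin_subset[OF PS]])
    show "(\<lambda>k. (1 / m) * x k) \<in> \<psi> ` W" if "x \<in> ?\<psi> ` S" for x
    proof -
      have "(\<lambda>k. (1 / m) * x k) \<in> \<psi> ` V" using that unfolding im by blast
      then show ?thesis using V(2) by blast
    qed
    show "\<psi> ` W \<subseteq> Rn n" by (rule openin_subset[OF W(4)])
    show "?\<psi> ` S \<subseteq> Rn n" by (rule openin_subset[OF PS])
  qed
  have deriv: "partial_deriv i (\<lambda>y. ?\<psi> y k) y = sqrt c * partial_deriv i (\<lambda>y. \<psi> y k) (\<lambda>k. l * y k)"
    if y: "y \<in> S" and k: "k < n" and i: "i < n" for y i k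
  proof -
    have C: "C_k (Suc 0) n W (\<lambda>y. \<psi> y k)" using smooth_imp_C_1[OF W(1) W(5)[rule_format, OF k]] unfolding One_nat_def .
    have upd: "(\<lambda>k. l * (y(i := t)) k) = (\<lambda>k. l * y k)(i := l * t)" for t by auto
    have "((\<lambda>t. l * t) has_real_derivative l) (at (y i))" using DERIV_cmult_Id[of l] by simp
    from DERIV_cmult[OF DERIV_chain2[OF C_k_Suc_DERIV[OF W(1) C i lS[OF y]] this], of m]
    have "((\<lambda>t. m * \<psi> ((\<lambda>k. l * y k)(i := l * t)) k) has_real_derivative
        m * (partial_deriv i (\<lambda>y. \<psi> y k) (\<lambda>k. l * y k) * l)) (at (y i))" .
    from DERIV_imp_deriv[OF this] have "partial_deriv i (\<lambda>y. ?\<psi> y k) y = m * (partial_deriv i (\<lambda>y. \<psi> y k) (\<lambda>k. l * y k) * l)"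
      by (simp only: partial_deriv_def upd)
    then show ?thesis using m(2)[symmetric] by simp
  qed
  show "\<exists>W \<psi> \<eta>. x \<in> W \<and> W \<subseteq> B \<and> flattening n (\<lambda>i j x. c * a i j (\<lambda>k. l * x k)) W \<psi> \<eta>"
  proof (rule exI[of _ S], rule exI[of _ ?\<psi>], rule exI[of _ ?\<eta>], unfold flattening_def, intro conjI allI impI ballI)
    show "?\<eta> (?\<psi> y) = y" if "y \<in> S" for y
      using W(7) lS[OF that] m(1) l(1) by simp
    show "c * a i j (\<lambda>k. l * y k) = (\<Sum>k<n. partial_deriv i (\<lambda>x. ?\<psi> x k) y * partial_deriv j (\<lambda>x. ?\<psi> x k) y)"
      if y: "y \<in> S" and ij: "i < n" "j < n" for y i j
    proof -
      have "(\<Sum>k<n. partial_deriv i (\<lambda>x. ?\<psi> x k) y * partial_deriv j (\<lambda>x. ?\<psi> x k) y) =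
        (\<Sum>k<n. c * (partial_deriv i (\<lambda>y. \<psi> y k) (\<lambda>k. l * y k) * partial_deriv j (\<lambda>y. \<psi> y k) (\<lambda>k. l * y k)))"
      proof (rule sum.cong[OF refl])
        fix k assume "k \<in> {..<n}"
        then have k: "k < n" by simp
        have "sqrt c * u * (sqrt c * w) = c * (u * w)" for u w
          using real_sqrt_mult_self[of c] c by (simp add: algebra_simps)
        then show "partial_deriv i (\<lambda>x. ?\<psi> x k) y * partial_deriv j (\<lambda>x. ?\<psi> x k) y =
          c * (partial_deriv i (\<lambda>y. \<psi> y k) (\<lambda>k. l * y k) * partial_deriv j (\<lambda>y. \<psi> y k) (\<lambda>k. l * y k))"
          by (simp only: deriv[OF y k ij(1)] deriv[OF y k ij(2)])
      qed
      then show ?thesis using W(8) lS[OF y] ij by (simp add: sum_distrib_left)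
    qed
  qed (use S xS SB PS psm esm in auto)
qed

section \<open>Metrics on the domain of one chart\<close>

text \<open>The metric whose coefficients in the chart \<open>c\<close> are \<open>a\<close>, for coefficients depending on the
  coordinates. It is zero off the tangent spaces over the domain of \<open>c\<close>, in accordance with
  \<^const>\<open>riemannian_metric\<close>.\<close>

definition metric_of :: "nat \<Rightarrow> 'a chart set \<Rightarrow> 'a chart \<Rightarrow> (nat \<Rightarrow> nat \<Rightarrow> (nat \<Rightarrow> real) \<Rightarrow> real) \<Rightarrow> 'a metric_field" where
  "metric_of n A c a p v w =
     (if p \<in> fst c \<and> v \<in> tangent_space n A p \<and> w \<in> tangent_space n A p
      then \<Sum>i<n. \<Sum>j<n. a i j (snd c p) * v c i * w c j else 0)"

definition coefficients :: "nat \<Rightarrow> 'a chart set \<Rightarrow> 'a chart \<Rightarrow> 'a metric_field \<Rightarrow> nat \<Rightarrow> nat \<Rightarrow> (nat \<Rightarrow> real) \<Rightarrow> real" where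
  "coefficients n A c g i j x = metric_component n A g c i j (inv_into (fst c) (snd c) x)"

context manifold_with_atlas
begin

lemma metric_of_component:
  assumes c: "c \<in> A" "p \<in> fst c" and c0: "c0 \<in> A" "p \<in> fst c0" and ij: "i < n" "j < n"
  shows "metric_component n A (metric_of n A c0 a) c i j p =
    (\<Sum>k<n. \<Sum>l<n. a k l (snd c0 p) * jacobian c c0 p k i * jacobian c c0 p l j)"
  unfolding metric_component_def metric_of_def
  using c c0 ij by (simp add: coord_vector_tangent coord_vector_component)

lemma metric_component_change:
  assumes g: "inner_product_on (tangent_space n A p) (g p)"
    and c: "c \<in> A" "p \<in> fst c" and c': "c' \<in> A" "p \<in> fst c'" and ij: "i < n" "j < n"
  shows "metric_component n A g c' i j p =
    (\<Sum>k<n. \<Sum>l<n. metric_component n A g c k l p * jacobian c' c p k i * jacobian c' c p l j)"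
proof -
  have "g p (coord_vector n A c' i p) (coord_vector n A c' j p) =
     (\<Sum>k<n. \<Sum>l<n. metric_component n A g c k l p * coord_vector n A c' i p c k * coord_vector n A c' j p c l)"
    by (rule inner_product_eq_components[where g = g, OF g c coord_vector_tangent[OF c' ij(1)] coord_vector_tangent[OF c' ij(2)]])
  then show ?thesis
    unfolding metric_component_def[of n A g c'] using c by (simp add: coord_vector_component)
qed

lemma coefficients_apply:
  "c \<in> A \<Longrightarrow> p \<in> fst c \<Longrightarrow> coefficients n A c g i j (snd c p) = metric_component n A g c i j p"
  by (simp add: coefficients_def inv_into_f_f[OF chart_inj])

text \<open>A Riemannian metric is determined by its coefficients in one chart: on tangent vectors by
  bilinearity, elsewhere because it is zero.\<close>

lemma metric_of_coefficients:
  assumes g: "riemannian_metric n A (fst c) g" and c: "c \<in> A"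
  shows "metric_of n A c (coefficients n A c g) = g"
proof (intro ext)
  fix p v w
  show "metric_of n A c (coefficients n A c g) p v w = g p v w"
  proof (cases "p \<in> fst c \<and> v \<in> tangent_space n A p \<and> w \<in> tangent_space n A p")
    case True
    then have "inner_product_on (tangent_space n A p) (g p)" using g unfolding riemannian_metric_def by blast
    then show ?thesis
      using inner_product_eq_components[of p g c v w] True c by (simp add: metric_of_def coefficients_apply)
  next
    case False
    then have "p \<notin> fst c \<or> v \<notin> tangent_space n A p \<or> w \<notin> tangent_space n A p" by blast
    then have "g p v w = 0" using g unfolding riemannian_metric_def by blast
    then show ?thesis using False by (auto simp: metric_of_def)
  qed
qed

text \<open>A chart in which the metric has the components \<open>\<delta>\<^sub>i\<^sub>j\<close> is, read in the coordinates of \<open>c0\<close>, a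
  flattening: the transformation law of the components expresses those in \<open>c0\<close> by the Jacobian of the
  transition function.\<close>

lemma flat_metric_coefficients:
  assumes g: "flat_metric n A (fst c0) g" and c0: "c0 \<in> A"
  shows "flat_coefficients n (snd c0 ` fst c0) (coefficients n A c0 g)"
  unfolding flat_coefficients_def
proof
  fix x assume "x \<in> snd c0 ` fst c0"
  then obtain p where p: "p \<in> fst c0" "x = snd c0 p" by blast
  then obtain c where c: "c \<in> A" "p \<in> fst c" "fst c \<subseteq> fst c0"
    and comp: "\<forall>q\<in>fst c. \<forall>i<n. \<forall>j<n. metric_component n A g c i j q = (if i = j then 1 else 0)"
    using g unfolding flat_metric_def by blast
  have Int: "fst c0 \<inter> fst c = fst c" "fst c \<inter> fst c0 = fst c" using c(3) by auto
  let ?W = "snd c0 ` fst c" and ?\<psi> = "transition c0 c" and ?\<eta> = "transition c c0"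
  have t: "?\<psi> (snd c0 q) = snd c q" "?\<eta> (snd c q) = snd c0 q" if "q \<in> fst c" for q
    using that c(3) transition_apply[OF c0, of q c] transition_apply[OF c(1), of q c0] by auto
  have img: "?\<psi> ` ?W = snd c ` fst c" using t(1) by (simp add: image_image)
  show "\<exists>W \<psi> \<eta>. x \<in> W \<and> W \<subseteq> snd c0 ` fst c0 \<and> flattening n (coefficients n A c0 g) W \<psi> \<eta>"
  proof (rule exI[of _ ?W], rule exI[of _ ?\<psi>], rule exI[of _ ?\<eta>], unfold flattening_def, intro conjI allI impI ballI)
    show "open_Rn n ?W" using overlap_open[OF c0 c(1)] by (simp only: Int)
    show "x \<in> ?W" "?W \<subseteq> snd c0 ` fst c0" using p c by auto
    show "open_Rn n (?\<psi> ` ?W)" unfolding img by (rule chart_image_open[OF c(1)])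
    show "smooth_on_subset n ?W (\<lambda>y. ?\<psi> y k)" if "k < n" for k
      using transition_smooth[OF c0 c(1) that] by (simp only: Int)
    show "smooth_on_subset n (?\<psi> ` ?W) (\<lambda>y. ?\<eta> y k)" if "k < n" for k
      using transition_smooth[OF c(1) c0 that] by (simp only: Int img)
    show "?\<eta> (?\<psi> y) = y" if "y \<in> ?W" for y using that t by auto
    fix y i j assume y: "y \<in> ?W" and ij: "i < n" "j < n"
    obtain q where q: "q \<in> fst c" "y = snd c0 q" using y by blast
    have q0: "q \<in> fst c0" using q(1) c(3) by blast
    have ip: "inner_product_on (tangent_space n A q) (g q)"
      using g q0 unfolding flat_metric_def riemannian_metric_def by blast
    have "coefficients n A c0 g i j y = metric_component n A g c0 i j q"
      unfolding q(2) by (rule coefficients_apply[OF c0 q0])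
    also have "\<dots> = (\<Sum>k<n. \<Sum>l<n. metric_component n A g c k l q * jacobian c0 c q k i * jacobian c0 c q l j)"
      by (rule metric_component_change[where g = g, OF ip c(1) q(1) c0 q0 ij])
    also have "\<dots> = (\<Sum>k<n. \<Sum>l<n. (if k = l then 1 else 0) * (jacobian c0 c q k i * jacobian c0 c q l j))"
      using comp q(1) by (simp add: mult.assoc)
    also have "\<dots> = (\<Sum>k<n. jacobian c0 c q k i * jacobian c0 c q k j)"
      by (intro sum.cong refl sum_kronecker) simp
    finally show "coefficients n A c0 g i j y =
        (\<Sum>k<n. partial_deriv i (\<lambda>x. ?\<psi> x k) y * partial_deriv j (\<lambda>x. ?\<psi> x k) y)"
      by (simp only: jacobian_def q(2))
  qed
qed

lemma metric_of_inner_product: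
  assumes a: "flat_coefficients n (snd c0 ` fst c0) a" and c0: "c0 \<in> A" and p: "p \<in> fst c0"
  shows "inner_product_on (tangent_space n A p) (metric_of n A c0 a p)"
proof -
  let ?T = "tangent_space n A p" and ?b = "metric_of n A c0 a p"
  have x: "snd c0 p \<in> snd c0 ` fst c0" using p by blast
  have b: "?b v w = (\<Sum>i<n. \<Sum>j<n. a i j (snd c0 p) * v c0 i * w c0 j)" if "v \<in> ?T" "w \<in> ?T" for v w
    using that p by (simp add: metric_of_def)
  show ?thesis unfolding inner_product_on_def
  proof (intro conjI ballI allI impI)
    fix v w assume vw: "v \<in> ?T" "w \<in> ?T"
    have "(\<Sum>i<n. \<Sum>j<n. a i j (snd c0 p) * v c0 i * w c0 j) = (\<Sum>j<n. \<Sum>i<n. a i j (snd c0 p) * v c0 i * w c0 j)"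
      by (rule sum.swap)
    also have "\<dots> = (\<Sum>j<n. \<Sum>i<n. a j i (snd c0 p) * w c0 j * v c0 i)"
      by (intro sum.cong refl) (simp add: flat_coefficients_symmetric[OF a x])
    finally show "?b v w = ?b w v" using b vw by simp
  next
    fix u v w r s assume T: "u \<in> ?T" "v \<in> ?T" "w \<in> ?T"
    show "?b (\<lambda>c k. r * u c k + s * v c k) w = r * ?b u w + s * ?b v w"
      unfolding b[OF tangent_combination[OF T(1,2)] T(3)] b[OF T(1,3)] b[OF T(2,3)]
      by (simp add: sum_distrib_left sum.distrib[symmetric] algebra_simps)
  next
    fix v assume v: "v \<in> ?T" "v \<noteq> (\<lambda>c k. 0)"
    have "\<exists>i<n. v c0 i \<noteq> 0"
    proof (rule ccontr)
      assume "\<not> ?thesis"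
      then have "v = (\<lambda>c k. 0)" using tangent_expansion[OF v(1) c0 p] by simp
      then show False using v(2) by simp
    qed
    then obtain i where "i < n" "v c0 i \<noteq> 0" by blast
    then show "0 < ?b v v" unfolding b[OF v(1) v(1)]
      by (rule flat_coefficients_positive[OF a x])
  qed
qed

end

text \<open>Smoothness is about the first \<open>n\<close> coordinates; the others vanish, hence they are continuous, too.\<close>

lemma smooth_map_continuous_on:
  assumes W: "open_Rn n W" and s: "\<forall>k<n. smooth_on_subset n W (\<lambda>y. \<psi> y k)"
    and im: "\<psi> ` W \<subseteq> Rn n"
  shows "continuous_on W \<psi>"
proof (rule continuous_on_coordinatewise_then_product)
  fix k
  show "continuous_on W (\<lambda>y. \<psi> y k)"
  proof (cases "k < n")
    case True
    then show ?thesis using smooth_on_subset_imp_continuous_on[OF W] s by blast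
  next
    case False
    then have "\<psi> y k = 0" if "y \<in> W" for y
      using im that by (auto simp: topspace_Euclidean_space)
    then have "continuous_on W (\<lambda>y. \<psi> y k) = continuous_on W (\<lambda>y. 0::real)"
      by (intro continuous_on_cong refl)
    then show ?thesis by simp
  qed
qed

lemma smooth_compose_chart_part:
  assumes S: "S \<subseteq> Rn (n + m)" and V: "V \<subseteq> Rn n"
    and f: "smooth_on_subset n V f" and SV: "\<And>z. z \<in> S \<Longrightarrow> chart_part n z \<in> V"
  shows "smooth_on_subset (n + m) S (\<lambda>z. f (chart_part n z))"
proof (rule smooth_on_subset_compose[OF f _ SV V S])
  fix j assume "j < n"
  then show "smooth_on_subset (n + m) S (\<lambda>z. chart_part n z j)"
    by (simp add: chart_part_def smooth_on_subset_coordinate[OF S])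
qed

context manifold_with_atlas
begin

text \<open>Smoothness in the chart \<open>c0\<close> implies smoothness in all other charts, because the components in
  another chart are sums of products of the coefficients, composed with a transition function, and of
  Jacobians. The parameters run through a subset \<open>P\<close> of $\mathbb{R}^m$. The case \<open>m = 0\<close> is that of a
  single metric.\<close>

lemma metric_of_family_smooth:
  assumes c: "c \<in> A" and c0: "c0 \<in> A" and ij: "i < n" "j < n"
    and b: "\<And>k l. k < n \<Longrightarrow> l < n \<Longrightarrow> smooth_on_subset (n + m)
        {z \<in> Rn (n + m). chart_part n z \<in> snd c0 ` fst c0 \<and> simplex_part n z \<in> P}
        (\<lambda>z. b (simplex_part n z) k l (chart_part n z))"
  shows "smooth_on_subset (n + m)
        {z \<in> Rn (n + m). chart_part n z \<in> snd c ` (fst c \<inter> fst c0) \<and> simplex_part n z \<in> P}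
        (\<lambda>z. metric_component n A (metric_of n A c0 (b (simplex_part n z))) c i j
               (inv_into (fst c) (snd c) (chart_part n z)))"
proof -
  let ?T = "{z \<in> Rn (n + m). chart_part n z \<in> snd c0 ` fst c0 \<and> simplex_part n z \<in> P}"
  let ?V = "snd c ` (fst c \<inter> fst c0)"
  let ?S = "{z \<in> Rn (n + m). chart_part n z \<in> snd c ` (fst c \<inter> fst c0) \<and> simplex_part n z \<in> P}"
  let ?t = "transition c c0"
  define G where "G z = (\<lambda>j. if j < n then ?t (chart_part n z) j else z j)" for z
  have V: "open_Rn n ?V" by (rule overlap_open[OF c c0])
  note VE = openin_subset[OF V]
  have SE: "?S \<subseteq> Rn (n + m)" by blast
  have S0E: "?T \<subseteq> Rn (n + m)" by blast
  have SV: "\<And>z. z \<in> ?S \<Longrightarrow> chart_part n z \<in> ?V" by blast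
  have point: "\<exists>p. p \<in> fst c \<and> p \<in> fst c0 \<and> chart_part n z = snd c p \<and>
      inv_into (fst c) (snd c) (chart_part n z) = p \<and> ?t (chart_part n z) = snd c0 p" if z: "z \<in> ?S" for z
  proof -
    obtain p where "p \<in> fst c" "p \<in> fst c0" "chart_part n z = snd c p" using z by blast
    then show ?thesis using transition_apply[OF c, of p c0] inv_into_f_f[OF chart_inj[OF c], of p] by auto
  qed
  have partsG: "chart_part n (G z) = ?t (chart_part n z) \<and> simplex_part n (G z) = simplex_part n z \<and> G z \<in> ?T"
    if z: "z \<in> ?S" for z
  proof -
    obtain p where p: "p \<in> fst c" "p \<in> fst c0" "?t (chart_part n z) = snd c0 p"
      using point[OF z] by blast
    have "snd c0 p \<in> Rn n"
      using openin_subset[OF chart_image_open[OF c0]] p(2) by blast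
    then have "chart_part n (G z) k = ?t (chart_part n z) k" for k
      unfolding chart_part_def[of n "G z"]
      by (cases "k < n") (simp_all add: G_def p(3) topspace_Euclidean_space)
    then have 1: "chart_part n (G z) = ?t (chart_part n z)" by (rule ext)
    have 2: "simplex_part n (G z) = simplex_part n z" by (simp add: simplex_part_def G_def)
    have "G z \<in> Rn (n + m)"
      using z by (simp add: G_def topspace_Euclidean_space)
    then show ?thesis using 1 2 p z by auto
  qed
  have tsm: "smooth_on_subset (n + m) ?S (\<lambda>z. ?t (chart_part n z) k)" if "k < n" for k
    by (rule smooth_compose_chart_part[OF SE VE transition_smooth[OF c c0 that] SV])
  have bsm: "smooth_on_subset (n + m) ?S (\<lambda>z. b (simplex_part n z) k l (?t (chart_part n z)))"
    if kl: "k < n" "l < n" for k l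
  proof -
    have "smooth_on_subset (n + m) ?S (\<lambda>z. b (simplex_part n (G z)) k l (chart_part n (G z)))"
    proof (rule smooth_on_subset_compose[OF b[OF kl] _ _ S0E SE])
      fix j
      show "smooth_on_subset (n + m) ?S (\<lambda>z. G z j)"
        unfolding G_def using tsm smooth_on_subset_coordinate[OF SE] by (cases "j < n") simp_all
    qed (use partsG in blast)
    then show ?thesis by (rule smooth_on_subset_cong) (use partsG in simp)
  qed
  have Jsm: "smooth_on_subset (n + m) ?S (\<lambda>z. partial_deriv i (\<lambda>x. ?t x k) (chart_part n z))"
    if ik: "i < n" "k < n" for i k
    by (rule smooth_compose_chart_part[OF SE VE smooth_on_subset_partial_deriv[OF V transition_smooth[OF c c0 ik(2)] ik(1)] SV])
  have "smooth_on_subset (n + m) ?S (\<lambda>z. \<Sum>k<n. \<Sum>l<n. b (simplex_part n z) k l (?t (chart_part n z)) *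
      partial_deriv i (\<lambda>x. ?t x k) (chart_part n z) * partial_deriv j (\<lambda>x. ?t x l) (chart_part n z))"
    by (intro smooth_on_subset_sum[OF SE] smooth_on_subset_mult bsm Jsm ij) auto
  then show ?thesis
  proof (rule smooth_on_subset_cong)
    fix z assume z: "z \<in> ?S"
    obtain p where p: "p \<in> fst c" "p \<in> fst c0" "chart_part n z = snd c p"
      "inv_into (fst c) (snd c) (chart_part n z) = p" "?t (chart_part n z) = snd c0 p"
      using point[OF z] by blast
    show "(\<Sum>k<n. \<Sum>l<n. b (simplex_part n z) k l (?t (chart_part n z)) *
        partial_deriv i (\<lambda>x. ?t x k) (chart_part n z) * partial_deriv j (\<lambda>x. ?t x l) (chart_part n z)) =
      metric_component n A (metric_of n A c0 (b (simplex_part n z))) c i j (inv_into (fst c) (snd c) (chart_part n z))"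
      unfolding p(4) p(5) metric_of_component[OF c p(1) c0 p(2) ij] by (simp only: jacobian_def p(3))
  qed
qed

lemma metric_of_smooth:
  assumes c: "c \<in> A" and c0: "c0 \<in> A" and ij: "i < n" "j < n"
    and a: "\<And>k l. k < n \<Longrightarrow> l < n \<Longrightarrow> smooth_on_subset n (snd c0 ` fst c0) (a k l)"
  shows "smooth_on_subset n (snd c ` (fst c \<inter> fst c0))
        (\<lambda>x. metric_component n A (metric_of n A c0 a) c i j (inv_into (fst c) (snd c) x))"
proof -
  have chart_part: "chart_part n z = z" if "z \<in> Rn n" for z
    using that by (auto simp: chart_part_def topspace_Euclidean_space)
  have set: "{z \<in> Rn (n + 0). chart_part n z \<in> V \<and> simplex_part n z \<in> UNIV} = V"
    if "V \<subseteq> Rn n" for V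
    using that chart_part by auto
  note E0 = openin_subset[OF chart_image_open[OF c0]] and E = openin_subset[OF overlap_open[OF c c0]]
  have "smooth_on_subset (n + 0) (snd c ` (fst c \<inter> fst c0))
        (\<lambda>z. metric_component n A (metric_of n A c0 a) c i j (inv_into (fst c) (snd c) (chart_part n z)))"
  proof (rule metric_of_family_smooth[OF c c0 ij, where m = 0 and P = UNIV and b = "\<lambda>s. a", unfolded set[OF E0] set[OF E]])
    fix k l assume kl: "k < n" "l < n"
    have "smooth_on_subset n (snd c0 ` fst c0) (\<lambda>z. a k l (chart_part n z))"
      by (rule smooth_on_subset_cong[OF a[OF kl]]) (use E0 chart_part in auto)
    then show "smooth_on_subset (n + 0) (snd c0 ` fst c0) (\<lambda>z. a k l (chart_part n z))" by simp
  qed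
  then have "smooth_on_subset n (snd c ` (fst c \<inter> fst c0))
        (\<lambda>z. metric_component n A (metric_of n A c0 a) c i j (inv_into (fst c) (snd c) (chart_part n z)))" by simp
  then show ?thesis
  proof (rule smooth_on_subset_cong)
    fix x assume "x \<in> snd c ` (fst c \<inter> fst c0)"
    then have "chart_part n x = x" using E by (intro chart_part) (rule subsetD)
    then show "metric_component n A (metric_of n A c0 a) c i j (inv_into (fst c) (snd c) (chart_part n x)) =
        metric_component n A (metric_of n A c0 a) c i j (inv_into (fst c) (snd c) x)" by (simp only:)
  qed
qed

lemma chart_by_maximality:
  assumes "is_chart n M c" "\<And>c'. c' \<in> A \<Longrightarrow> smooth_transition n c c' \<and> smooth_transition n c' c"
  shows "c \<in> A"
proof -
  have "\<forall>c. is_chart n M c \<and> (\<forall>c'\<in>A. smooth_transition n c c' \<and> smooth_transition n c' c) \<longrightarrow> c \<in> A"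
    using manifold unfolding smooth_manifold_def by (elim conjE)
  then show ?thesis using assms by (elim allE[of _ c]) simp
qed

text \<open>Composing a chart with a diffeomorphism between open sets of $\mathbb{R}^n$ yields a chart of
  the maximal atlas: its transition functions to and from any chart of the atlas are those of \<open>c0\<close>
  composed with \<open>\<eta>\<close> and \<open>\<psi>\<close>.\<close>

lemma smooth_reparametrized_chart:
  assumes c0: "c0 \<in> A" and W: "open_Rn n W" "W \<subseteq> snd c0 ` fst c0"
    and P: "open_Rn n (\<psi> ` W)"
    and s: "\<forall>k<n. smooth_on_subset n W (\<lambda>y. \<psi> y k)" and r: "\<forall>k<n. smooth_on_subset n (\<psi> ` W) (\<lambda>y. \<eta> y k)"
    and inv: "\<forall>y\<in>W. \<eta> (\<psi> y) = y"
  shows "({p \<in> fst c0. snd c0 p \<in> W}, \<lambda>p. \<psi> (snd c0 p)) \<in> A" (is "(?V, ?\<phi>) \<in> A")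
proof (rule chart_by_maximality)
  have WE: "W \<subseteq> Rn n" and PE: "\<psi> ` W \<subseteq> Rn n"
    using openin_subset W(1) P by auto
  have imV: "snd c0 ` ?V = W" using W(2) by auto
  have im: "?\<phi> ` ?V = \<psi> ` W" using imV by (metis image_image)
  have etaim: "\<eta> ` \<psi> ` W = W" using inv by (auto simp: image_image)
  have hom0: "homeomorphic_map (subtopology M ?V) (subtopology (Euclidean_space n) W) (snd c0)"
  proof -
    have "homeomorphic_map (subtopology (subtopology M (fst c0)) ?V)
        (subtopology (subtopology (Euclidean_space n) (snd c0 ` fst c0)) W) (snd c0)"
    proof (rule homeomorphic_map_subtopologies[OF chart_homeomorphic[OF c0]])
      show "snd c0 ` (topspace (subtopology M (fst c0)) \<inter> ?V) = topspace (subtopology (Euclidean_space n) (snd c0 ` fst c0)) \<inter> W"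
        using openin_subset[OF chart_open[OF c0]] imV W(2) WE by (auto simp: topspace_subtopology)
    qed
    moreover have "fst c0 \<inter> ?V = ?V" "snd c0 ` fst c0 \<inter> W = W" using W(2) by auto
    ultimately show ?thesis by (simp add: subtopology_subtopology)
  qed
  have hom1: "homeomorphic_map (subtopology (Euclidean_space n) W) (subtopology (Euclidean_space n) (\<psi> ` W)) \<psi>"
  proof -
    have "continuous_on W \<psi>" by (rule smooth_map_continuous_on[OF W(1) s PE])
    moreover have "continuous_on (\<psi> ` W) \<eta>"
      by (rule smooth_map_continuous_on[OF P r]) (simp only: etaim WE)
    ultimately have "homeomorphic_maps (top_of_set W) (top_of_set (\<psi> ` W)) \<psi> \<eta>"
      using inv etaim by (auto simp: homeomorphic_maps_def)
    then show ?thesis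
      unfolding topspace_subtopology_Euclidean_open[OF W(1)] topspace_subtopology_Euclidean_open[OF P]
      by (rule homeomorphic_maps_imp_map)
  qed
  have V: "openin M ?V"
  proof -
    have "openin (subtopology M (fst c0)) {p \<in> topspace (subtopology M (fst c0)). snd c0 p \<in> W}"
      using openin_continuous_map_preimage[OF homeomorphic_imp_continuous_map[OF chart_homeomorphic[OF c0]]]
        openin_subset_topspace_eq W by (simp add: openin_open_subtopology[OF chart_image_open[OF c0]])
    moreover have "{p \<in> topspace (subtopology M (fst c0)). snd c0 p \<in> W} = ?V"
      using openin_subset[OF chart_open[OF c0]] by (auto simp: topspace_subtopology)
    ultimately show ?thesis using openin_trans_full[OF _ chart_open[OF c0]] by simp
  qed
  show "is_chart n M (?V, ?\<phi>)"
    unfolding is_chart_def prod.case im using V P homeomorphic_map_compose[OF hom0 hom1] by (simp add: o_def)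
  fix c assume c: "c \<in> A"
  have pt: "transition (?V, ?\<phi>) c (\<psi> (snd c0 p)) = snd c p" if "p \<in> ?V" for p
  proof -
    have "inj_on ?\<phi> ?V"
    proof (rule inj_onI)
      fix p q assume pq: "p \<in> ?V" "q \<in> ?V" "\<psi> (snd c0 p) = \<psi> (snd c0 q)"
      then have "snd c0 p = snd c0 q" using inv by (metis (mono_tags, lifting) mem_Collect_eq)
      then show "p = q" using pq inj_onD[OF chart_inj[OF c0]] by auto
    qed
    from inv_into_f_f[OF this that] have "inv_into ?V ?\<phi> (\<psi> (snd c0 p)) = p" .
    then show ?thesis by (simp only: transition_def fst_conv snd_conv)
  qed
  have imVc: "?\<phi> ` (?V \<inter> fst c) \<subseteq> \<psi> ` W" using im by blast
  have sub1: "open_Rn n (snd c0 ` (fst c0 \<inter> fst c))" by (rule overlap_open[OF c0 c])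
  show "smooth_transition n (?V, ?\<phi>) c \<and> smooth_transition n c (?V, ?\<phi>)"
    unfolding smooth_transition_def fst_conv snd_conv
  proof (intro conjI allI impI)
    fix k assume k: "k < n"
    have "smooth_on_subset n (?\<phi> ` (?V \<inter> fst c)) (\<lambda>x. transition c0 c (\<eta> x) k)"
    proof (rule smooth_on_subset_compose[OF transition_smooth[OF c0 c k]])
      show "smooth_on_subset n (?\<phi> ` (?V \<inter> fst c)) (\<lambda>x. \<eta> x j)" if "j < n" for j
        by (rule smooth_on_subset_mono[OF r[rule_format, OF that] imVc])
      show "\<eta> x \<in> snd c0 ` (fst c0 \<inter> fst c)" if "x \<in> ?\<phi> ` (?V \<inter> fst c)" for x
        using that inv by auto
      show "snd c0 ` (fst c0 \<inter> fst c) \<subseteq> Rn n" by (rule openin_subset[OF sub1])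
      show "?\<phi> ` (?V \<inter> fst c) \<subseteq> Rn n" using imVc PE by blast
    qed
    then show "smooth_on_subset n (?\<phi> ` (?V \<inter> fst c)) (\<lambda>x. transition (?V, ?\<phi>) c x k)"
    proof (rule smooth_on_subset_cong)
      fix x assume "x \<in> ?\<phi> ` (?V \<inter> fst c)"
      then obtain p where p: "p \<in> ?V" "p \<in> fst c" "x = \<psi> (snd c0 p)" by blast
      then have "transition (?V, ?\<phi>) c x = snd c p" "transition c0 c (\<eta> x) = snd c p"
        using pt[OF p(1)] inv transition_apply[OF c0, of p c] by simp_all
      then show "transition c0 c (\<eta> x) k = transition (?V, ?\<phi>) c x k" by simp
    qed
    have S: "snd c ` (fst c \<inter> ?V) \<subseteq> snd c ` (fst c \<inter> fst c0)" by blast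
    have tW: "transition c c0 x = snd c0 p \<and> snd c0 p \<in> W \<and> transition c (?V, ?\<phi>) x = \<psi> (snd c0 p)"
      if "p \<in> fst c" "p \<in> ?V" "x = snd c p" for x p
      using that transition_apply[OF c, of p] by simp
    have "smooth_on_subset n (snd c ` (fst c \<inter> ?V)) (\<lambda>x. \<psi> (transition c c0 x) k)"
    proof (rule smooth_on_subset_compose[OF s[rule_format, OF k]])
      show "smooth_on_subset n (snd c ` (fst c \<inter> ?V)) (\<lambda>x. transition c c0 x j)" if "j < n" for j
        by (rule smooth_on_subset_mono[OF transition_smooth[OF c c0 that] S])
      show "transition c c0 x \<in> W" if "x \<in> snd c ` (fst c \<inter> ?V)" for x
        using that tW by auto
      show "snd c ` (fst c \<inter> ?V) \<subseteq> Rn n"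
        using S openin_subset[OF overlap_open[OF c c0]] by blast
    qed (rule WE)
    then show "smooth_on_subset n (snd c ` (fst c \<inter> ?V)) (\<lambda>x. transition c (?V, ?\<phi>) x k)"
      by (rule smooth_on_subset_cong) (use tW in auto)
  qed
qed

text \<open>The converse of \<open>flat_metric_coefficients\<close>: a flattening \<open>\<psi>\<close> composed with \<open>c0\<close> is a chart, and
  the components in it are \<open>(D\<eta>)\<^sup>T (D\<psi>)\<^sup>T D\<psi> D\<eta> = \<delta>\<close>.\<close>

lemma flat_metric_metric_of:
  assumes a: "flat_coefficients n (snd c0 ` fst c0) a" and c0: "c0 \<in> A"
  shows "flat_metric n A (fst c0) (metric_of n A c0 a)"
proof -
  have comps: "\<forall>(V, \<phi>)\<in>A. \<forall>i<n. \<forall>j<n. smooth_on_subset n (\<phi> ` (V \<inter> fst c0))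
          (\<lambda>x. metric_component n A (metric_of n A c0 a) (V, \<phi>) i j (inv_into V \<phi> x))"
  proof (intro ballI allI impI, clarify)
    fix V \<phi> i j assume "(V, \<phi>) \<in> A" "i < n" "j < n"
    then show "smooth_on_subset n (\<phi> ` (V \<inter> fst c0))
          (\<lambda>x. metric_component n A (metric_of n A c0 a) (V, \<phi>) i j (inv_into V \<phi> x))"
      using metric_of_smooth[OF _ c0 _ _ flat_coefficients_smooth[OF a], of "(V, \<phi>)" i j] by simp
  qed
  have riem: "riemannian_metric n A (fst c0) (metric_of n A c0 a)"
    unfolding riemannian_metric_def
  proof (intro conjI comps)
    show "\<forall>p\<in>fst c0. inner_product_on (tangent_space n A p) (metric_of n A c0 a p)"
      using metric_of_inner_product[OF a c0] by blast
    show "\<forall>p v w. p \<notin> fst c0 \<or> v \<notin> tangent_space n A p \<or> w \<notin> tangent_space n A p \<longrightarrow> metric_of n A c0 a p v w = 0"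
      by (auto simp: metric_of_def)
  qed
  have "\<exists>c\<in>A. p \<in> fst c \<and> fst c \<subseteq> fst c0 \<and> (\<forall>q\<in>fst c. \<forall>i<n. \<forall>j<n.
      metric_component n A (metric_of n A c0 a) c i j q = (if i = j then 1 else 0))" if p: "p \<in> fst c0" for p
  proof -
    have "snd c0 p \<in> snd c0 ` fst c0" using p by blast
    then obtain W \<psi> \<eta> where fl: "snd c0 p \<in> W" "W \<subseteq> snd c0 ` fst c0" "flattening n a W \<psi> \<eta>"
      by (rule flat_coefficientsE[OF a])
    note W = flatteningD(1)[OF fl(3)] fl(1,2) flatteningD(2-6)[OF fl(3)]
    define c where "c = ({p \<in> fst c0. snd c0 p \<in> W}, \<lambda>p. \<psi> (snd c0 p))"
    have c: "c \<in> A" unfolding c_def by (rule smooth_reparametrized_chart[OF c0 W(1,3,4-7)])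
    have comp: "metric_component n A (metric_of n A c0 a) c i j q = (if i = j then 1 else 0)"
      if q: "q \<in> fst c" and ij: "i < n" "j < n" for q i j
    proof -
      have q0: "q \<in> fst c0" and qW: "snd c0 q \<in> W" using q by (auto simp: c_def)
      let ?J = "\<lambda>m k. jacobian c0 c q m k" and ?K = "\<lambda>k i. jacobian c c0 q k i"
      have JJ: "jacobian c0 c q m k = partial_deriv k (\<lambda>x. \<psi> x m) (snd c0 q)" if "k < n" for m k
        unfolding jacobian_def
      proof (rule partial_deriv_cong[OF W(1) qW that])
        fix y assume "y \<in> W"
        then obtain p where "p \<in> fst c0" "y = snd c0 p" using W(3) by blast
        then show "transition c0 c y m = \<psi> y m" using transition_apply[OF c0, of p c] by (simp add: c_def)
      qed
      have "metric_component n A (metric_of n A c0 a) c i j q = (\<Sum>k<n. \<Sum>l<n. a k l (snd c0 q) * ?K k i * ?K l j)"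
        by (rule metric_of_component[OF c q c0 q0 ij])
      also have "\<dots> = (\<Sum>m<n. (\<Sum>k<n. ?J m k * ?K k i) * (\<Sum>l<n. ?J m l * ?K l j))"
        by (rule quadratic_form_gram) (use W(8) qW in \<open>simp add: JJ\<close>)
      also have "\<dots> = (\<Sum>m<n. jacobian c c q m i * jacobian c c q m j)"
        using jacobian_chain[OF c c0 c q q0 q] ij by simp
      also have "\<dots> = (\<Sum>m<n. (if i = m then 1 else 0) * (if j = m then 1 else 0))"
        by (simp add: jacobian_self[OF c q] ij)
      also have "\<dots> = (if j = i then 1 else 0)" by (rule sum_kronecker[OF ij(1)])
      finally show ?thesis by simp
    qed
    have "p \<in> fst c" "fst c \<subseteq> fst c0" using p W(2) by (auto simp: c_def)
    then show ?thesis using c comp by (intro bexI[of _ c]) auto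
  qed
  then show ?thesis using riem unfolding flat_metric_def by blast
qed

end

section \<open>The cone on a family of flat metrics of the ball\<close>

text \<open>The coefficients of the metrics in the cone on a family \<open>b\<close>. The barycentric coordinate \<open>s 0\<close> of
  the apex is the time of the deformation, and the remaining ones are normalized to a point of the
  opposite face. For \<open>s 0 < 1/3\<close> the metrics are dilated, towards a constant one at \<open>s 0 = 1/3\<close>; the
  standard metric is blended in from then on, and from \<open>s 0 = 2/3\<close> on the family \<open>b\<close> does not
  contribute any more. The arguments of the ramps are chosen such that the three factors are 1, 1 and 0
  at \<open>s 0 = 0\<close>.\<close>

definition cone_coefficients ::
    "((nat \<Rightarrow> real) \<Rightarrow> nat \<Rightarrow> nat \<Rightarrow> (nat \<Rightarrow> real) \<Rightarrow> real) \<Rightarrow> (nat \<Rightarrow> real) \<Rightarrow> nat \<Rightarrow> nat \<Rightarrow> (nat \<Rightarrow> real) \<Rightarrow> real" where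
  "cone_coefficients b s i j x =
     ramp (1 - 3 / 2 * s 0) * b (\<lambda>k. s (Suc k) * (1 / (1 - s 0))) i j (\<lambda>k. ramp (1 - 3 * s 0) * x k) +
     ramp (3 * s 0 - 1) * (if i = j then 1 else 0)"

lemma simplex_tail:
  assumes "s \<in> standard_simplex (Suc d)" "s 0 < 1"
  shows "(\<lambda>k. s (Suc k) * (1 / (1 - s 0))) \<in> standard_simplex d"
proof -
  have s: "\<And>i. 0 \<le> s i" "\<And>i. i > Suc d \<Longrightarrow> s i = 0" "(\<Sum>i\<le>Suc d. s i) = 1"
    using assms(1) by (auto simp: standard_simplex_def)
  have sum: "(\<Sum>i\<le>d. s (Suc i)) = 1 - s 0" using s(3) sum.atMost_Suc_shift[of s d] by linarith
  have "s (Suc k) \<le> 1 - s 0" for k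
  proof (cases "k \<le> d")
    case True
    then show ?thesis using member_le_sum[of k "{..d}" "\<lambda>i. s (Suc i)"] s(1) sum by simp
  next
    case False
    then show ?thesis using s(2)[of "Suc k"] assms(2) by simp
  qed
  then show ?thesis
    using s assms(2) sum by (simp add: standard_simplex_def sum_divide_distrib[symmetric])
qed

lemma simplex_vertex_bounds:
  assumes "s \<in> standard_simplex d" shows "0 \<le> s k" "s k \<le> 1"
  using assms by (auto simp: standard_simplex_def)

lemma unit_ball_open: "open_Rn n (unit_ball n)"
proof -
  have "open {x::nat \<Rightarrow> real. sqrt (\<Sum>i<n. (x i)\<^sup>2) < 1}"
    by (intro open_Collect_less continuous_intros continuous_on_product_coordinates)
  then show ?thesis
    unfolding Euclidean_space_eq_top_of_set openin_open unit_ball_def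
    by (auto simp: topspace_Euclidean_space)
qed

lemma unit_ball_scale:
  assumes "x \<in> unit_ball n" "0 \<le> l" "l \<le> 1"
  shows "(\<lambda>k. l * x k) \<in> unit_ball n"
proof -
  have "sqrt (\<Sum>i<n. (l * x i)\<^sup>2) = l * sqrt (\<Sum>i<n. (x i)\<^sup>2)"
    using assms(2) by (simp add: power_mult_distrib sum_distrib_left[symmetric] real_sqrt_mult)
  also have "\<dots> \<le> 1 * sqrt (\<Sum>i<n. (x i)\<^sup>2)"
    by (rule mult_right_mono[OF assms(3)]) (simp add: sum_nonneg)
  finally show ?thesis using assms(1) by (simp add: unit_ball_def topspace_Euclidean_space)
qed

lemma zero_in_unit_ball: "(\<lambda>k. 0) \<in> unit_ball n"
  by (simp add: unit_ball_def topspace_Euclidean_space)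

text \<open>As long as the dilation factor is positive, the standard metric is not blended in yet and the
  metric is a rescaled one. Afterwards the metric is constant, and positive definite because at every
  time at least one of the two coefficients of the combination is positive.\<close>

lemma cone_coefficients_flat:
  assumes b: "\<And>s. s \<in> standard_simplex d \<Longrightarrow> flat_coefficients n (unit_ball n) (b s)"
    and s: "s \<in> standard_simplex (Suc d)"
  shows "flat_coefficients n (unit_ball n) (cone_coefficients b s)"
proof (cases "s 0 < 1 / 3")
  case True
  let ?l = "ramp (1 - 3 * s 0)" and ?c = "ramp (1 - 3 / 2 * s 0)" and ?t = "\<lambda>k. s (Suc k) * (1 / (1 - s 0))"
  have "flat_coefficients n (unit_ball n) (\<lambda>i j x. ?c * b ?t i j (\<lambda>k. ?l * x k))"
  proof (rule flat_coefficients_scale[OF b unit_ball_open])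
    show "?t \<in> standard_simplex d" by (rule simplex_tail[OF s]) (use True in simp)
    show "0 < ?l" "0 < ?c" using True by (simp_all add: ramp_pos_iff)
    show "(\<lambda>k. ?l * x k) \<in> unit_ball n" if "x \<in> unit_ball n" for x
      using unit_ball_scale[OF that ramp_nonneg ramp_le_1] simplex_vertex_bounds[OF s] by simp
  qed
  moreover have "ramp (3 * s 0 - 1) = 0" using True by (simp add: ramp_eq_0_iff)
  ultimately show ?thesis by (simp add: cone_coefficients_def[abs_def])
next
  case False
  let ?c = "ramp (1 - 3 / 2 * s 0)" and ?t = "\<lambda>k. s (Suc k) * (1 / (1 - s 0))" and ?e = "ramp (3 * s 0 - 1)"
  define m where "m i j = ?c * b ?t i j (\<lambda>k. 0) + ?e * (if i = j then 1 else 0)" for i j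
  have eq: "cone_coefficients b s = (\<lambda>i j x. m i j)"
    using False by (simp add: cone_coefficients_def[abs_def] m_def ramp_eq_0_iff[THEN iffD2] fun_eq_iff)
  have flat: "flat_coefficients n (unit_ball n) (b ?t)" if "s 0 < 2 / 3"
    by (rule b[OF simplex_tail[OF s]]) (use that in simp)
  have c0: "?c = 0" if "\<not> s 0 < 2 / 3" using that by (simp add: ramp_eq_0_iff)
  show ?thesis unfolding eq
  proof (rule flat_coefficients_constant[OF unit_ball_open])
    show "m i j = m j i" if "i < n" "j < n" for i j
    proof (cases "s 0 < 2 / 3")
      case True
      then show ?thesis using flat_coefficients_symmetric[OF flat zero_in_unit_ball that] by (simp add: m_def)
    next
      case False
      show ?thesis unfolding m_def c0[OF False] by auto
    qed
    fix v :: "nat \<Rightarrow> real" and i assume v: "i < n" "v i \<noteq> 0"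
    have "(\<Sum>i<n. \<Sum>j<n. m i j * v i * v j) = ?c * (\<Sum>i<n. \<Sum>j<n. b ?t i j (\<lambda>k. 0) * v i * v j) +
        ?e * (\<Sum>i<n. \<Sum>j<n. (if i = j then 1 else 0) * (v i * v j))"
      by (simp add: m_def distrib_right sum.distrib sum_distrib_left mult.assoc)
    also have "(\<Sum>i<n. \<Sum>j<n. (if i = j then 1 else 0) * (v i * v j)) = (\<Sum>i<n. v i * v i)"
      by (intro sum.cong refl sum_kronecker) simp
    finally have q: "(\<Sum>i<n. \<Sum>j<n. m i j * v i * v j) =
      ?c * (\<Sum>i<n. \<Sum>j<n. b ?t i j (\<lambda>k. 0) * v i * v j) + ?e * (\<Sum>i<n. v i * v i)" .
    have sq: "0 < (\<Sum>i<n. v i * v i)"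
      by (rule sum_pos2[of _ i]) (use v in \<open>auto simp: zero_less_mult_iff\<close>)
    show "0 < (\<Sum>i<n. \<Sum>j<n. m i j * v i * v j)"
    proof (cases "s 0 < 2 / 3")
      case True
      have "0 < ?c * (\<Sum>i<n. \<Sum>j<n. b ?t i j (\<lambda>k. 0) * v i * v j)"
        by (rule mult_pos_pos[OF _ flat_coefficients_positive[where v = v, OF flat[OF True] zero_in_unit_ball v]])
          (use True in \<open>simp add: ramp_pos_iff\<close>)
      moreover have "0 \<le> ?e * (\<Sum>i<n. v i * v i)" using sq ramp_nonneg by simp
      ultimately show ?thesis unfolding q by linarith
    next
      case False
      then have "0 < ?e" by (simp add: ramp_pos_iff)
      then show ?thesis unfolding q c0[OF False] using sq by simp
    qed
  qed
qed

lemma smooth_affine_coordinate: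
  "S \<subseteq> Rn N \<Longrightarrow> smooth_on_subset N S (\<lambda>z. a + c * z j)"
  by (intro smooth_on_subset_add smooth_on_subset_mult smooth_on_subset_const smooth_on_subset_coordinate)

text \<open>The product of \<open>B\<close> and a simplex, encoded as in \<^const>\<open>smooth_family\<close>.\<close>

definition product_domain :: "nat \<Rightarrow> nat \<Rightarrow> (nat \<Rightarrow> real) set \<Rightarrow> (nat \<Rightarrow> real) set" where
  "product_domain n d B = {z \<in> Rn (n + Suc d).
     chart_part n z \<in> B \<and> simplex_part n z \<in> standard_simplex d}"

lemma product_domain_subset: "product_domain n d B \<subseteq> Rn (n + Suc d)"
  by (auto simp: product_domain_def)

text \<open>The normalization of the barycentric coordinates is smooth away from the apex. Near the apex
  the normalized coordinates do not enter.\<close>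

lemma cone_coefficients_smooth:
  assumes b: "smooth_on_subset (n + Suc d) (product_domain n d (unit_ball n))
      (\<lambda>z. b (simplex_part n z) i j (chart_part n z))"
  shows "smooth_on_subset (n + Suc (Suc d)) (product_domain n (Suc d) (unit_ball n))
      (\<lambda>z. cone_coefficients b (simplex_part n z) i j (chart_part n z))"
    (is "smooth_on_subset ?N ?D ?f")
proof (rule smooth_on_subset_local)
  let ?E = "Euclidean_space ?N"
  have s0: "simplex_part n z 0 = z n" for z by (simp add: simplex_part_def)
  have half: "openin ?E {z \<in> topspace ?E. g (z n)}" if "open {t::real. g t}" for g
  proof -
    have "continuous_on (topspace ?E) (\<lambda>z. z n)"
      by (rule smooth_on_subset_imp_continuous_on[OF openin_topspace smooth_on_subset_coordinate[OF order_refl]])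
    then have "continuous_map ?E euclideanreal (\<lambda>z. z n)"
      using continuous_map_Euclidean_space_iff by blast
    from openin_continuous_map_preimage[OF this, of "{t. g t}"] that show ?thesis by simp
  qed
  fix z0 assume z0: "z0 \<in> ?D"
  show "\<exists>W. openin ?E W \<and> z0 \<in> W \<and> smooth_on_subset ?N (?D \<inter> W) ?f"
  proof (cases "z0 n < 1")
    case True
    let ?W = "{z \<in> topspace ?E. z n < 1}"
    let ?S = "?D \<inter> ?W"
    have SE: "?S \<subseteq> topspace ?E" by blast
    define G where "G z = (\<lambda>k. if k < n then ramp (1 - 3 * z n) * z k else if k < n + Suc d then z (Suc k) * (1 / (1 - z n)) else 0)" for z
    have ch: "chart_part n (G z) = (\<lambda>k. ramp (1 - 3 * z n) * chart_part n z k)" for z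
      by (auto simp: chart_part_def G_def fun_eq_iff)
    have si: "simplex_part n (G z) = (\<lambda>k. simplex_part n z (Suc k) * (1 / (1 - simplex_part n z 0)))" if "z \<in> topspace ?E" for z
      using that by (auto simp: simplex_part_def G_def fun_eq_iff topspace_Euclidean_space)
    have aff: "smooth_on_subset ?N ?S (\<lambda>z. ramp (1 - c * z n))" "smooth_on_subset ?N ?S (\<lambda>z. ramp (c * z n - 1))" for c
      using smooth_ramp[OF smooth_affine_coordinate[OF SE, of 1 "- c" n]]
        smooth_ramp[OF smooth_affine_coordinate[OF SE, of "-1" c n]] by (simp_all add: algebra_simps)
    have inv: "smooth_on_subset ?N ?S (\<lambda>z. 1 / (1 - z n))"
      using smooth_inverse[OF smooth_affine_coordinate[OF SE, of 1 "-1" n]] by simp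
    have "smooth_on_subset ?N ?S (\<lambda>z. b (simplex_part n (G z)) i j (chart_part n (G z)))"
    proof (rule smooth_on_subset_compose[OF b _ _ product_domain_subset SE])
      fix k assume k: "k < n + Suc d"
      show "smooth_on_subset ?N ?S (\<lambda>z. G z k)"
      proof (cases "k < n")
        case True
        then show ?thesis
          using smooth_on_subset_mult[OF aff(1) smooth_on_subset_coordinate[OF SE]] by (simp add: G_def)
      next
        case False
        then show ?thesis
          using smooth_on_subset_mult[OF smooth_on_subset_coordinate[OF SE] inv] k by (simp add: G_def)
      qed
    next
      fix z assume z: "z \<in> ?S"
      then have zE: "z \<in> topspace ?E" and zs: "simplex_part n z \<in> standard_simplex (Suc d)"
        and zc: "chart_part n z \<in> unit_ball n" and zn: "z n < 1" by (auto simp: product_domain_def)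
      have "chart_part n (G z) \<in> unit_ball n"
        unfolding ch using simplex_vertex_bounds(1)[OF zs, of 0]
        by (intro unit_ball_scale[OF zc ramp_nonneg ramp_le_1]) (simp add: s0)
      moreover have "simplex_part n (G z) \<in> standard_simplex d"
        unfolding si[OF zE] by (rule simplex_tail[OF zs]) (simp add: s0 zn)
      moreover have "G z \<in> Rn (n + Suc d)"
        by (simp add: G_def topspace_Euclidean_space)
      ultimately show "G z \<in> product_domain n d (unit_ball n)" by (simp add: product_domain_def)
    qed
    then have "smooth_on_subset ?N ?S (\<lambda>z. ramp (1 - 3 / 2 * z n) * b (simplex_part n (G z)) i j (chart_part n (G z)) +
        ramp (3 * z n - 1) * (if i = j then 1 else 0))"
      by (intro smooth_on_subset_add smooth_on_subset_mult smooth_on_subset_const[OF SE] aff)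
    then have "smooth_on_subset ?N ?S ?f"
      by (rule smooth_on_subset_cong) (simp add: cone_coefficients_def ch si s0)
    moreover have "z0 \<in> ?W" using z0 True by (auto simp: product_domain_def)
    moreover have "openin ?E ?W" by (rule half) (simp add: open_Collect_less)
    ultimately show ?thesis by blast
  next
    case False
    let ?W = "{z \<in> topspace ?E. z n > 2 / 3}"
    let ?S = "?D \<inter> ?W"
    have SE: "?S \<subseteq> topspace ?E" by blast
    have "smooth_on_subset ?N ?S (\<lambda>z. ramp (-1 + 3 * z n) * (if i = j then 1 else 0))"
      by (intro smooth_on_subset_mult smooth_ramp smooth_affine_coordinate smooth_on_subset_const SE)
    then have "smooth_on_subset ?N ?S ?f"
    proof (rule smooth_on_subset_cong)
      fix z assume "z \<in> ?S"
      then have "ramp (1 - 3 / 2 * z n) = 0" by (simp add: ramp_eq_0_iff)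
      then show "ramp (-1 + 3 * z n) * (if i = j then 1 else 0) = ?f z"
        by (simp add: cone_coefficients_def s0)
    qed
    moreover have "z0 \<in> ?W" using z0 False by (auto simp: product_domain_def)
    moreover have "openin ?E ?W" by (rule half) (rule open_Collect_less[OF continuous_on_const continuous_on_id])
    ultimately show ?thesis by blast
  qed
qed

section \<open>Homotopy groups of contractible spaces\<close>

lemma nsphere_eq_top_of_set: "nsphere k = top_of_set {x. (\<Sum>i\<le>k. (x i)\<^sup>2) = 1 \<and> (\<forall>i>k. x i = 0)}"
  unfolding nsphere by (simp only: euclidean_product_topology)

lemma sphere_base_in_nsphere: "sphere_base \<in> topspace (nsphere k)"
  using in_topspace_nsphere by (simp add: sphere_base_def)

text \<open>A contraction moves the base point, so it gives a free homotopy only. But it extends \<open>f\<close> to a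
  map of the disc: the point at distance \<open>r\<close> from the origin in direction \<open>w\<close> goes to the point reached from \<open>f w\<close> at
  the time \<open>2 - 2r\<close> of the contraction, and a small disc is mapped to the point \<open>c\<close>. The
  straight-line homotopy of the sphere to the base point, inside the disc, fixes the base point.\<close>

lemma pointed_nullhomotopic:
  assumes H: "homotopic_with (\<lambda>x. True) X X id (\<lambda>x. c)"
    and f: "continuous_map (nsphere k) X f" "f sphere_base = x0"
  shows "pointed_homotopic k X x0 f (\<lambda>s. x0)"
proof -
  obtain H where H: "continuous_map (prod_topology (top_of_set {0..1::real}) X) X H"
    "\<And>x. H (0, x) = x" "\<And>x. H (1, x) = c"
    using H unfolding homotopic_with_def by auto
  let ?S = "{x::nat \<Rightarrow> real. (\<Sum>i\<le>k. (x i)\<^sup>2) = 1 \<and> (\<forall>i>k. x i = 0)}"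
  let ?D = "{0..1::real} \<times> ?S"
  \<comment> \<open>\<open>u\<close> is the straight-line homotopy in the disc, \<open>r\<close> the distance of its value from the origin. The time of
     the contraction is clamped to the unit interval, which makes a bound on \<open>r\<close> unnecessary.\<close>
  define u where "u p = (\<lambda>i. (1 - fst p) * snd p i + fst p * sphere_base i)" for p :: "real \<times> (nat \<Rightarrow> real)"
  define r where "r p = sqrt (\<Sum>i\<le>k. (u p i)\<^sup>2)" for p
  define g where "g p = H (max 0 (min 1 (2 - 2 * r p)), f (\<lambda>i. u p i / r p))" for p
  define h where "h p = (if r p \<le> 1 / 2 then c else g p)" for p
  have dom: "prod_topology (top_of_set {0..1::real}) (nsphere k) = top_of_set ?D"
    unfolding nsphere_eq_top_of_set by (simp add: prod_topology_subtopology subtopology_subtopology Times_Int_Times)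
  have snd_i: "continuous_on T (\<lambda>p. snd p i)" for T and i :: nat and  x :: "real \<times> (nat \<Rightarrow> real)"
    by (rule continuous_on_product_then_coordinatewise[OF continuous_on_snd[OF continuous_on_id]])
  have cu: "continuous_on T (\<lambda>p. u p i)" for T i
    unfolding u_def by (intro continuous_intros snd_i)
  have cr: "continuous_on T r" for T
    unfolding r_def by (intro continuous_intros cu)
  have fb: "sphere_base i = 0" if "i > k" for i using that by (simp add: sphere_base_def)
  have cont_g: "continuous_map (subtopology (top_of_set ?D) {p \<in> topspace (top_of_set ?D). 1 / 2 \<le> r p}) X g"
  proof -
    let ?T = "{p \<in> ?D. 1 / 2 \<le> r p}"
    have eq: "subtopology (top_of_set ?D) {p \<in> topspace (top_of_set ?D). 1 / 2 \<le> r p} = top_of_set ?T"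
      by (simp add: subtopology_subtopology) (metis (no_types, lifting) inf.absorb_iff2 mem_Collect_eq subsetI)
    have "continuous_on ?T (\<lambda>p i. u p i / r p)"
    proof (rule continuous_on_coordinatewise_then_product)
      show "continuous_on ?T (\<lambda>p. u p i / r p)" for i
        by (intro continuous_on_divide cu cr) auto
    qed
    moreover have "(\<lambda>i. u p i / r p) \<in> ?S" if p: "p \<in> ?T" for p
    proof -
      have rp: "r p > 0" using p by auto
      have "(\<Sum>i\<le>k. (u p i)\<^sup>2) = (r p)\<^sup>2" by (simp add: r_def sum_nonneg)
      then have "(\<Sum>i\<le>k. (u p i / r p)\<^sup>2) = 1"
        using rp by (simp add: power_divide sum_divide_distrib[symmetric])
      moreover have "u p i = 0" if "i > k" for i using p that fb by (auto simp: u_def)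
      ultimately show ?thesis by simp
    qed
    ultimately have "continuous_map (top_of_set ?T) (nsphere k) (\<lambda>p i. u p i / r p)"
      unfolding nsphere_eq_top_of_set by auto
    then have 1: "continuous_map (top_of_set ?T) X (\<lambda>p. f (\<lambda>i. u p i / r p))"
      using continuous_map_compose[OF _ f(1)] by (simp add: o_def)
    have "continuous_on ?T (\<lambda>p. max 0 (min 1 (2 - 2 * r p)))"
      by (intro continuous_intros cr)
    then have 2: "continuous_map (top_of_set ?T) (top_of_set {0..1}) (\<lambda>p. max 0 (min 1 (2 - 2 * r p)))"
      by auto
    have "continuous_map (top_of_set ?T) (prod_topology (top_of_set {0..1}) X)
        (\<lambda>p. (max 0 (min 1 (2 - 2 * r p)), f (\<lambda>i. u p i / r p)))"
      using 1 2 by (simp add: continuous_map_pairwise o_def)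
    from continuous_map_compose[OF this H(1)] show ?thesis
      unfolding eq g_def[abs_def] by (simp only: o_def)
  qed
  have cX: "c \<in> topspace X"
    using assms(1) homotopic_with_imp_continuous_maps continuous_map_image_subset_topspace f(1) sphere_base_in_nsphere
    by (metis (no_types, lifting) continuous_map_const equals0D continuous_map_def Pi_iff)
  have cont: "continuous_map (top_of_set ?D) X (\<lambda>p. if r p \<le> 1 / 2 then c else g p)"
  proof (rule continuous_map_cases_le)
    show "continuous_map (top_of_set ?D) euclideanreal r" using cr by simp
    show "continuous_map (subtopology (top_of_set ?D) {x \<in> topspace (top_of_set ?D). r x \<le> 1 / 2}) X (\<lambda>p. c)"
      using cX by simp
    show "c = g p" if "r p = 1 / 2" for p using that H(3) by (simp add: g_def)
  qed (use cont_g in auto)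
  have base: "h (t, sphere_base) = x0" for t
  proof -
    have "u (t, sphere_base) = sphere_base" by (auto simp: u_def fun_eq_iff algebra_simps)
    moreover from this have "r (t, sphere_base) = 1"
      using sphere_base_in_nsphere[of k] by (simp add: r_def nsphere_eq_top_of_set)
    ultimately show ?thesis using f(2) H(2) by (simp add: h_def g_def)
  qed
  have h0: "h (0, s) = f s" if "s \<in> topspace (nsphere k)" for s
  proof -
    have "u (0, s) = s" by (simp add: u_def)
    moreover from this have "r (0, s) = 1" using that by (simp add: r_def nsphere_eq_top_of_set)
    ultimately show ?thesis using H(2) by (simp add: h_def g_def)
  qed
  have h1: "h (1, s) = x0" for s
  proof -
    have "u (1, s) = u (1, sphere_base)" by (simp add: u_def)
    then have "h (1, s) = h (1, sphere_base)" by (simp add: h_def g_def r_def)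
    then show ?thesis using base by simp
  qed
  show ?thesis unfolding pointed_homotopic_def
  proof (subst homotopic_with)
    show "\<And>h k'. (\<And>x. x \<in> topspace (nsphere k) \<Longrightarrow> h x = k' x) \<Longrightarrow> (h sphere_base = x0) = (k' sphere_base = x0)"
      using sphere_base_in_nsphere[of k] by metis
    show "\<exists>h. continuous_map (prod_topology (top_of_set {0..1::real}) (nsphere k)) X h \<and>
        (\<forall>x\<in>topspace (nsphere k). h (0, x) = f x) \<and> (\<forall>x\<in>topspace (nsphere k). h (1, x) = x0) \<and>
        (\<forall>t\<in>{0..1}. h (t, sphere_base) = x0)"
      using cont h0 h1 base unfolding dom by (intro exI[of _ h]) (auto simp: h_def[abs_def])
  qed
qed

text \<open>All pointed maps are homotopic to the constant one, hence there is one class, and it consists of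
  all pointed maps.\<close>

lemma homotopy_group_contractible:
  assumes H: "homotopic_with (\<lambda>x. True) X X id (\<lambda>x. c)" and x: "x \<in> topspace X"
  shows "homotopy_group k X x = {{h. continuous_map (nsphere k) X h \<and> h sphere_base = x}}"
proof -
  let ?M = "{h. continuous_map (nsphere k) X h \<and> h sphere_base = x}"
  have "{h'. pointed_homotopic k X x h h'} = ?M" if h: "h \<in> ?M" for h
  proof (intro equalityI subsetI)
    fix h' assume "h' \<in> {h'. pointed_homotopic k X x h h'}"
    then have "homotopic_with (\<lambda>h. h sphere_base = x) (nsphere k) X h h'" by (simp add: pointed_homotopic_def)
    then show "h' \<in> ?M"
      using homotopic_with_imp_continuous_maps homotopic_with_imp_property by blast
  next
    fix h' assume h': "h' \<in> ?M"
    have "pointed_homotopic k X x h (\<lambda>s. x)" "pointed_homotopic k X x h' (\<lambda>s. x)"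
      using h h' pointed_nullhomotopic[OF H] by auto
    then show "h' \<in> {h'. pointed_homotopic k X x h h'}"
      unfolding pointed_homotopic_def mem_Collect_eq by (metis homotopic_with_symD homotopic_with_trans)
  qed
  then have "(\<lambda>h. {h'. pointed_homotopic k X x h h'}) ` ?M = (\<lambda>h. ?M) ` ?M" by (intro image_cong refl)
  moreover have "(\<lambda>s. x) \<in> ?M" using x by simp
  ultimately show ?thesis unfolding homotopy_group_def using image_constant[of "\<lambda>s. x" ?M ?M] by (simp only:)
qed

lemma path_components_of_contractible:
  assumes "contractible_space X" "x \<in> topspace X"
  shows "path_components_of X = {topspace X}" "\<And>y. y \<in> topspace X \<Longrightarrow> path_component_of_set X y = topspace X"
proof -
  have "path_connected_space X" by (rule contractible_imp_path_connected_space[OF assms(1)])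
  then show *: "path_component_of_set X y = topspace X" if "y \<in> topspace X" for y
    using that unfolding path_connected_space_path_component_set by simp
  have "path_components_of X = (\<lambda>y. topspace X) ` topspace X"
    unfolding path_components_of_def by (rule image_cong[OF refl *])
  then show "path_components_of X = {topspace X}" using image_constant[OF assms(2), of "topspace X"] by simp
qed

text \<open>On path components and on homotopy groups the map is one between singletons.\<close>

lemma weak_homotopy_equivalence_contractible:
  assumes X: "contractible_space X" "topspace X \<noteq> {}" and Y: "contractible_space Y"
    and f: "continuous_map X Y f"
  shows "weak_homotopy_equivalence X Y f"
  unfolding weak_homotopy_equivalence_def
proof (intro conjI ballI allI impI f)
  obtain x where x: "x \<in> topspace X" using X(2) by blast
  have fY: "f x \<in> topspace Y" if "x \<in> topspace X" for x
    using f that by (auto simp: continuous_map_def)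
  note PX = path_components_of_contractible[OF X(1) x] and PY = path_components_of_contractible[OF Y fY[OF x]]
  have "(\<Union>x\<in>topspace X. path_component_of_set Y (f x)) = topspace Y"
    using PY(2)[OF fY] x by auto
  then show "bij_betw (\<lambda>C. \<Union>x\<in>C. path_component_of_set Y (f x)) (path_components_of X) (path_components_of Y)"
    unfolding PX(1) PY(1) by (simp add: bij_betw_def)
next
  fix x k assume x: "x \<in> topspace X"
  then have y: "f x \<in> topspace Y" using f by (auto simp: continuous_map_def)
  obtain c where c: "homotopic_with (\<lambda>x. True) X X id (\<lambda>x. c)" using X(1) unfolding contractible_space_def by blast
  obtain c' where c': "homotopic_with (\<lambda>x. True) Y Y id (\<lambda>x. c')" using Y unfolding contractible_space_def by blast
  let ?A = "{h. continuous_map (nsphere k) X h \<and> h sphere_base = x}"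
  let ?B = "{h. continuous_map (nsphere k) Y h \<and> h sphere_base = f x}"
  note A = homotopy_group_contractible[OF c x, of k] and B = homotopy_group_contractible[OF c' y, of k]
  have cls: "{h'. pointed_homotopic k Y (f x) g h'} = ?B" if "g \<in> ?B" for g
  proof -
    have "{h'. pointed_homotopic k Y (f x) g h'} \<in> homotopy_group k Y (f x)"
      using that unfolding homotopy_group_def by blast
    then show ?thesis unfolding B by simp
  qed
  have "(\<Union>h\<in>?A. {h'. pointed_homotopic k Y (f x) (f \<circ> h) h'}) = (\<Union>h\<in>?A. ?B)"
  proof (rule SUP_cong[OF refl], rule cls)
    fix h assume "h \<in> ?A"
    then show "f \<circ> h \<in> ?B" using continuous_map_compose[of "nsphere k" X h Y f] f by simp
  qed
  moreover have "(\<lambda>s. x) \<in> ?A" using x by simp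
  moreover have "(\<Union>h\<in>?A. ?B) = ?B"
  proof (rule SUP_const, rule notI)
    assume "?A = {}"
    from equals0D[OF this] \<open>(\<lambda>s. x) \<in> ?A\<close> show False by (rule notE)
  qed
  ultimately have "homotopy_group_map k Y (f x) f ?A = ?B" unfolding homotopy_group_map_def by (simp only:)
  then show "bij_betw (homotopy_group_map k Y (f x) f) (homotopy_group k X x) (homotopy_group k Y (f x))"
    unfolding A B by (simp add: bij_betw_def)
qed

section \<open>Geometric realization\<close>

lemma quotient_map_quotient_topology: "quotient_map T (quotient_topology T q) q"
proof -
  have top: "topspace (quotient_topology T q) = q ` topspace T"
  proof (rule antisym)
    show "topspace (quotient_topology T q) \<subseteq> q ` topspace T"
      using openin_topspace[of "quotient_topology T q"] unfolding openin_quotient_topology by (rule conjunct1)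
    have "{x \<in> topspace T. q x \<in> q ` topspace T} = topspace T" by blast
    then have "openin (quotient_topology T q) (q ` topspace T)" unfolding openin_quotient_topology by simp
    then show "q ` topspace T \<subseteq> topspace (quotient_topology T q)" by (rule openin_subset)
  qed
  show ?thesis unfolding quotient_map_def top
  proof (intro conjI allI impI refl)
    fix W assume "W \<subseteq> q ` topspace T"
    then show "openin T {x \<in> topspace T. q x \<in> W} = openin (quotient_topology T q) W"
      unfolding openin_quotient_topology by simp
  qed
qed

lemma topspace_cells: "topspace (cells X) = {((d, x), s). x \<in> simplices X d \<and> s \<in> standard_simplex d}"
  by (auto simp: cells_def)

lemma quotient_map_realization: "quotient_map (cells X) (realization X) (cell_class X)"
  unfolding realization_def by (rule quotient_map_quotient_topology)

lemma topspace_realization: "topspace (realization X) = cell_class X ` topspace (cells X)"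
  using quotient_imp_surjective_map[OF quotient_map_realization[of X]] by simp

lemma cell_class_eq_iff: "cell_class X a = cell_class X b \<longleftrightarrow> equivclp (glue X) a b"
proof
  assume "cell_class X a = cell_class X b"
  then have "b \<in> cell_class X a" by (simp add: cell_class_def)
  then show "equivclp (glue X) a b" by (simp add: cell_class_def)
next
  assume ab: "equivclp (glue X) a b"
  then show "cell_class X a = cell_class X b"
    unfolding cell_class_def
    by (intro Collect_cong iffI) (rule equivclp_trans[OF equivclp_sym[OF ab]] equivclp_trans[OF ab]; assumption)+
qed

text \<open>The gluing relation, as an equation between points of the realization.\<close>

lemma cell_class_act:
  assumes "\<theta> \<in> simplex_maps m d" "x \<in> simplices X d" "s \<in> standard_simplex m"
  shows "cell_class X ((m, act X m d \<theta> x), s) = cell_class X ((d, x), simplex_push m \<theta> s)"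
  unfolding cell_class_eq_iff by (rule r_into_equivclp) (rule glue.intros[OF assms])

text \<open>The sum over the fibres of \<open>\<theta>\<close> of the coordinates is the sum of all coordinates.\<close>

lemma simplex_push_in_simplex:
  assumes \<theta>: "\<theta> \<in> simplex_maps m d" and s: "s \<in> standard_simplex m"
  shows "simplex_push m \<theta> s \<in> standard_simplex d"
proof -
  have s': "\<And>i. 0 \<le> s i" "(\<Sum>i\<le>m. s i) = 1" using s by (auto simp: standard_simplex_def)
  have \<theta>': "\<And>i. i \<le> m \<Longrightarrow> \<theta> i \<le> d" using \<theta> by (auto simp: simplex_maps_def PiE_iff)
  have le1: "simplex_push m \<theta> s j \<le> 1" for j
    unfolding simplex_push_def s'(2)[symmetric] by (rule sum_mono2) (use s' in auto)
  have "simplex_push m \<theta> s j = 0" if "j > d" for j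
    unfolding simplex_push_def using \<theta>' that by (intro sum.neutral) (auto simp: not_le[symmetric])
  moreover have "(\<Sum>j\<le>d. simplex_push m \<theta> s j) = 1"
    unfolding simplex_push_def using sum.group[of "{..m}" "{..d}" \<theta> s] \<theta>' s'(2) by auto
  moreover have "0 \<le> simplex_push m \<theta> s j" for j
    unfolding simplex_push_def using s' by (intro sum_nonneg) auto
  ultimately show ?thesis using le1 by (simp add: standard_simplex_def)
qed

lemma glue_in_cells:
  assumes X: "simplicial_set X" and "glue X a b"
  shows "a \<in> topspace (cells X)" "b \<in> topspace (cells X)"
proof -
  from assms(2) have "a \<in> topspace (cells X) \<and> b \<in> topspace (cells X)"
  proof cases
    case (1 \<theta> m d x s)
    have "act X m d \<theta> x \<in> simplices X m" using X 1 unfolding simplicial_set_def by blast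
    then show ?thesis using 1 simplex_push_in_simplex[OF 1(3) 1(5)] by (simp add: topspace_cells)
  qed
  then show "a \<in> topspace (cells X)" "b \<in> topspace (cells X)" by auto
qed

text \<open>The gluing relation relates points of cells only. A class is a set of arbitrary triples, and
  this ensures that the class of a point of a cell does not contain spurious ones.\<close>

lemma equivclp_in_cells:
  assumes X: "simplicial_set X" and "equivclp (glue X) a b" "a \<in> topspace (cells X)"
  shows "b \<in> topspace (cells X)"
  using assms(2,3) by (induction rule: equivclp_induct) (use glue_in_cells[OF X] in blast)+

section \<open>Simplicial sets with a natural cone\<close>

text \<open>The operator \<open>\<theta>\<close> with an additional vertex 0 in front, which it preserves.\<close>

definition cone_lift :: "nat \<Rightarrow> (nat \<Rightarrow> nat) \<Rightarrow> (nat \<Rightarrow> nat)" where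
  "cone_lift m \<theta> = restrict (\<lambda>i. case i of 0 \<Rightarrow> 0 | Suc j \<Rightarrow> Suc (\<theta> j)) {..Suc m}"

text \<open>The point at time \<open>t\<close> on the segment from the vertex 0 to the point \<open>s\<close> of the opposite face.\<close>

definition cone_point :: "real \<Rightarrow> (nat \<Rightarrow> real) \<Rightarrow> (nat \<Rightarrow> real)" where
  "cone_point t s = (\<lambda>j. case j of 0 \<Rightarrow> 1 - t | Suc i \<Rightarrow> t * s i)"

lemma cone_lift_in_simplex_maps:
  assumes "\<theta> \<in> simplex_maps m d" shows "cone_lift m \<theta> \<in> simplex_maps (Suc m) (Suc d)"
proof -
  have \<theta>: "\<And>i. i \<le> m \<Longrightarrow> \<theta> i \<le> d" "mono_on {..m} \<theta>"
    using assms by (auto simp: simplex_maps_def PiE_iff)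
  have "mono_on {..Suc m} (cone_lift m \<theta>)"
  proof (rule mono_onI)
    fix i j assume "i \<in> {..Suc m}" "j \<in> {..Suc m}" "i \<le> j"
    then show "cone_lift m \<theta> i \<le> cone_lift m \<theta> j"
      using mono_onD[OF \<theta>(2)] by (cases i; cases j) (auto simp: cone_lift_def)
  qed
  then show ?thesis
    using \<theta>(1) by (auto simp: simplex_maps_def cone_lift_def PiE_iff split: nat.splits)
qed

lemma Suc_in_simplex_maps: "restrict Suc {..d} \<in> simplex_maps d (Suc d)"
  by (auto simp: simplex_maps_def PiE_iff intro!: mono_onI)

lemma vertex_in_simplex_maps: "restrict (\<lambda>i. 0) {..m} \<in> simplex_maps m d"
  by (auto simp: simplex_maps_def PiE_iff intro!: mono_onI)

lemma simplex_push_cone_lift_0: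
  "simplex_push (Suc m) (cone_lift m \<theta>) s 0 = s 0"
proof -
  have "{i \<in> {..Suc m}. cone_lift m \<theta> i = 0} = {0}"
  proof (rule Set.set_eqI)
    show "i \<in> {i \<in> {..Suc m}. cone_lift m \<theta> i = 0} \<longleftrightarrow> i \<in> {0}" for i
      by (cases i) (auto simp: cone_lift_def)
  qed
  then show ?thesis by (simp add: simplex_push_def)
qed

lemma simplex_push_cone_lift_Suc:
  "simplex_push (Suc m) (cone_lift m \<theta>) s (Suc j) = simplex_push m \<theta> (\<lambda>i. s (Suc i)) j"
proof -
  have "{i \<in> {..Suc m}. cone_lift m \<theta> i = Suc j} = Suc ` {i \<in> {..m}. \<theta> i = j}"
  proof (rule Set.set_eqI)
    show "i \<in> {i \<in> {..Suc m}. cone_lift m \<theta> i = Suc j} \<longleftrightarrow> i \<in> Suc ` {i \<in> {..m}. \<theta> i = j}" for i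
      by (cases i) (auto simp: cone_lift_def)
  qed
  then show ?thesis by (simp add: simplex_push_def sum.reindex)
qed

lemma simplex_push_scale: "simplex_push m \<theta> (\<lambda>i. s i * c) j = simplex_push m \<theta> s j * c"
  by (simp add: simplex_push_def sum_distrib_right)

lemma simplex_push_cone_point:
  "simplex_push (Suc m) (cone_lift m \<theta>) (cone_point t s) = cone_point t (simplex_push m \<theta> s)"
proof
  fix j
  show "simplex_push (Suc m) (cone_lift m \<theta>) (cone_point t s) j = cone_point t (simplex_push m \<theta> s) j"
    using simplex_push_scale[of m \<theta> s t]
    by (cases j) (simp_all add: simplex_push_cone_lift_0 simplex_push_cone_lift_Suc cone_point_def mult.commute)
qed

lemma simplex_push_Suc:
  assumes "s \<in> standard_simplex d"
  shows "simplex_push d (restrict Suc {..d}) s = cone_point 1 s"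
proof
  fix j
  show "simplex_push d (restrict Suc {..d}) s j = cone_point 1 s j"
  proof (cases j)
    case 0
    then have "{i \<in> {..d}. restrict Suc {..d} i = j} = {}" by auto
    then show ?thesis using 0 by (simp add: simplex_push_def cone_point_def)
  next
    case (Suc i)
    show ?thesis
    proof (cases "i \<le> d")
      case True
      then have "{i \<in> {..d}. restrict Suc {..d} i = j} = {i}" using Suc by auto
      then show ?thesis using Suc by (simp add: simplex_push_def cone_point_def)
    next
      case False
      then have "{i \<in> {..d}. restrict Suc {..d} i = j} = {}" using Suc by auto
      moreover have "s i = 0" using assms False by (simp add: standard_simplex_def)
      ultimately show ?thesis using Suc by (simp add: simplex_push_def cone_point_def)
    qed
  qed
qed

definition simplex_vertex :: "nat \<Rightarrow> real" where "simplex_vertex = (\<lambda>j. if j = 0 then 1 else 0)"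

lemma simplex_vertex_in: "simplex_vertex \<in> standard_simplex d"
  unfolding simplex_vertex_def using basis_in_standard_simplex[of 0 d] by (simp add: eq_commute)

lemma simplex_push_vertex:
  assumes "s \<in> standard_simplex m"
  shows "simplex_push m (restrict (\<lambda>i. 0) {..m}) s = simplex_vertex"
proof
  fix j :: nat
  have "{i \<in> {..m}. restrict (\<lambda>i. 0) {..m} i = j} = (if j = 0 then {..m} else {})" by auto
  then show "simplex_push m (restrict (\<lambda>i. 0) {..m}) s j = simplex_vertex j"
    using assms by (simp add: simplex_push_def simplex_vertex_def standard_simplex_def)
qed

lemma cone_point_0: "cone_point 0 s = simplex_vertex"
  by (auto simp: cone_point_def simplex_vertex_def split: nat.splits)

lemma cone_point_in_simplex:
  assumes s: "s \<in> standard_simplex d" and t: "0 \<le> t" "t \<le> 1"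
  shows "cone_point t s \<in> standard_simplex (Suc d)"
proof -
  have s': "\<And>i. 0 \<le> s i" "\<And>i. s i \<le> 1" "\<And>i. i > d \<Longrightarrow> s i = 0" "(\<Sum>i\<le>d. s i) = 1"
    using s by (auto simp: standard_simplex_def)
  have "0 \<le> cone_point t s j \<and> cone_point t s j \<le> 1" for j
    using t s' by (cases j) (auto simp: cone_point_def intro: mult_le_one)
  moreover have "cone_point t s j = 0" if "j > Suc d" for j
    using that s'(3) by (cases j) (auto simp: cone_point_def)
  moreover have "(\<Sum>j\<le>Suc d. cone_point t s j) = 1"
    unfolding sum.atMost_Suc_shift by (simp add: cone_point_def sum_distrib_left[symmetric] s'(4))
  ultimately show ?thesis by (simp add: standard_simplex_def)
qed

lemma continuous_cone_point:
  "continuous_map (prod_topology (top_of_set {0..1::real}) (subtopology (powertop_real UNIV) (standard_simplex d)))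
     (subtopology (powertop_real UNIV) (standard_simplex (Suc d))) (\<lambda>p. cone_point (1 - fst p) (snd p))"
proof -
  have dom: "prod_topology (top_of_set {0..1::real}) (top_of_set (standard_simplex d)) = top_of_set ({0..1} \<times> standard_simplex d)"
    by (simp add: prod_topology_subtopology subtopology_subtopology Times_Int_Times)
  have "continuous_on ({0..1} \<times> standard_simplex d) (\<lambda>p. cone_point (1 - fst p) (snd p))"
  proof (rule continuous_on_coordinatewise_then_product)
    fix j
    have "continuous_on ({0..1} \<times> standard_simplex d) (\<lambda>p. snd p i)" for i
      by (rule continuous_on_product_then_coordinatewise[OF continuous_on_snd[OF continuous_on_id]])
    then show "continuous_on ({0..1} \<times> standard_simplex d) (\<lambda>p. cone_point (1 - fst p) (snd p) j)"
      unfolding cone_point_def by (cases j) (auto intro!: continuous_intros)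
  qed
  moreover have "(\<lambda>p. cone_point (1 - fst p) (snd p)) \<in> {0..1} \<times> standard_simplex d \<rightarrow> standard_simplex (Suc d)"
    by (auto intro!: cone_point_in_simplex)
  ultimately show ?thesis unfolding euclidean_product_topology dom by simp
qed

text \<open>The product with a fixed space distributes over disjoint sums: the summands are open.\<close>

lemma continuous_map_prod_sum_topology:
  assumes "\<And>i. i \<in> I \<Longrightarrow> continuous_map (prod_topology Z (X i)) Y (\<lambda>(t, s). h (t, (i, s)))"
  shows "continuous_map (prod_topology Z (sum_topology X I)) Y h"
  unfolding continuous_map_def
proof (intro conjI allI impI)
  show "h \<in> topspace (prod_topology Z (sum_topology X I)) \<rightarrow> topspace Y"
  proof (rule Pi_I)
    fix p assume p: "p \<in> topspace (prod_topology Z (sum_topology X I))"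
    obtain t i s where p': "p = (t, (i, s))" by (cases p)
    have i: "i \<in> I" and ts: "(t, s) \<in> topspace (prod_topology Z (X i))" using p p' by auto
    have "(\<lambda>(t, s). h (t, (i, s))) \<in> topspace (prod_topology Z (X i)) \<rightarrow> topspace Y"
      using assms[OF i] unfolding continuous_map_def by (rule conjunct1)
    from funcset_mem[OF this ts] show "h p \<in> topspace Y" by (simp add: p')
  qed
  fix W assume W: "openin Y W"
  show "openin (prod_topology Z (sum_topology X I)) {p \<in> topspace (prod_topology Z (sum_topology X I)). h p \<in> W}"
    unfolding openin_prod_topology_alt
  proof (intro allI impI)
    fix t a assume ta: "(t, a) \<in> {p \<in> topspace (prod_topology Z (sum_topology X I)). h p \<in> W}"
    obtain i s where a: "a = (i, s)" by (cases a)
    have i: "i \<in> I" and ts: "t \<in> topspace Z" "s \<in> topspace (X i)" "h (t, (i, s)) \<in> W" using ta a by auto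
    let ?P = "{p \<in> topspace (prod_topology Z (X i)). (\<lambda>(t, s). h (t, (i, s))) p \<in> W}"
    have "openin (prod_topology Z (X i)) ?P"
      by (rule openin_continuous_map_preimage[OF assms[OF i] W])
    moreover have "(t, s) \<in> ?P" using ts by simp
    ultimately obtain U V where UV: "openin Z U" "openin (X i) V" "t \<in> U" "s \<in> V" "U \<times> V \<subseteq> ?P"
      unfolding openin_prod_topology_alt by meson
    have "openin (sum_topology X I) (Pair i ` V)"
      using open_map_component_injection[OF i, of X] UV(2) unfolding open_map_def by blast
    moreover have "U \<times> Pair i ` V \<subseteq> {p \<in> topspace (prod_topology Z (sum_topology X I)). h p \<in> W}"
      using UV(5) i by auto
    ultimately show "\<exists>U V. openin Z U \<and> openin (sum_topology X I) V \<and> t \<in> U \<and> a \<in> V \<and>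
        U \<times> V \<subseteq> {p \<in> topspace (prod_topology Z (sum_topology X I)). h p \<in> W}"
      using UV(1,3,4) a by (intro exI[of _ U] exI[of _ "Pair i ` V"]) simp
  qed
qed

text \<open>The map \<open>K\<close> assigns to each simplex a cone on it, naturally and with common apex \<open>v\<close> (an extra
  degeneracy). The contraction moves a point \<open>s\<close> of the simplex \<open>x\<close> along the segment in the cone \<open>K x\<close>
  from \<open>s\<close>, regarded as a point of the face opposite the apex, to the apex. Naturality is compatibility
  with the gluing. The resulting map on the realization is continuous because the
  product of a quotient map with the identity of the locally compact unit interval is a quotient map.\<close>

lemma realization_contractible_if_cone:
  assumes X: "simplicial_set X"
    and cone: "\<And>d x. x \<in> simplices X d \<Longrightarrow> K d x \<in> simplices X (Suc d)"
    and nat: "\<And>m d \<theta> x. \<theta> \<in> simplex_maps m d \<Longrightarrow> x \<in> simplices X d \<Longrightarrow>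
      K m (act X m d \<theta> x) = act X (Suc m) (Suc d) (cone_lift m \<theta>) (K d x)"
    and face: "\<And>d x. x \<in> simplices X d \<Longrightarrow> act X d (Suc d) (restrict Suc {..d}) (K d x) = x"
    and apex: "\<And>d x. x \<in> simplices X d \<Longrightarrow> act X 0 (Suc d) (restrict (\<lambda>i. 0) {..0}) (K d x) = v"
  shows "contractible_space (realization X)"
proof -
  let ?I = "top_of_set {0..1::real}"
  \<comment> \<open>The contraction, on the disjoint union of the cells before gluing.\<close>
  define h where "h p = (case p of (t, ((d, x), s)) \<Rightarrow> cell_class X ((Suc d, K d x), cone_point (1 - t) s))"
    for p :: "real \<times> 'a cell_point"
  have cont: "continuous_map (prod_topology ?I (cells X)) (realization X) h"
    unfolding cells_def
  proof (rule continuous_map_prod_sum_topology)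
    fix i assume "i \<in> (SIGMA d:UNIV. simplices X d)"
    then obtain d x where i: "i = (d, x)" and x: "x \<in> simplices X d" by blast
    have "(Suc d, K d x) \<in> (SIGMA d:UNIV. simplices X d)" using cone[OF x] by simp
    from continuous_map_component_injection[OF this, of "\<lambda>(d, x). subtopology (powertop_real UNIV) (standard_simplex d)"]
    have "continuous_map (subtopology (powertop_real UNIV) (standard_simplex (Suc d))) (cells X) (\<lambda>s. ((Suc d, K d x), s))"
      by (simp add: cells_def)
    from continuous_map_compose[OF continuous_map_compose[OF continuous_cone_point this] quotient_imp_continuous_map[OF quotient_map_realization]]
    show "continuous_map (prod_topology ?I (case i of (d, x) \<Rightarrow> subtopology (powertop_real UNIV) (standard_simplex d)))
          (realization X) (\<lambda>(t, s). h (t, (i, s)))"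
      by (simp add: i h_def o_def case_prod_unfold)
  qed
  have h_glue: "h (t, a) = h (t, b)" if "glue X a b" and t: "t \<in> {0..1}" for a b t
    using that(1)
  proof cases
    case (1 \<theta> m d x s)
    have "h (t, a) = cell_class X ((Suc m, act X (Suc m) (Suc d) (cone_lift m \<theta>) (K d x)), cone_point (1 - t) s)"
      using 1 nat by (simp add: h_def)
    also have "\<dots> = cell_class X ((Suc d, K d x), simplex_push (Suc m) (cone_lift m \<theta>) (cone_point (1 - t) s))"
      by (rule cell_class_act[OF cone_lift_in_simplex_maps[OF 1(3)] cone[OF 1(4)] cone_point_in_simplex[OF 1(5)]])
         (use t in auto)
    also have "\<dots> = h (t, b)" using 1 by (simp add: h_def simplex_push_cone_point)
    finally show ?thesis .
  qed
  have h_eq: "h (t, a) = h (t, b)" if "equivclp (glue X) a b" and t: "t \<in> {0..1}" for a b t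
    using that(1)
  proof (induction rule: equivclp_induct)
    case (step y z)
    then show ?case using h_glue[OF _ t] by metis
  qed simp
  have loc: "locally_compact_space ?I"
    by (intro compact_imp_locally_compact_space) (simp add: compact_space_subtopology)
  have "Hausdorff_space ?I" by (simp add: Hausdorff_space_subtopology)
  then have Q: "quotient_map (prod_topology ?I (cells X)) (prod_topology ?I (realization X)) (\<lambda>(t, a). (t, cell_class X a))"
    by (intro quotient_map_prod_right loc quotient_map_realization disjI1)
  obtain g where g: "continuous_map (prod_topology ?I (realization X)) (realization X) g"
    "\<And>p. p \<in> topspace (prod_topology ?I (cells X)) \<Longrightarrow> g ((\<lambda>(t, a). (t, cell_class X a)) p) = h p"
  proof (rule quotient_map_lift_exists[OF Q cont])
    fix p q assume pq: "p \<in> topspace (prod_topology ?I (cells X))" "q \<in> topspace (prod_topology ?I (cells X))"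
      "(\<lambda>(t, a). (t, cell_class X a)) p = (\<lambda>(t, a). (t, cell_class X a)) q"
    obtain t a where p: "p = (t, a)" by (cases p)
    obtain t' b where q: "q = (t', b)" by (cases q)
    show "h p = h q" using pq h_eq[of a b t] unfolding p q by (simp add: cell_class_eq_iff)
  qed blast
  have "homotopic_with (\<lambda>x. True) (realization X) (realization X) id (\<lambda>_. cell_class X ((0, v), simplex_vertex))"
  proof (subst homotopic_with)
    have gt: "g (t, cell_class X ((d, x), s)) = cell_class X ((Suc d, K d x), cone_point (1 - t) s)"
      if "x \<in> simplices X d" "s \<in> standard_simplex d" "t \<in> {0..1}" for t d x s
      using g(2)[of "(t, ((d, x), s))"] that by (simp add: topspace_cells h_def)
    have g0: "g (0, C) = id C \<and> g (1, C) = cell_class X ((0, v), simplex_vertex)" if C: "C \<in> topspace (realization X)" for C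
    proof -
      obtain d x s where C: "C = cell_class X ((d, x), s)" and x: "x \<in> simplices X d" and s: "s \<in> standard_simplex d"
        using C unfolding topspace_realization topspace_cells by auto
      have "g (0, C) = cell_class X ((Suc d, K d x), simplex_push d (restrict Suc {..d}) s)"
        using gt[OF x s, of 0] C simplex_push_Suc[OF s] by simp
      also have "\<dots> = C"
        using cell_class_act[OF Suc_in_simplex_maps cone[OF x] s] face[OF x] C by simp
      finally have 0: "g (0, C) = C" .
      have "g (1, C) = cell_class X ((Suc d, K d x), simplex_push 0 (restrict (\<lambda>i. 0) {..0}) simplex_vertex)"
        using gt[OF x s, of 1] C simplex_push_vertex[OF simplex_vertex_in[of 0]] by (simp add: cone_point_0)
      also have "\<dots> = cell_class X ((0, v), simplex_vertex)"
        using cell_class_act[OF vertex_in_simplex_maps cone[OF x] simplex_vertex_in[of 0]] apex[OF x] by simp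
      finally show ?thesis using 0 by simp
    qed
    show "\<exists>h. continuous_map (prod_topology (top_of_set {0..1::real}) (realization X)) (realization X) h \<and>
      (\<forall>x\<in>topspace (realization X). h (0, x) = id x) \<and>
      (\<forall>x\<in>topspace (realization X). h (1, x) = cell_class X ((0, v), simplex_vertex)) \<and> (\<forall>t\<in>{0..1::real}. True)"
      using g(1) g0 by (intro exI[of _ g]) simp
  qed simp
  then show ?thesis unfolding contractible_space_def by blast
qed

lemma simplicial_set_point: "simplicial_set sset_point"
  by (simp add: simplicial_set_def sset_point_def)

lemma cell_in_topspace_cells:
  "((d, x), s) \<in> topspace (cells X) \<longleftrightarrow> x \<in> simplices X d \<and> s \<in> standard_simplex d"
  by (simp add: topspace_cells)

text \<open>Every point of every cell is glued to the vertex by the operator to \<open>[0]\<close>.\<close>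

lemma topspace_realization_point:
  "topspace (realization sset_point) = {cell_class sset_point ((0, ()), simplex_vertex)}"
proof -
  have eq: "cell_class sset_point ((d, ()), s) = cell_class sset_point ((0, ()), simplex_vertex)"
    if "s \<in> standard_simplex d" for d s
    using cell_class_act[OF vertex_in_simplex_maps[of d 0], of "()" sset_point s] that
    by (simp add: sset_point_def simplex_push_vertex)
  have "((0, ()), simplex_vertex) \<in> topspace (cells sset_point)"
    by (simp add: topspace_cells sset_point_def simplex_vertex_in)
  then have mem: "cell_class sset_point ((0, ()), simplex_vertex) \<in> topspace (realization sset_point)"
    unfolding topspace_realization by (rule imageI)
  have uniq: "C = cell_class sset_point ((0, ()), simplex_vertex)"
    if C: "C \<in> topspace (realization sset_point)" for C
  proof -
    obtain a where a: "a \<in> topspace (cells sset_point)" "C = cell_class sset_point a"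
      using C unfolding topspace_realization by (rule imageE)
    obtain c s where c: "a = (c, s)" by (rule prod.exhaust)
    obtain d u where "c = (d, u)" by (rule prod.exhaust)
    then have a': "a = ((d, u), s)" by (simp only: c)
    have "s \<in> standard_simplex d" using a(1) unfolding a' cell_in_topspace_cells by (rule conjunct2)
    from eq[OF this] show ?thesis unfolding a(2) a' unit_eq[of u] .
  qed
  show ?thesis
  proof (intro equalityI subsetI)
    fix C assume "C \<in> topspace (realization sset_point)"
    then show "C \<in> {cell_class sset_point ((0, ()), simplex_vertex)}" unfolding singleton_iff by (rule uniq)
  next
    fix C assume "C \<in> {cell_class sset_point ((0, ()), simplex_vertex)}"
    then have "C = cell_class sset_point ((0, ()), simplex_vertex)" by (rule singletonD)
    with mem show "C \<in> topspace (realization sset_point)" by (simp only:)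
  qed
qed

text \<open>It remains to see that the map induced on the realization is the constant map to the only point,
  and that the realization is nonempty.\<close>

lemma sset_contractible_if_realization_contractible:
  assumes X: "simplicial_set X" and x0: "x0 \<in> simplices X 0" and contr: "contractible_space (realization X)"
  shows "sset_contractible X"
proof -
  let ?p = "cell_class sset_point ((0, ()), simplex_vertex)" and ?f = "realization_map sset_point (\<lambda>d x. ())"
  have f: "?f C = ?p" if C: "C \<in> topspace (realization X)" for C
  proof -
    obtain a where a: "a \<in> topspace (cells X)" "C = cell_class X a"
      using C unfolding topspace_realization by (rule imageE)
    have p: "cell_class sset_point ((d, ()), s) = ?p" if "((d, x), s) \<in> C" for d x s
    proof -
      have "((d, x), s) \<in> topspace (cells X)"
        by (rule equivclp_in_cells[OF X _ a(1)]) (use that in \<open>simp add: a(2) cell_class_def\<close>)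
      then have "((d, ()), s) \<in> topspace (cells sset_point)" by (simp add: topspace_cells sset_point_def)
      then have "cell_class sset_point ((d, ()), s) \<in> topspace (realization sset_point)"
        unfolding topspace_realization by (rule imageI)
      then show ?thesis unfolding topspace_realization_point by simp
    qed
    have "realization_map sset_point (\<lambda>d x. ()) C = (\<Union>b\<in>C. ?p)"
      unfolding realization_map_def
    proof (rule SUP_cong[OF refl])
      fix b assume b: "b \<in> C"
      obtain c s where c: "b = (c, s)" by (rule prod.exhaust)
      obtain d x where "c = (d, x)" by (rule prod.exhaust)
      then have b': "b = ((d, x), s)" by (simp only: c)
      show "(case b of (x, xa) \<Rightarrow> (case x of (d, x) \<Rightarrow> \<lambda>s. cell_class sset_point ((d, ()), s)) xa) = ?p"
        using p b unfolding b' by simp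
    qed
    also have "\<dots> = ?p"
    proof (rule SUP_const, rule notI)
      assume "C = {}"
      moreover have "a \<in> C" unfolding a(2) cell_class_def by simp
      ultimately show False by simp
    qed
    finally show ?thesis .
  qed
  have "continuous_map (realization X) (realization sset_point) (\<lambda>C. ?p)"
    using topspace_realization_point by simp
  then have cont: "continuous_map (realization X) (realization sset_point) ?f"
    by (rule continuous_map_eq) (simp add: f)
  have "((0, x0), simplex_vertex) \<in> topspace (cells X)" using x0 simplex_vertex_in by (simp add: topspace_cells)
  then have ne: "topspace (realization X) \<noteq> {}" unfolding topspace_realization by (simp only: image_is_empty) (rule notI, simp only: empty_iff)
  have "contractible_space (realization sset_point)"
    by (rule contractible_space_subset_singleton) (simp add: topspace_realization_point)
  then have "weak_homotopy_equivalence (realization X) (realization sset_point) ?f"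
    by (rule weak_homotopy_equivalence_contractible[OF contr ne _ cont])
  moreover have "sset_map X sset_point (\<lambda>d x. ())" by (simp add: sset_map_def sset_point_def)
  ultimately show ?thesis
    using X simplicial_set_point by (simp add: sset_contractible_def weak_equivalence_def)
qed

section \<open>Contractibility of the simplicial set of flat metrics\<close>

lemma simplex_push_id:
  assumes "s \<in> standard_simplex d"
  shows "simplex_push d (restrict id {..d}) s = s"
proof
  fix j
  show "simplex_push d (restrict id {..d}) s j = s j"
  proof (cases "j \<le> d")
    case True
    then have "{i \<in> {..d}. restrict id {..d} i = j} = {j}" by auto
    then show ?thesis by (simp add: simplex_push_def)
  next
    case False
    then have "{i \<in> {..d}. restrict id {..d} i = j} = {}" by auto
    moreover have "s j = 0" using assms False by (simp add: standard_simplex_def)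
    ultimately show ?thesis by (simp add: simplex_push_def)
  qed
qed

lemma simplex_push_compose:
  assumes \<eta>: "\<eta> \<in> simplex_maps k m"
  shows "simplex_push k (compose {..k} \<theta> \<eta>) s = simplex_push m \<theta> (simplex_push k \<eta> s)"
proof
  fix j
  let ?L = "{l \<in> {..m}. \<theta> l = j}"
  have \<eta>': "\<And>i. i \<le> k \<Longrightarrow> \<eta> i \<le> m" using \<eta> by (auto simp: simplex_maps_def PiE_iff)
  have eq: "{i \<in> {..k}. compose {..k} \<theta> \<eta> i = j} = (\<Union>l\<in>?L. {i \<in> {..k}. \<eta> i = l})"
    using \<eta>' by (auto simp: compose_def)
  have "sum s (\<Union>l\<in>?L. {i \<in> {..k}. \<eta> i = l}) = (\<Sum>l\<in>?L. sum s {i \<in> {..k}. \<eta> i = l})"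
    by (rule sum.UNION_disjoint) auto
  then show "simplex_push k (compose {..k} \<theta> \<eta>) s j = simplex_push m \<theta> (simplex_push k \<eta> s) j"
    unfolding simplex_push_def eq .
qed

context manifold_with_atlas
begin

lemma FMet_simplices:
  "G \<in> simplices (FMet n A U) d \<longleftrightarrow> (\<forall>s\<in>standard_simplex d. flat_metric n A U (G s)) \<and>
     smooth_family n A U d G \<and> (\<forall>s. s \<notin> standard_simplex d \<longrightarrow> G s = (\<lambda>p v w. 0))"
  by (simp add: FMet_def)

lemma FMet_act: "act (FMet n A U) m d \<theta> G =
   (\<lambda>s. if s \<in> standard_simplex m then G (simplex_push m \<theta> s) else (\<lambda>p v w. 0))"
  by (simp add: FMet_def fun_eq_iff)

text \<open>The operator acts on the parameters by a linear map, with which the family is composed.\<close>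

lemma smooth_family_push:
  assumes G: "smooth_family n A U d G" and \<theta>: "\<theta> \<in> simplex_maps m d"
  shows "smooth_family n A U m (act (FMet n A U) m d \<theta> G)"
  unfolding smooth_family_def
proof (intro ballI, clarify)
  fix V \<phi> i j assume V: "(V, \<phi>) \<in> A" and ij: "i < n" "j < n"
  let ?S = "\<lambda>d. {z \<in> Rn (n + Suc d). chart_part n z \<in> \<phi> ` (V \<inter> U) \<and> simplex_part n z \<in> standard_simplex d}"
  let ?F = "\<lambda>z. metric_component n A (G (simplex_part n z)) (V, \<phi>) i j (inv_into V \<phi> (chart_part n z))"
  define P where "P z = (\<lambda>k. if k < n then z k else if k < n + Suc d then \<Sum>l\<in>{l \<in> {..m}. \<theta> l = k - n}. z (n + l) else 0)"
    for z :: "nat \<Rightarrow> real"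
  have F: "smooth_on_subset (n + Suc d) (?S d) ?F"
    using G V ij unfolding smooth_family_def by blast
  have SE: "?S m \<subseteq> Rn (n + Suc m)" by blast
  have ch: "chart_part n (P z) = chart_part n z" for z by (auto simp: chart_part_def P_def fun_eq_iff)
  have si: "simplex_part n (P z) = simplex_push m \<theta> (simplex_part n z)" for z
  proof
    fix k
    have "\<forall>l\<le>m. \<theta> l < Suc d" using \<theta> by (auto simp: simplex_maps_def PiE_iff less_Suc_eq_le)
    then have empty: "{l \<in> {..m}. \<theta> l = k} = {}" if "\<not> k < Suc d" using that by auto
    show "simplex_part n (P z) k = simplex_push m \<theta> (simplex_part n z) k"
    proof (cases "k < Suc d")
      case True
      then show ?thesis by (simp add: simplex_part_def simplex_push_def P_def)
    next
      case False
      then have "simplex_push m \<theta> (simplex_part n z) k = 0"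
        unfolding simplex_push_def empty[OF False] by simp
      then show ?thesis using False by (simp add: simplex_part_def P_def)
    qed
  qed
  have "smooth_on_subset (n + Suc m) (?S m) (\<lambda>z. ?F (P z))"
  proof (rule smooth_on_subset_compose[OF F _ _ _ SE])
    show "smooth_on_subset (n + Suc m) (?S m) (\<lambda>z. P z k)" if k: "k < n + Suc d" for k
    proof (cases "k < n")
      case True
      then have "(\<lambda>z. P z k) = (\<lambda>z. z k)" by (simp add: P_def)
      then show ?thesis using smooth_on_subset_coordinate[OF SE] by (simp only:)
    next
      case False
      then have "(\<lambda>z. P z k) = (\<lambda>z. \<Sum>l\<in>{l \<in> {..m}. \<theta> l = k - n}. z (n + l))"
        using k by (simp add: P_def)
      moreover have "smooth_on_subset (n + Suc m) (?S m) (\<lambda>z. \<Sum>l\<in>{l \<in> {..m}. \<theta> l = k - n}. z (n + l))"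
        by (intro smooth_on_subset_sum[OF SE] smooth_on_subset_coordinate[OF SE])
      ultimately show ?thesis by (simp only:)
    qed
    show "P z \<in> ?S d" if "z \<in> ?S m" for z
      using that simplex_push_in_simplex[OF \<theta>] by (simp add: ch si) (simp add: P_def topspace_Euclidean_space)
  qed blast
  then show "smooth_on_subset (n + Suc m) (?S m) (\<lambda>z. metric_component n A
      (act (FMet n A U) m d \<theta> G (simplex_part n z)) (V, \<phi>) i j (inv_into V \<phi> (chart_part n z)))"
    by (rule smooth_on_subset_cong) (simp add: ch si FMet_act)
qed

lemma simplicial_set_FMet: "simplicial_set (FMet n A U)"
  unfolding simplicial_set_def
proof (intro conjI allI ballI)
  fix m d \<theta> G assume \<theta>: "\<theta> \<in> simplex_maps m d" and G: "G \<in> simplices (FMet n A U) d"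
  show "act (FMet n A U) m d \<theta> G \<in> simplices (FMet n A U) m"
    using G smooth_family_push[OF _ \<theta>, of U G] simplex_push_in_simplex[OF \<theta>]
    unfolding FMet_simplices by (auto simp: FMet_act)
next
  fix d G assume G: "G \<in> simplices (FMet n A U) d"
  show "act (FMet n A U) d d (restrict id {..d}) G = G"
  proof
    fix s show "act (FMet n A U) d d (restrict id {..d}) G s = G s"
      using G unfolding FMet_simplices FMet_act by (cases "s \<in> standard_simplex d") (simp_all add: simplex_push_id)
  qed
next
  fix k m d \<eta> \<theta> G assume \<eta>: "\<eta> \<in> simplex_maps k m" and \<theta>: "\<theta> \<in> simplex_maps m d"
  show "act (FMet n A U) k d (compose {..k} \<theta> \<eta>) G = act (FMet n A U) k m \<eta> (act (FMet n A U) m d \<theta> G)"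
    using simplex_push_in_simplex[OF \<eta>] by (simp add: FMet_act simplex_push_compose[OF \<eta>] fun_eq_iff)
qed

definition metric_family ::
    "'a chart \<Rightarrow> nat \<Rightarrow> ((nat \<Rightarrow> real) \<Rightarrow> nat \<Rightarrow> nat \<Rightarrow> (nat \<Rightarrow> real) \<Rightarrow> real) \<Rightarrow> (nat \<Rightarrow> real) \<Rightarrow> 'a metric_field" where
  "metric_family c d b s = (if s \<in> standard_simplex d then metric_of n A c (b s) else (\<lambda>p v w. 0))"

lemma metric_family_in_FMet:
  assumes c0: "c0 \<in> A"
    and flat: "\<And>s. s \<in> standard_simplex d \<Longrightarrow> flat_coefficients n (snd c0 ` fst c0) (b s)"
    and smooth: "\<And>k l. k < n \<Longrightarrow> l < n \<Longrightarrow> smooth_on_subset (n + Suc d) (product_domain n d (snd c0 ` fst c0))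
        (\<lambda>z. b (simplex_part n z) k l (chart_part n z))"
  shows "metric_family c0 d b \<in> simplices (FMet n A (fst c0)) d"
  unfolding FMet_simplices
proof (intro conjI ballI allI impI)
  fix s assume "s \<in> standard_simplex d"
  then show "flat_metric n A (fst c0) (metric_family c0 d b s)"
    using flat_metric_metric_of[OF flat c0] by (simp add: metric_family_def)
next
  show "smooth_family n A (fst c0) d (metric_family c0 d b)"
    unfolding smooth_family_def
  proof (intro ballI, clarify)
    fix V \<phi> i j assume V: "(V, \<phi>) \<in> A" and ij: "i < n" "j < n"
    have "smooth_on_subset (n + Suc d)
        {z \<in> Rn (n + Suc d). chart_part n z \<in> snd (V, \<phi>) ` (fst (V, \<phi>) \<inter> fst c0) \<and> simplex_part n z \<in> standard_simplex d}
        (\<lambda>z. metric_component n A (metric_of n A c0 (b (simplex_part n z))) (V, \<phi>) i j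
               (inv_into (fst (V, \<phi>)) (snd (V, \<phi>)) (chart_part n z)))"
      by (rule metric_of_family_smooth[OF V c0 ij smooth[unfolded product_domain_def]])
    then show "smooth_on_subset (n + Suc d)
        {z \<in> Rn (n + Suc d). chart_part n z \<in> \<phi> ` (V \<inter> fst c0) \<and> simplex_part n z \<in> standard_simplex d}
        (\<lambda>z. metric_component n A (metric_family c0 d b (simplex_part n z)) (V, \<phi>) i j (inv_into V \<phi> (chart_part n z)))"
      unfolding fst_conv snd_conv by (rule smooth_on_subset_cong) (simp add: metric_family_def)
  qed
qed (simp add: metric_family_def)

lemma FMet_coefficients:
  assumes c0: "c0 \<in> A" and G: "G \<in> simplices (FMet n A (fst c0)) d"
  shows FMet_coefficients_flat: "\<And>s. s \<in> standard_simplex d \<Longrightarrow> flat_coefficients n (snd c0 ` fst c0) (coefficients n A c0 (G s))"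
    and FMet_coefficients_smooth: "\<And>k l. k < n \<Longrightarrow> l < n \<Longrightarrow> smooth_on_subset (n + Suc d) (product_domain n d (snd c0 ` fst c0))
        (\<lambda>z. coefficients n A c0 (G (simplex_part n z)) k l (chart_part n z))"
    and FMet_metric_of_coefficients: "\<And>s. s \<in> standard_simplex d \<Longrightarrow> metric_of n A c0 (coefficients n A c0 (G s)) = G s"
proof -
  fix s assume "s \<in> standard_simplex d"
  then have flat: "flat_metric n A (fst c0) (G s)" using G unfolding FMet_simplices by blast
  show "flat_coefficients n (snd c0 ` fst c0) (coefficients n A c0 (G s))"
    by (rule flat_metric_coefficients[OF flat c0])
  have "riemannian_metric n A (fst c0) (G s)" using flat unfolding flat_metric_def by (rule conjunct1)
  then show "metric_of n A c0 (coefficients n A c0 (G s)) = G s" by (rule metric_of_coefficients[OF _ c0])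
next
  fix k l assume kl: "k < n" "l < n"
  have "smooth_family n A (fst c0) d G" using G unfolding FMet_simplices by blast
  then have "\<forall>(V, \<phi>)\<in>A. \<forall>i<n. \<forall>j<n. smooth_on_subset (n + Suc d)
          {z \<in> Rn (n + Suc d).
             chart_part n z \<in> \<phi> ` (V \<inter> fst c0) \<and> simplex_part n z \<in> standard_simplex d}
          (\<lambda>z. metric_component n A (G (simplex_part n z)) (V, \<phi>) i j (inv_into V \<phi> (chart_part n z)))"
    unfolding smooth_family_def .
  from bspec[OF this c0] kl show "smooth_on_subset (n + Suc d) (product_domain n d (snd c0 ` fst c0))
        (\<lambda>z. coefficients n A c0 (G (simplex_part n z)) k l (chart_part n z))"
    by (simp add: case_prod_unfold product_domain_def coefficients_def)
qed

definition cone_metric :: "'a chart \<Rightarrow> nat \<Rightarrow> ((nat \<Rightarrow> real) \<Rightarrow> 'a metric_field) \<Rightarrow> (nat \<Rightarrow> real) \<Rightarrow> 'a metric_field" where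
  "cone_metric c d G = metric_family c (Suc d) (cone_coefficients (\<lambda>s. coefficients n A c (G s)))"

text \<open>The cone on a family of metrics is the one whose coefficients in the chart \<open>c0\<close> are
  \<^const>\<open>cone_coefficients\<close>. Naturality holds because these depend on the family only through its
  values at the normalized point of the face, and normalization commutes with simplicial operators.\<close>

lemma FMet_contractible_of_ball_chart:
  assumes c0: "c0 \<in> A" and ball: "snd c0 ` fst c0 = unit_ball n"
  shows "sset_contractible (FMet n A (fst c0))"
proof -
  let ?X = "FMet n A (fst c0)"
  note C = FMet_coefficients[OF c0, unfolded ball]
  have cone: "cone_metric c0 d G \<in> simplices ?X (Suc d)" if G: "G \<in> simplices ?X d" for d G
    unfolding cone_metric_def
  proof (rule metric_family_in_FMet[OF c0, unfolded ball])
    show "flat_coefficients n (unit_ball n) (cone_coefficients (\<lambda>s. coefficients n A c0 (G s)) s)"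
      if "s \<in> standard_simplex (Suc d)" for s
      by (rule cone_coefficients_flat[OF C(1)[OF G] that])
    show "smooth_on_subset (n + Suc (Suc d)) (product_domain n (Suc d) (unit_ball n))
        (\<lambda>z. cone_coefficients (\<lambda>s. coefficients n A c0 (G s)) (simplex_part n z) k l (chart_part n z))"
      if "k < n" "l < n" for k l
      by (rule cone_coefficients_smooth[where b = "\<lambda>s. coefficients n A c0 (G s)", OF C(2)[OF G that]])
  qed
  have nat: "cone_metric c0 m (act ?X m d \<theta> G) = act ?X (Suc m) (Suc d) (cone_lift m \<theta>) (cone_metric c0 d G)"
    if \<theta>: "\<theta> \<in> simplex_maps m d" for m d \<theta> G
  proof
    fix s
    show "cone_metric c0 m (act ?X m d \<theta> G) s = act ?X (Suc m) (Suc d) (cone_lift m \<theta>) (cone_metric c0 d G) s"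
    proof (cases "s \<in> standard_simplex (Suc m)")
      case True
      have push: "simplex_push (Suc m) (cone_lift m \<theta>) s \<in> standard_simplex (Suc d)"
        by (rule simplex_push_in_simplex[OF cone_lift_in_simplex_maps[OF \<theta>] True])
      have "cone_coefficients (\<lambda>s. coefficients n A c0 (act ?X m d \<theta> G s)) s =
          cone_coefficients (\<lambda>s. coefficients n A c0 (G s)) (simplex_push (Suc m) (cone_lift m \<theta>) s)"
      \<comment> \<open>At the apex the normalized coordinates are meaningless, but there the family does not contribute.\<close>
      proof (cases "s 0 < 1")
        case s0: True
        have "(\<lambda>k. simplex_push (Suc m) (cone_lift m \<theta>) s (Suc k) * (1 / (1 - s 0))) =
            simplex_push m \<theta> (\<lambda>k. s (Suc k) * (1 / (1 - s 0)))"
          by (rule ext) (simp only: simplex_push_cone_lift_Suc simplex_push_scale)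
        then show ?thesis
          using simplex_tail[OF True s0]
          by (intro ext) (simp only: cone_coefficients_def simplex_push_cone_lift_0 FMet_act if_True)
      next
        case False
        then have "ramp (1 - 3 / 2 * s 0) = 0" by (simp add: ramp_eq_0_iff)
        then show ?thesis
          by (intro ext) (simp only: cone_coefficients_def simplex_push_cone_lift_0 mult_zero_left)
      qed
      then show ?thesis using True push by (simp add: cone_metric_def metric_family_def FMet_act)
    qed (simp add: cone_metric_def metric_family_def FMet_act)
  qed
  have face: "act ?X d (Suc d) (restrict Suc {..d}) (cone_metric c0 d G) = G" if G: "G \<in> simplices ?X d" for d G
  proof
    fix s
    show "act ?X d (Suc d) (restrict Suc {..d}) (cone_metric c0 d G) s = G s"
    proof (cases "s \<in> standard_simplex d")
      case True
      have "cone_coefficients (\<lambda>s. coefficients n A c0 (G s)) (cone_point 1 s) = coefficients n A c0 (G s)"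
        by (intro ext) (simp add: cone_coefficients_def cone_point_def ramp_1 ramp_eq_0_iff[THEN iffD2])
      then show ?thesis
        using True cone_point_in_simplex[OF True, of 1] C(3)[OF G True]
        by (simp add: FMet_act simplex_push_Suc cone_metric_def metric_family_def)
    next
      case False
      then show ?thesis using G unfolding FMet_simplices FMet_act by simp
    qed
  qed
  define v where "v = metric_family c0 0 (\<lambda>s i j x. ramp 2 * (if i = j then 1 else 0))"
  have apex: "act ?X 0 (Suc d) (restrict (\<lambda>i. 0) {..0}) (cone_metric c0 d G) = v" for d G
  proof
    fix s
    show "act ?X 0 (Suc d) (restrict (\<lambda>i. 0) {..0}) (cone_metric c0 d G) s = v s"
    proof (cases "s \<in> standard_simplex 0")
      case True
      have "cone_coefficients (\<lambda>s. coefficients n A c0 (G s)) simplex_vertex = (\<lambda>i j x. ramp 2 * (if i = j then 1 else 0))"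
        by (intro ext) (simp add: cone_coefficients_def simplex_vertex_def ramp_eq_0_iff[THEN iffD2])
      then show ?thesis
        using True simplex_vertex_in[of "Suc d"] simplex_push_vertex[OF True]
        by (simp add: FMet_act cone_metric_def metric_family_def v_def)
    qed (simp add: FMet_act v_def metric_family_def)
  qed
  have "contractible_space (realization ?X)"
  proof (rule realization_contractible_if_cone[OF simplicial_set_FMet, where K = "cone_metric c0" and v = v])
    show "cone_metric c0 m (act ?X m d \<theta> G) = act ?X (Suc m) (Suc d) (cone_lift m \<theta>) (cone_metric c0 d G)"
      if "\<theta> \<in> simplex_maps m d" for m d \<theta> G
      by (rule nat[OF that])
  qed (rule cone face apex; assumption?)+
  moreover have "metric_family c0 0 (\<lambda>s i j x. if i = j then 1 else 0) \<in> simplices ?X 0"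
  proof (rule metric_family_in_FMet[OF c0, unfolded ball])
    show "flat_coefficients n (unit_ball n) (\<lambda>i j x. if i = j then 1 else 0)"
    proof (rule flat_coefficients_constant[OF unit_ball_open])
      fix v :: "nat \<Rightarrow> real" and i assume v: "i < n" "v i \<noteq> 0"
      have "(\<Sum>i<n. \<Sum>j<n. (if i = j then 1 else 0) * (v i * v j)) = (\<Sum>i<n. v i * v i)"
        by (intro sum.cong refl sum_kronecker) simp
      moreover have "0 < (\<Sum>i<n. v i * v i)"
        by (rule sum_pos2[of _ i]) (use v in \<open>auto simp: zero_less_mult_iff\<close>)
      ultimately show "0 < (\<Sum>i<n. \<Sum>j<n. (if i = j then 1 else 0) * v i * v j)" by (simp only: mult.assoc)
    qed (simp add: eq_commute)
    show "smooth_on_subset (n + Suc 0) (product_domain n 0 (unit_ball n)) (\<lambda>z. if k = l then 1 else 0)" for k l :: nat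
      by (rule smooth_on_subset_const[OF product_domain_subset])
  qed
  ultimately show ?thesis
    by (intro sset_contractible_if_realization_contractible[OF simplicial_set_FMet])
qed

text \<open>The conditions on a diffeomorphism are those on a chart compatible with the atlas, which is
  maximal.\<close>

lemma ball_coordinates_chart:
  assumes U: "openin M U" and f: "diffeomorphism n M A U (unit_ball n) f"
  shows "(U, f) \<in> A" "f ` U = unit_ball n"
proof -
  have hom: "homeomorphic_map (subtopology M U) (subtopology (Euclidean_space n) (unit_ball n)) f"
    using f unfolding diffeomorphism_def by (rule conjunct1)
  have sm: "\<forall>(V, \<phi>)\<in>A. \<forall>k<n.
        smooth_on_subset n (\<phi> ` (V \<inter> U)) (\<lambda>x. f (inv_into V \<phi> x) k) \<and>
        smooth_on_subset n (f ` (V \<inter> U)) (\<lambda>x. \<phi> (inv_into U f x) k)"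
    using f unfolding diffeomorphism_def by (rule conjunct2)
  have "topspace (subtopology M U) = U" "topspace (subtopology (Euclidean_space n) (unit_ball n)) = unit_ball n"
    using openin_subset[OF U] openin_subset[OF unit_ball_open[of n]] by (auto simp: topspace_subtopology)
  then show im: "f ` U = unit_ball n" using homeomorphic_imp_surjective_map[OF hom] by simp
  show "(U, f) \<in> A"
  proof (rule chart_by_maximality)
    show "is_chart n M (U, f)" unfolding is_chart_def using U hom unit_ball_open by (simp add: im)
    show "smooth_transition n (U, f) c \<and> smooth_transition n c (U, f)" if "c \<in> A" for c
      using bspec[OF sm that] unfolding smooth_transition_def transition_def
      by (simp add: case_prod_unfold Int_commute)
  qed
qed

end

theorem lemma15p1p1:
  fixes n :: nat and M :: "'a topology" and A :: "'a chart set" and U :: "'a set"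
  assumes "smooth_manifold n M A"
    and "is_ball n M A U"
  shows "sset_contractible (FMet n A U)"
proof -
  interpret manifold_with_atlas n M A by unfold_locales (rule assms(1))
  obtain f where U: "openin M U" and f: "diffeomorphism n M A U (unit_ball n) f"
    using assms(2) unfolding is_ball_def by blast
  show ?thesis
    using FMet_contractible_of_ball_chart[OF ball_coordinates_chart(1)[OF U f]] ball_coordinates_chart(2)[OF U f] by simp
qed

end
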